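(* There exists a (sufficiently small) $\varepsilon_0>0$ such that for every $\varepsilon\in(0,\varepsilon_0)$ the following holds. Let $L$ be a lattice in $\mathbb{R}^8$ such that $\det L\le\frac{10}{9}$ and such that for every $x\in L\setminus\{0\}$ with $\|x\|\le2^{16}$ there exists a positive integer $k$ with $$\big|\,\|x\|^2-2k\,\big|\le\varepsilon.$$ Then there exist $\Phi\in O(8)$, a basis $u_1,\dots,u_8$ of $L$, and a basis $z_1,\dots,z_8$ of $E_8$ with $\max_i\|z_i\|=2$ such that $$\|u_i-\Phi z_i\|\le2^{1000}\cdot\varepsilon\qquad\text{for }i=1,\dots,8.$$
   Context: A lattice in $\mathbb{R}^n$ is a discrete subgroup $L\subset\mathbb{R}^n$ whose $\mathbb{R}$-linear span is $\mathbb{R}^n$; a basis of $L$ is an $n$-tuple $u_1,\dots,u_n$ with $L=\sum_{i=1}^n\mathbb{Z}u_i$, and $\det L=|\det[u_1,\dots,u_n]|$ for any basis. $E_8=\{x\in\mathbb{Z}^8\cup(\mathbb{Z}+\tfrac12)^8:\ \sum_i x_i\in2\mathbb{Z}\}$ is the $E_8$ lattice (determinant $1$, minimal vector length $\sqrt2$); it is, up to orthogonal transformations, the unique lattice in $\mathbb{R}^8$ of determinant $1$ all of whose vectors have even integer squared length. *)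

theory Defs
  imports "HOL-Analysis.Analysis"
begin

definition additive_subgroup_set :: "'a::ab_group_add set \<Rightarrow> bool" where
  "additive_subgroup_set L \<longleftrightarrow>
     0 \<in> L \<and> (\<forall>x\<in>L. \<forall>y\<in>L. x + y \<in> L) \<and> (\<forall>x\<in>L. - x \<in> L)"

definition is_lattice :: "(real ^ 'n) set \<Rightarrow> bool" where
  "is_lattice L \<longleftrightarrow> additive_subgroup_set L \<and> discrete L \<and> span L = UNIV"

definition is_lattice_basis :: "('n \<Rightarrow> real ^ 'n) \<Rightarrow> (real ^ 'n) set \<Rightarrow> bool" where
  "is_lattice_basis u L \<longleftrightarrow>
     L = range (\<lambda>c :: 'n \<Rightarrow> int. \<Sum>i\<in>UNIV. of_int (c i) *\<^sub>R u i)"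

text \<open>
  The value of the description operator is determined only for sets \<open>L\<close> that have a basis and for
  which the displayed determinant does not depend on the basis; every lattice is such a set.
\<close>
definition lattice_det :: "(real ^ 'n) set \<Rightarrow> real" where
  "lattice_det L =
     (THE d. \<exists>u. is_lattice_basis u L \<and> d = \<bar>det (\<chi> i j. u j $ i)\<bar>)"

definition E8_lattice :: "(real ^ 8) set" where
  "E8_lattice =
     {x. ((\<forall>i. x $ i \<in> \<int>) \<or> (\<forall>i. \<exists>m::int. x $ i = of_int m + 1 / 2)) \<and>
         (\<exists>m::int. (\<Sum>i\<in>UNIV. x $ i) = 2 * of_int m)}"

end

theory Submission
  imports Defs
begin

text \<open>
  Suppose that no \<open>\<epsilon>\<^sub>0\<close> works. Counterexamples \<open>L\<^sub>n\<close> with \<open>\<epsilon>\<^sub>n \<rightarrow> 0\<close> have shortest vectors of length at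
  least \<open>1\<close> and bounded determinant, hence Hermite-Korkine-Zolotarev reduced bases of bounded length,
  and a subsequence of these bases converges to a basis of an even lattice with \<open>det\<^sup>2 \<le> 100/81\<close>. Such
  a lattice is isometric to \<open>E\<^sub>8\<close>: successive squared Gram-Schmidt norms of a reduced basis drop by a
  factor of at least \<open>3/4\<close>, and these Hermite bounds together with evenness force the chain of root
  lattices \<open>A\<^sub>1 \<subset> A\<^sub>2 \<subset> A\<^sub>3 = D\<^sub>3 \<subset> D\<^sub>4 \<subset> D\<^sub>5 \<subset> E\<^sub>6 \<subset> E\<^sub>7 \<subset> E\<^sub>8\<close> inside it.

  The integral relation between the limit basis and the standard basis of \<open>E\<^sub>8\<close> gives bases of the
  \<open>L\<^sub>n\<close> that converge to the latter up to an isometry. Eventually the hypothesis on \<open>L\<^sub>n\<close> pins the inner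
  products down to an error \<open>\<epsilon>\<^sub>n\<close>, and Gram-Schmidt orthonormalisation produces \<open>\<Phi>\<close> with an error
  linear in \<open>\<epsilon>\<^sub>n\<close>.
\<close>

section \<open>Orthogonal components and successive minima\<close>

text \<open>Compactness gives no rate, yet the claim is linear in \<epsilon>. The rate comes back
  because norms of the limit are even integers: once a squared norm in \<open>L n\<close> is close
  to its limit, the even integer near it provided by the hypothesis must be that limit, so the
  distance is at most \<epsilon>. The radius 2^16 is ample: reduced bases have length at most 2^13,
  and evenness of the limit is tested only on their vectors and sums of two of them. The factor 3/4
  yields bounds weaker than the sharp Hermite constants, so they do not single out the root lattices
  by themselves: A_1 + A_1 and A_4 survive one step and are refuted by the residue of a later Gram
  determinant. From D_3 on, an orthonormal frame replaces the roots: coordinates of lattice vectors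
  are then all integral or all half-integral, and the four cosets of D_k in its dual leave few
  candidates for the next minimal vector. The constant actually reached is 2^50: a factor 64 for
  each of eight Gram-Schmidt steps, and 4 for passing from the frame to a basis.\<close>

definition perp :: "'a::euclidean_space set \<Rightarrow> 'a \<Rightarrow> 'a" where
  "perp S x = (SOME p. x - p \<in> S \<and> (\<forall>s\<in>S. p \<bullet> s = 0))"

lemma perp_works:
  assumes "subspace S"
  shows perp_in: "x - perp S x \<in> S" and perp_orth: "s \<in> S \<Longrightarrow> perp S x \<bullet> s = 0"
proof -
  obtain y z where "y \<in> span S" "\<And>w. w \<in> span S \<Longrightarrow> orthogonal z w" "x = y + z"
    using orthogonal_subspace_decomp_exists[of S x] by metis
  then have "\<exists>p. x - p \<in> S \<and> (\<forall>s\<in>S. p \<bullet> s = 0)"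
    using assms by (intro exI[of _ z]) (auto simp: orthogonal_def span_eq_iff[THEN iffD2])
  then have "x - perp S x \<in> S \<and> (\<forall>s\<in>S. perp S x \<bullet> s = 0)"
    unfolding perp_def by (rule someI_ex)
  then show "x - perp S x \<in> S" "s \<in> S \<Longrightarrow> perp S x \<bullet> s = 0" by auto
qed

lemma perp_unique:
  assumes "subspace S" "x - p \<in> S" "\<And>s. s \<in> S \<Longrightarrow> p \<bullet> s = 0"
  shows "perp S x = p"
proof -
  let ?d = "p - perp S x"
  have "?d = (x - perp S x) - (x - p)" by simp
  then have "?d \<in> S" using perp_in[OF assms(1), of x] assms(1,2) subspace_diff by metis
  then have "?d \<bullet> ?d = 0"
    using perp_orth[OF assms(1)] assms(3) by (simp add: inner_diff_left)
  then show ?thesis by simp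
qed

lemma perp_span_unique:
  assumes "x - p \<in> span G" "\<And>s. s \<in> G \<Longrightarrow> p \<bullet> s = 0"
  shows "perp (span G) x = p"
proof (rule perp_unique)
  fix s assume "s \<in> span G"
  then have "orthogonal p s"
    by (rule orthogonal_to_span) (use assms(2) in \<open>auto simp: orthogonal_def\<close>)
  then show "p \<bullet> s = 0" by (simp add: orthogonal_def)
qed (use assms in auto)

lemma perp_eq_0: "subspace S \<Longrightarrow> perp S x = 0 \<longleftrightarrow> x \<in> S"
  using perp_in[of S x] perp_unique[of S x 0] by auto

lemma perp_add: "subspace S \<Longrightarrow> perp S (x + y) = perp S x + perp S y"
  using perp_in[of S x] perp_in[of S y] perp_orth[of S]
  by (intro perp_unique) (auto simp: inner_add_left add_diff_add subspace_add)

lemma perp_scaleR: "subspace S \<Longrightarrow> perp S (t *\<^sub>R x) = t *\<^sub>R perp S x"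
  using perp_in[of S x] perp_orth[of S]
  by (intro perp_unique) (auto simp: subspace_scale simp flip: scaleR_diff_right)

lemma perp_diff: "subspace S \<Longrightarrow> perp S (x - y) = perp S x - perp S y"
  using perp_add[of S x "- y"] perp_scaleR[of S "-1" y] by simp

lemma perp_translate: "subspace S \<Longrightarrow> s \<in> S \<Longrightarrow> perp S (x + s) = perp S x"
  by (simp add: perp_add perp_eq_0)

text \<open>One Gram-Schmidt step: enlarging \<open>S\<close> by \<open>x\<close> adds only the
  direction \<open>perp S x\<close>, so exactly the component of \<open>perp S y\<close> along it
  disappears.\<close>

lemma perp_insert:
  assumes S: "subspace S" and x: "x \<notin> S"
  shows "perp (span (insert x S)) y
           = perp S y - ((perp S y \<bullet> perp S x) / (norm (perp S x))\<^sup>2) *\<^sub>R perp S x"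
proof -
  let ?p = "perp S x" and ?q = "perp S y"
  let ?t = "(?q \<bullet> ?p) / (norm ?p)\<^sup>2"
  have p0: "?p \<bullet> ?p \<noteq> 0" using x perp_eq_0[OF S] by simp
  have px: "?p \<bullet> x = ?p \<bullet> ?p" and qx: "?q \<bullet> x = ?q \<bullet> ?p"
    using perp_orth[OF S perp_in[OF S, of x]] by (simp_all add: inner_diff_right)
  show ?thesis
  proof (rule perp_span_unique)
    have "y - (?q - ?t *\<^sub>R ?p) = (y - ?q) - ?t *\<^sub>R (x - ?p) + ?t *\<^sub>R x"
      by (simp add: scaleR_diff_right)
    also have "\<dots> \<in> span (insert x S)"
    proof (intro span_add span_diff[of "y - ?q"] span_scale)
      show "y - ?q \<in> span (insert x S)" "x - ?p \<in> span (insert x S)" "x \<in> span (insert x S)"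
        using perp_in[OF S] by (auto intro!: span_base)
    qed
    finally show "y - (?q - ?t *\<^sub>R ?p) \<in> span (insert x S)" .
    show "(?q - ?t *\<^sub>R ?p) \<bullet> s = 0" if "s \<in> insert x S" for s
      using that perp_orth[OF S] p0
      by (auto simp: inner_diff_left px qx power2_norm_eq_inner)
  qed
qed

lemma perp_insert_norm:
  assumes S: "subspace S" and x: "x \<notin> S"
  shows "(norm (perp (span (insert x S)) y))\<^sup>2
           = (norm (perp S y))\<^sup>2 - (perp S y \<bullet> perp S x)\<^sup>2 / (norm (perp S x))\<^sup>2"
proof -
  have "perp S x \<bullet> perp S x \<noteq> 0" using x perp_eq_0[OF S] by simp
  then show ?thesis
    unfolding perp_insert[OF assms] power2_norm_eq_inner
    by (simp add: inner_diff_left inner_diff_right inner_commute field_simps power2_eq_square)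
qed

lemma span_image_lessThan:
  fixes b :: "nat \<Rightarrow> 'a::real_vector"
  assumes "y \<in> span (b ` {..<k})"
  shows "\<exists>t. y = (\<Sum>i<k. t i *\<^sub>R b i)"
  using assms
proof (induction k arbitrary: y)
  case 0
  then show ?case by simp
next
  case (Suc k)
  then obtain s where "y - s *\<^sub>R b k \<in> span (b ` {..<k})"
    by (auto simp: lessThan_Suc span_breakdown_eq)
  then obtain t where t: "y - s *\<^sub>R b k = (\<Sum>i<k. t i *\<^sub>R b i)" using Suc.IH by blast
  have "(\<Sum>i<Suc k. (t(k := s)) i *\<^sub>R b i) = (\<Sum>i<k. t i *\<^sub>R b i) + s *\<^sub>R b k" by simp
  then show ?case using t by (metis add.commute diff_add_cancel add_diff_cancel_left')
qed

text \<open>Indexing by naturals, unlike in \<open>is_lattice_basis\<close>, makes prefixes of a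
  basis available for induction.\<close>

definition zspan :: "(nat \<Rightarrow> 'a::real_vector) \<Rightarrow> nat \<Rightarrow> 'a set" where
  "zspan b k = range (\<lambda>c::nat \<Rightarrow> int. \<Sum>i<k. of_int (c i) *\<^sub>R b i)"

lemma zspanI: "y = (\<Sum>i<k. of_int (c i) *\<^sub>R b i) \<Longrightarrow> y \<in> zspan b k"
  by (auto simp: zspan_def)

lemma zspan_Suc: "y \<in> zspan b (Suc k) \<longleftrightarrow> (\<exists>n::int. y - of_int n *\<^sub>R b k \<in> zspan b k)"
proof
  assume "y \<in> zspan b (Suc k)"
  then obtain c where "y = (\<Sum>i<Suc k. of_int (c i) *\<^sub>R b i)" by (auto simp: zspan_def)
  then show "\<exists>n::int. y - of_int n *\<^sub>R b k \<in> zspan b k"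
    by (intro exI[of _ "c k"] zspanI[where c = c]) simp
next
  assume "\<exists>n::int. y - of_int n *\<^sub>R b k \<in> zspan b k"
  then obtain n c where "y - of_int n *\<^sub>R b k = (\<Sum>i<k. of_int (c i) *\<^sub>R b i)"
    by (auto simp: zspan_def)
  then show "y \<in> zspan b (Suc k)"
    by (intro zspanI[where c = "c(k := n)"]) (simp add: algebra_simps)
qed

text \<open>Rounding each real coefficient costs at most half of each vector. This yields bounded
  representatives modulo the \<open>b i\<close>, both for the existence of minimal vectors and for
  size reduction.\<close>

lemma zspan_approx:
  fixes b :: "nat \<Rightarrow> 'a::real_normed_vector"
  assumes "y \<in> span (b ` {..<k})"
  shows "\<exists>z\<in>zspan b k. norm (y - z) \<le> (\<Sum>i<k. norm (b i)) / 2"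
proof -
  obtain t where t: "y = (\<Sum>i<k. t i *\<^sub>R b i)" using span_image_lessThan[OF assms] by blast
  let ?z = "\<Sum>i<k. of_int (round (t i)) *\<^sub>R b i"
  have "norm (y - ?z) = norm (\<Sum>i<k. (t i - of_int (round (t i))) *\<^sub>R b i)"
    unfolding t by (simp add: scaleR_diff_left sum_subtractf)
  also have "\<dots> \<le> (\<Sum>i<k. \<bar>t i - of_int (round (t i))\<bar> * norm (b i))"
    by (rule order_trans[OF norm_sum]) simp
  also have "\<dots> \<le> (\<Sum>i<k. 1 / 2 * norm (b i))"
    using of_int_round_abs_le by (intro sum_mono mult_right_mono) (auto simp: abs_minus_commute)
  also have "\<dots> = (\<Sum>i<k. norm (b i)) / 2" by (simp add: sum_divide_distrib)
  finally show ?thesis by (intro bexI[of _ ?z] zspanI) auto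
qed

text \<open>\<open>perp S x\<close> is a shortest nonzero vector of the projection of
  \<open>L\<close> to the orthogonal complement of \<open>S\<close>; working with representatives
  keeps all vectors inside \<open>L\<close>.\<close>

definition minv :: "'a::euclidean_space set \<Rightarrow> 'a set \<Rightarrow> 'a \<Rightarrow> bool" where
  "minv L S x \<longleftrightarrow> x \<in> L \<and> x \<notin> S \<and> (\<forall>y\<in>L - S. norm (perp S x) \<le> norm (perp S y))"

text \<open>
  Hermite-Korkine-Zolotarev reduction: every vector is shortest modulo the span of its predecessors.
  The squared Gram-Schmidt norms \<open>gsn b i\<close> multiply up to the squared covolume.
\<close>
definition hkz :: "'a::euclidean_space set \<Rightarrow> (nat \<Rightarrow> 'a) \<Rightarrow> nat \<Rightarrow> bool" where
  "hkz L b k \<longleftrightarrow> (\<forall>i<k. minv L (span (b ` {..<i})) (b i))"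

definition gsn :: "(nat \<Rightarrow> 'a::euclidean_space) \<Rightarrow> nat \<Rightarrow> real" where
  "gsn b i = (norm (perp (span (b ` {..<i})) (b i)))\<^sup>2"

lemma image_upd_lessThan: "i \<le> (k::nat) \<Longrightarrow> (b(k := x)) ` {..<i} = b ` {..<i}"
  by (rule image_cong) auto

lemma gsn_upd: "i < k \<Longrightarrow> gsn (b(k := x)) i = gsn b i"
  unfolding gsn_def by (simp add: image_upd_lessThan)

lemma gsn_upd_same: "gsn (b(k := x)) k = (norm (perp (span (b ` {..<k})) x))\<^sup>2"
  unfolding gsn_def by (simp add: image_upd_lessThan)

lemma prod_gsn_upd:
  "(\<Prod>i<Suc k. gsn (b(k := x)) i) = (\<Prod>i<k. gsn b i) * (norm (perp (span (b ` {..<k})) x))\<^sup>2"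
proof -
  have "(\<Prod>i<k. gsn (b(k := x)) i) = (\<Prod>i<k. gsn b i)" by (rule prod.cong) (auto simp: gsn_upd)
  then show ?thesis by (simp add: gsn_upd_same del: fun_upd_apply)
qed

lemma hkz_upd: "hkz L b k \<Longrightarrow> minv L (span (b ` {..<k})) x \<Longrightarrow> hkz L (b(k := x)) (Suc k)"
  unfolding hkz_def
proof (intro allI impI)
  fix i assume *: "\<forall>i<k. minv L (span (b ` {..<i})) (b i)" "minv L (span (b ` {..<k})) x" "i < Suc k"
  then have "(b(k := x)) ` {..<i} = b ` {..<i}" by (intro image_upd_lessThan) simp
  then show "minv L (span ((b(k := x)) ` {..<i})) ((b(k := x)) i)"
    using * by (cases "i = k") auto
qed

lemma hkz_mono: "hkz L b k \<Longrightarrow> i \<le> k \<Longrightarrow> hkz L b i"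
  by (auto simp: hkz_def)

lemma span_image_Suc: "span (b ` {..<Suc k}) = span (insert (b k) (span (b ` {..<k})))"
proof -
  have "span (insert (b k) (span (b ` {..<k}))) = span (insert (b k) (b ` {..<k}))"
    unfolding span_eq by (auto intro: span_base span_mono[THEN subsetD, rotated])
  then show ?thesis by (simp add: lessThan_Suc)
qed

lemma gsn_pos:
  assumes "hkz L b k" "i < k"
  shows "gsn b i > 0"
  using assms perp_eq_0[of "span (b ` {..<i})" "b i"] by (auto simp: gsn_def hkz_def minv_def)

lemma dim_hkz:
  assumes "hkz L b k"
  shows "dim (b ` {..<k}) = k"
  using assms
proof (induction k)
  case (Suc k)
  then have "dim (b ` {..<k}) = k" "b k \<notin> span (b ` {..<k})"
    by (auto simp: hkz_def minv_def)
  then show ?case by (simp add: lessThan_Suc dim_insert)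
qed simp

section \<open>Full-rank discrete subgroups: minimal vectors and the Hermite bound\<close>

locale full_lattice =
  fixes L :: "'a::euclidean_space set"
  assumes zero: "0 \<in> L" and add: "x \<in> L \<Longrightarrow> y \<in> L \<Longrightarrow> x + y \<in> L"
    and neg: "x \<in> L \<Longrightarrow> - x \<in> L"
    and disc: "discrete L" and full: "span L = UNIV"
begin

lemma diff: "x \<in> L \<Longrightarrow> y \<in> L \<Longrightarrow> x - y \<in> L"
  using add[of x "- y"] neg[of y] by simp

lemma scale_nat: "x \<in> L \<Longrightarrow> of_nat n *\<^sub>R x \<in> L"
  by (induction n) (auto simp: zero add scaleR_add_left)

lemma scale_int:
  assumes "x \<in> L"
  shows "of_int n *\<^sub>R x \<in> L"
proof (cases n rule: int_cases2)
  case (nonneg m)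
  then show ?thesis using scale_nat[OF assms, of m] by simp
next
  case (nonpos m)
  then show ?thesis using neg[OF scale_nat[OF assms, of m]] by simp
qed

lemma sum_in: "(\<And>i. i \<in> I \<Longrightarrow> f i \<in> L) \<Longrightarrow> sum f I \<in> L"
  by (induction I rule: infinite_finite_induct) (auto simp: zero add)

lemma zspan_subset: "(\<And>i. i < k \<Longrightarrow> b i \<in> L) \<Longrightarrow> zspan b k \<subseteq> L"
  by (auto simp: zspan_def intro!: sum_in scale_int)

lemma finite_bounded: "finite {x \<in> L. norm x \<le> B}"
proof -
  obtain d where d: "d > 0" "\<And>x. x \<in> L \<Longrightarrow> dist 0 x < d \<Longrightarrow> x = 0"
    using disc zero unfolding discrete_def isolated_in_dist_Ex_iff by (metis dist_commute)
  \<comment> \<open>Subtracting lattice vectors turns the isolation of 0 into one separation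
    distance valid on all of \<open>L\<close>; hence \<open>L\<close> is closed.\<close>
  have sep: "x = y" if "x \<in> L" "y \<in> L" "dist y x < d" for x y
    using d(2)[of "x - y"] diff[of x y] that by (simp add: dist_norm norm_minus_commute)
  have "closed L" by (rule discrete_imp_closed[OF d(1)]) (use sep in auto)
  then have "compact (L \<inter> cball 0 B)" by (simp add: closed_Int_compact)
  moreover have "discrete (L \<inter> cball 0 B)" using disc by (rule discrete_subset) auto
  ultimately have "finite (L \<inter> cball 0 B)" using discrete_compact_finite_iff by blast
  then show ?thesis by (rule rev_finite_subset) auto
qed


lemma hkz_in: "hkz L b k \<Longrightarrow> i < k \<Longrightarrow> b i \<in> L"
  by (auto simp: hkz_def minv_def)

text \<open>Infinitely many vectors share a projection, but subtracting an integral combination of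
  the \<open>b i\<close> leaves the projection alone and bounds the vector itself. The minimum is
  thus taken over the finite set \<open>F\<close>.\<close>

lemma minv_exists:
  fixes b :: "nat \<Rightarrow> 'a"
  assumes b: "\<And>i. i < k \<Longrightarrow> b i \<in> L" and k: "dim (b ` {..<k}) < DIM('a)"
  shows "\<exists>x. minv L (span (b ` {..<k})) x"
proof -
  let ?S = "span (b ` {..<k})"
  have S: "subspace ?S" by simp
  obtain x0 where x0: "x0 \<in> L - ?S"
  proof (rule ccontr)
    assume "\<not> thesis"
    then have "span L \<subseteq> ?S" using that by (intro span_minimal) auto
    then have "dim (UNIV :: 'a set) \<le> dim ?S" unfolding full by (rule dim_subset)
    then show False using k by (simp add: dim_span)
  qed
  define B where "B = norm (perp ?S x0) + (\<Sum>i<k. norm (b i)) / 2"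
  define F where "F = {y \<in> L - ?S. norm y \<le> B}"
  have red: "\<exists>y'\<in>F. perp ?S y' = perp ?S y"
    if y: "y \<in> L - ?S" "norm (perp ?S y) \<le> norm (perp ?S x0)" for y
  proof -
    obtain z where z: "z \<in> zspan b k" "norm (y - perp ?S y - z) \<le> (\<Sum>i<k. norm (b i)) / 2"
      using zspan_approx[OF perp_in[OF S]] by blast
    have zS: "z \<in> ?S" using z(1) by (auto simp: zspan_def intro!: span_sum span_scale intro: span_base)
    have zL: "z \<in> L" using zspan_subset[of k b] b z(1) by blast
    have "norm (y - z) \<le> B"
      using norm_triangle_ineq[of "perp ?S y" "y - perp ?S y - z"] z(2) y(2) by (simp add: B_def)
    moreover have "y - z \<notin> ?S" using y(1) zS span_add[of "y - z" _ z] by auto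
    moreover have "perp ?S (y - z) = perp ?S y" using zS by (simp add: perp_diff perp_eq_0)
    ultimately show ?thesis using y(1) zL diff by (intro bexI[of _ "y - z"]) (auto simp: F_def)
  qed
  have "finite F" using finite_bounded[of B] by (rule rev_finite_subset) (auto simp: F_def)
  moreover have "F \<noteq> {}" using red[of x0] x0 by auto
  ultimately obtain x where x: "x \<in> F" "\<And>y. y \<in> F \<Longrightarrow> norm (perp ?S x) \<le> norm (perp ?S y)"
    using ex_min_if_finite[of "(\<lambda>y. norm (perp ?S y)) ` F"] by (metis (no_types, lifting) arg_min_if_finite(1) arg_min_least)
  have "norm (perp ?S x) \<le> norm (perp ?S y)" if "y \<in> L - ?S" for y
  proof (cases "norm (perp ?S y) \<le> norm (perp ?S x0)")
    case True
    then show ?thesis using red[OF that True] x(2) by metis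
  next
    case False
    obtain y' where "y' \<in> F" "perp ?S y' = perp ?S x0" using red[of x0] x0 by auto
    then show ?thesis using x(2)[of y'] False by simp
  qed
  then have "minv L ?S x" using x(1) by (auto simp: minv_def F_def)
  then show ?thesis ..
qed

lemma minv_translate:
  assumes "subspace S" "minv L S x" "s \<in> S" "s \<in> L"
  shows "minv L S (x + s)"
  using assms subspace_diff[of S "x + s" s] unfolding minv_def
  by (auto simp: perp_translate add)

lemma minv_uminus:
  assumes "subspace S" "minv L S x"
  shows "minv L S (- x)"
  using assms perp_scaleR[of S "-1" x] subspace_neg[of S "- x"] neg
  unfolding minv_def by auto

text \<open>Rounding leaves a coefficient of \<open>b k\<close> of absolute value at most 1/2. Were
  it nonzero, the remainder would be a lattice vector outside the span of the predecessors with a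
  shorter projection than \<open>b k\<close>.\<close>

lemma hkz_zspan:
  assumes "hkz L b k" "y \<in> L" "y \<in> span (b ` {..<k})"
  shows "y \<in> zspan b k"
  using assms
proof (induction k arbitrary: y)
  case 0
  then show ?case by (simp add: zspan_def)
next
  case (Suc k)
  let ?S = "span (b ` {..<k})" and ?x = "b k"
  have hk: "hkz L b k" using Suc.prems(1) by (rule hkz_mono) simp
  have S: "subspace ?S" by simp
  have m: "minv L ?S ?x" using Suc.prems(1) by (simp add: hkz_def)
  obtain t where t: "y - t *\<^sub>R ?x \<in> ?S"
    using Suc.prems(3) by (auto simp: lessThan_Suc span_breakdown_eq)
  define y' where "y' = y - of_int (round t) *\<^sub>R ?x"
  have y'L: "y' \<in> L" unfolding y'_def using hkz_in[OF Suc.prems(1), of k] Suc.prems(2) by (intro diff scale_int) auto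
  have "y' \<in> ?S"
  proof (rule ccontr)
    assume "y' \<notin> ?S"
    then have le: "norm (perp ?S ?x) \<le> norm (perp ?S y')" using m y'L by (simp add: minv_def)
    have "y' = (y - t *\<^sub>R ?x) + (t - of_int (round t)) *\<^sub>R ?x" by (simp add: y'_def algebra_simps)
    then have "perp ?S y' = (t - of_int (round t)) *\<^sub>R perp ?S ?x"
      using t by (simp only: perp_add[OF S] perp_scaleR[OF S]) (simp add: perp_eq_0)
    then have "norm (perp ?S y') = \<bar>t - of_int (round t)\<bar> * norm (perp ?S ?x)" by simp
    also have "\<dots> \<le> 1 / 2 * norm (perp ?S ?x)"
      using of_int_round_abs_le[of t] by (intro mult_right_mono) (auto simp: abs_minus_commute)
    finally have "norm (perp ?S ?x) = 0" using le norm_ge_zero[of "perp ?S ?x"] by linarith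
    then show False using m by (simp add: perp_eq_0 minv_def)
  qed
  then have "y' \<in> zspan b k" using Suc.IH[OF hk y'L] by simp
  then show ?case unfolding zspan_Suc y'_def by blast
qed

text \<open>Subtract a multiple of \<open>x\<close> from \<open>y\<close> so that its Gram-Schmidt
  coefficient is at most 1/2 in absolute value. Minimality of \<open>x\<close> bounds the projection
  modulo \<open>S\<close> from below, and removing the direction of \<open>x\<close> costs at most a
  quarter of the squared norm of \<open>perp S x\<close>.\<close>

lemma minv_step:
  assumes S: "subspace S" and x: "minv L S x" and y: "minv L (span (insert x S)) y"
  shows "3 / 4 * (norm (perp S x))\<^sup>2 \<le> (norm (perp (span (insert x S)) y))\<^sup>2"
proof -
  let ?p = "perp S x"
  have xS: "x \<notin> S" and xL: "x \<in> L" using x by (auto simp: minv_def)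
  have p0: "(norm ?p)\<^sup>2 > 0" using xS by (simp add: perp_eq_0[OF S])
  define t where "t = (perp S y \<bullet> ?p) / (norm ?p)\<^sup>2"
  define y' where "y' = y - of_int (round t) *\<^sub>R x"
  have q: "perp S y' = perp S y - of_int (round t) *\<^sub>R ?p"
    by (simp add: y'_def perp_diff[OF S] perp_scaleR[OF S])
  have "y' \<in> L" using x y by (auto simp: y'_def minv_def intro!: diff scale_int)
  moreover have "y' \<notin> S"
  proof
    assume "y' \<in> S"
    then have "y' + of_int (round t) *\<^sub>R x \<in> span (insert x S)"
      by (intro span_add span_scale) (auto intro: span_base)
    then show False using y by (simp add: y'_def minv_def)
  qed
  ultimately have le: "(norm ?p)\<^sup>2 \<le> (norm (perp S y'))\<^sup>2"
    using x by (auto simp: minv_def intro!: power_mono)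
  have "perp (span (insert x S)) y' = perp (span (insert x S)) y"
    unfolding y'_def by (simp add: perp_diff perp_scaleR perp_eq_0 span_base)
  then have eq: "(norm (perp (span (insert x S)) y))\<^sup>2
      = (norm (perp S y'))\<^sup>2 - (perp S y' \<bullet> ?p)\<^sup>2 / (norm ?p)\<^sup>2"
    using perp_insert_norm[OF S xS, of y'] by simp
  have "perp S y' \<bullet> ?p = (t - of_int (round t)) * (norm ?p)\<^sup>2"
    using p0 unfolding q t_def by (simp add: inner_diff_left field_simps power2_norm_eq_inner)
  then have "(perp S y' \<bullet> ?p)\<^sup>2 / (norm ?p)\<^sup>2 = (t - of_int (round t))\<^sup>2 * (norm ?p)\<^sup>2"
    using p0 by (simp add: power2_eq_square)
  also have "\<dots> \<le> (1 / 2)\<^sup>2 * (norm ?p)\<^sup>2"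
    using of_int_round_abs_le[of t] by (intro mult_right_mono abs_le_square_iff[THEN iffD1]) (auto simp: abs_minus_commute)
  finally show ?thesis using eq le by (simp add: power2_eq_square)
qed

text \<open>With a the squared norm of \<open>perp S x\<close> for S the span of the first k
  vectors, completing the basis by minimal vectors contributes at least a, (3/4) a, ..., (3/4)^m a
  to the squared covolume; hence the exponent 0 + 1 + ... + m. With \<open>k = 0\<close> this also
  provides a full reduced basis.\<close>

lemma hermite:
  assumes "hkz L b k" "minv L (span (b ` {..<k})) x" "k + Suc m = DIM('a)"
  shows "\<exists>b'. hkz L b' DIM('a) \<and>
    (\<Prod>i<k. gsn b i) * ((norm (perp (span (b ` {..<k})) x))\<^sup>2) ^ Suc m * (3 / 4) ^ (\<Sum>{..m})
      \<le> (\<Prod>i<DIM('a). gsn b' i)"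
  using assms
proof (induction m arbitrary: b k x)
  case 0
  then show ?case
    using hkz_upd[OF 0(1,2)] prod_gsn_upd[of b k x] by (intro exI[of _ "b(k := x)"]) (simp del: fun_upd_apply)
next
  case (Suc m)
  let ?S = "span (b ` {..<k})"
  let ?b = "b(k := x)"
  define a where "a = (norm (perp ?S x))\<^sup>2"
  have S: "subspace ?S" by simp
  have h: "hkz L ?b (Suc k)" using Suc.prems(1,2) by (rule hkz_upd)
  have S': "span (?b ` {..<Suc k}) = span (insert x ?S)"
    unfolding span_image_Suc by (simp add: image_upd_lessThan del: fun_upd_apply) simp
  have "dim (?b ` {..<Suc k}) < DIM('a)" using dim_hkz[OF h] Suc.prems(3) by simp
  then obtain y where y: "minv L (span (?b ` {..<Suc k})) y"
    using minv_exists[of "Suc k" ?b] hkz_in[OF h] by blast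
  define a' where "a' = (norm (perp (span (?b ` {..<Suc k})) y))\<^sup>2"
  have le: "3 / 4 * a \<le> a'"
    unfolding a'_def a_def S' by (rule minv_step[OF S Suc.prems(2)]) (use y S' in simp)
  obtain b' where b': "hkz L b' DIM('a)"
    "(\<Prod>i<Suc k. gsn ?b i) * a' ^ Suc m * (3 / 4) ^ (\<Sum>{..m}) \<le> (\<Prod>i<DIM('a). gsn b' i)"
    using Suc.IH[OF h y] Suc.prems(3) unfolding a'_def[symmetric] add_Suc_shift by blast
  have P: "(\<Prod>i<k. gsn b i) \<ge> 0" by (simp add: prod_nonneg gsn_def)
  \<comment> \<open>The last summand \<open>Suc m\<close> of the exponent is spent on turning
    \<open>Suc m\<close> of the factors a into \<open>3 / 4 * a\<close>, the lower bound for
    \<open>a'\<close>.\<close>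
  have "(\<Prod>i<k. gsn b i) * a ^ Suc (Suc m) * (3 / 4) ^ (\<Sum>{..Suc m})
      = ((\<Prod>i<k. gsn b i) * a) * (3 / 4 * a) ^ Suc m * (3 / 4) ^ (\<Sum>{..m})"
    by (simp add: power_mult_distrib power_divide power_add mult_ac)
  also have "\<dots> \<le> ((\<Prod>i<k. gsn b i) * a) * a' ^ Suc m * (3 / 4) ^ (\<Sum>{..m})"
    using le P by (intro mult_right_mono mult_left_mono power_mono) (auto simp: a_def)
  also have "\<dots> = (\<Prod>i<Suc k. gsn ?b i) * a' ^ Suc m * (3 / 4) ^ (\<Sum>{..m})"
    unfolding prod_gsn_upd a_def ..
  finally show ?case using b' unfolding a_def by (intro exI[of _ b']) simp
qed

end

section \<open>The determinant of a lattice\<close>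

text \<open>Replacing the rows by their orthogonal components, last row first, keeps the
  determinant. The resulting rows are orthogonal, so their Gram matrix is diagonal. Squaring also
  removes the sign that depends on the enumeration \<open>g\<close>.\<close>

lemma det_rows_gsn:
  fixes b :: "nat \<Rightarrow> real ^ 'n" and g :: "'n \<Rightarrow> nat"
  assumes g: "bij_betw g UNIV {..<CARD('n)}"
  shows "(det (\<chi> i. b (g i)))\<^sup>2 = (\<Prod>i<CARD('n). gsn b i)"
proof -
  let ?p = "\<lambda>k. perp (span (b ` {..<k})) (b k)"
  \<comment> \<open>Rows before k are original, the others orthogonalised. Between
    \<open>M (Suc k)\<close> and \<open>M k\<close> a single row changes, by a combination of
    original rows that are present in both.\<close>
  define M where "M k = (\<chi> i. if g i < k then b (g i) else ?p (g i))" for k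
  have row: "row i (M k) = (if g i < k then b (g i) else ?p (g i))" for i k
    by (simp add: M_def row_def vec_eq_iff)
  have inj: "g i = g j \<Longrightarrow> i = j" for i j using g by (auto simp: bij_betw_def inj_on_def)
  have gle: "g i < CARD('n)" for i using bij_betwE[OF g] by auto
  have surj: "\<exists>i. g i = k" if "k < CARD('n)" for k
    using bij_betw_imp_surj_on[OF g] that by (metis imageE lessThan_iff)
  have step: "det (M (Suc k)) = det (M k)" if k: "k < CARD('n)" for k
  proof -
    obtain i0 where i0: "g i0 = k" using surj[OF k] by blast
    have "b ` {..<k} \<subseteq> {row j (M k) |j. j \<noteq> i0}"
    proof
      fix y assume "y \<in> b ` {..<k}"
      then obtain l where l: "l < k" "y = b l" by auto
      then obtain j where "g j = l" using surj[of l] k by auto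
      then show "y \<in> {row j (M k) |j. j \<noteq> i0}" using l i0 row[of j k] by (auto intro!: exI[of _ j])
    qed
    then have "b k - ?p k \<in> span {row j (M k) |j. j \<noteq> i0}"
      using perp_in[of "span (b ` {..<k})" "b k"] span_mono by blast
    then have "det (\<chi> j. if j = i0 then row i0 (M k) + (b k - ?p k) else row j (M k)) = det (M k)"
      by (intro det_row_span) (simp add: span_vec_eq)
    moreover have "(if j = i0 then row i0 (M k) + (b k - ?p k) else row j (M k)) = M (Suc k) $ j" for j
    proof (cases "j = i0")
      case False
      then have "g j \<noteq> k" using i0 inj by blast
      then show ?thesis using False unfolding row by (simp add: M_def less_Suc_eq)
    next
      case True
      then show ?thesis unfolding row by (simp add: i0 M_def)
    qed
    then have "(\<chi> j. if j = i0 then row i0 (M k) + (b k - ?p k) else row j (M k)) = M (Suc k)"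
      by (simp add: vec_eq_iff)
    ultimately show ?thesis by simp
  qed
  have "det (M k) = det (M 0)" if "k \<le> CARD('n)" for k
    using that by (induction k) (auto simp: step)
  from this[of "CARD('n)"] have "det (M CARD('n)) = det (M 0)" by simp
  moreover have "M CARD('n) = (\<chi> i. b (g i))"
    unfolding M_def vec_eq_iff vec_lambda_beta using gle by auto
  ultimately have sq: "(det (\<chi> i. b (g i)))\<^sup>2 = det (M 0 ** transpose (M 0))"
    unfolding det_mul det_transpose power2_eq_square by metis
  have entry: "(M 0 ** transpose (M 0)) $ i $ j = ?p (g i) \<bullet> ?p (g j)" for i j
    by (simp add: matrix_matrix_mult_def transpose_def M_def inner_vec_def)
  have lt: "?p l \<bullet> ?p k = 0" if "k < l" for k l
  proof (rule perp_orth)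
    have "?p k = b k - (b k - ?p k)" by simp
    also have "\<dots> \<in> span (b ` {..<l})"
    proof (rule span_diff)
      show "b k \<in> span (b ` {..<l})" using that by (auto intro: span_base)
      show "b k - ?p k \<in> span (b ` {..<l})"
        using that perp_in[of "span (b ` {..<k})" "b k"] span_mono[of "b ` {..<k}" "b ` {..<l}"] by fastforce
    qed
    finally show "?p k \<in> span (b ` {..<l})" .
  qed simp
  have "det (M 0 ** transpose (M 0)) = (\<Prod>i\<in>UNIV. gsn b (g i))"
    by (subst det_diagonal)
      (use lt inj in \<open>auto simp: entry gsn_def power2_norm_eq_inner inner_commute neq_iff, metis inner_commute neq_iff\<close>)
  also have "\<dots> = (\<Prod>i<CARD('n). gsn b i)"
    using prod.reindex_bij_betw[OF g] by simp
  finally show ?thesis using sq by simp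
qed

lemma basis_zspan:
  fixes b :: "nat \<Rightarrow> real ^ 'n" and g :: "'n \<Rightarrow> nat"
  assumes g: "bij_betw g UNIV {..<CARD('n)}"
  shows "is_lattice_basis (\<lambda>i. b (g i)) (zspan b CARD('n))"
proof -
  have inj: "inv_into UNIV g (g i) = i" for i
    using g by (simp add: bij_betw_def)
  have 1: "(\<Sum>k<CARD('n). of_int (c k) *\<^sub>R b k) = (\<Sum>i\<in>UNIV. of_int (c (g i)) *\<^sub>R b (g i))" for c :: "nat \<Rightarrow> int"
    using sum.reindex_bij_betw[OF g, of "\<lambda>k. of_int (c k) *\<^sub>R b k"] by simp
  have 2: "\<exists>c'. (\<Sum>i\<in>UNIV. of_int (c i) *\<^sub>R b (g i)) = (\<Sum>k<CARD('n). of_int (c' k) *\<^sub>R b k)" for c :: "'n \<Rightarrow> int"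
    unfolding 1 by (rule exI[of _ "\<lambda>k. c (inv_into UNIV g k)"]) (simp add: inj)
  show ?thesis
    unfolding is_lattice_basis_def zspan_def using 1 2 by (fastforce simp: image_def)
qed

lemma basis_in: "is_lattice_basis u L \<Longrightarrow> u i \<in> L"
  unfolding is_lattice_basis_def
  by (auto intro!: range_eqI[of _ _ "\<lambda>j. if j = i then 1 else 0"] simp: if_distrib if_distribR sum.delta cong: if_cong)

lemma basis_rows:
  assumes "is_lattice_basis u L"
  shows "rows (\<chi> i. u i) = range u"
  by (auto simp: rows_def row_def vec_nth_inverse)

lemma basis_det_nz:
  fixes u :: "'n \<Rightarrow> real ^ 'n"
  assumes u: "is_lattice_basis u L" and L: "span L = UNIV"
  shows "det (\<chi> i. u i) \<noteq> 0"
proof -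
  have "L \<subseteq> span (range u)"
    using u unfolding is_lattice_basis_def by (auto intro!: span_sum span_scale intro: span_base)
  then have "span (range u) = UNIV" using L span_minimal[of L "span (range u)"] by auto
  then have "span (rows (\<chi> i. u i)) = UNIV" using basis_rows[OF u] by simp
  then obtain B where "B ** (\<chi> i. u i) = mat 1" using matrix_left_invertible_span_rows by blast
  then have "det B * det (\<chi> i. u i) = 1" by (metis det_I det_mul)
  then show ?thesis by auto
qed

text \<open>The change of basis has integer entries, so its nonzero determinant has absolute value
  at least 1. Used in both directions, this makes the description in \<open>lattice_det\<close> well
  defined.\<close>

lemma basis_det_le:
  fixes u v :: "'n \<Rightarrow> real ^ 'n"
  assumes u: "is_lattice_basis u L" and v: "is_lattice_basis v L" and L: "span L = UNIV"
  shows "\<bar>det (\<chi> i. u i)\<bar> \<le> \<bar>det (\<chi> i. v i)\<bar>"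
proof -
  have "\<exists>c::'n \<Rightarrow> int. v j = (\<Sum>i\<in>UNIV. of_int (c i) *\<^sub>R u i)" for j
    using basis_in[OF v, of j] u unfolding is_lattice_basis_def by auto
  then obtain c :: "'n \<Rightarrow> 'n \<Rightarrow> int" where c: "v j = (\<Sum>i\<in>UNIV. of_int (c j i) *\<^sub>R u i)" for j
    by metis
  let ?C = "(\<chi> j i. of_int (c j i)) :: real ^ 'n ^ 'n"
  have "(\<chi> i. v i) = ?C ** (\<chi> i. u i)"
    by (simp add: vec_eq_iff matrix_matrix_mult_def c)
  then have d: "det (\<chi> i. v i) = det ?C * det (\<chi> i. u i)" by (simp only: det_mul)
  have "det ?C \<in> \<int>" unfolding det_def by (intro Ints_sum Ints_mult Ints_prod) auto
  moreover have "det ?C \<noteq> 0" using d basis_det_nz[OF v L] by auto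
  ultimately have "\<bar>det ?C\<bar> \<ge> 1" by (rule Ints_nonzero_abs_ge1)
  then show ?thesis unfolding d abs_mult using mult_right_mono[of 1 "\<bar>det ?C\<bar>" "\<bar>det (\<chi> i. u i)\<bar>"] by simp
qed

lemma lattice_det_eq:
  fixes u :: "'n \<Rightarrow> real ^ 'n"
  assumes u: "is_lattice_basis u L" and L: "span L = UNIV"
  shows "lattice_det L = \<bar>det (\<chi> i. u i)\<bar>"
proof -
  \<comment> \<open>\<open>lattice_det\<close> has the basis vectors as columns; all computations
    here have them as rows.\<close>
  have t: "det (\<chi> i j. v j $ i) = det (\<chi> i. v i)" for v :: "'n \<Rightarrow> real ^ 'n"
    using det_transpose[of "\<chi> i. v i"] by (simp add: transpose_def)
  show ?thesis
    unfolding lattice_det_def t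
    using u basis_det_le[OF u _ L] basis_det_le[OF _ u L] by (intro the_equality) (auto intro: antisym)
qed

context full_lattice
begin

lemma zspan_eq:
  assumes "hkz L b DIM('a)"
  shows "L = zspan b DIM('a)"
proof -
  have "dim (b ` {..<DIM('a)}) = DIM('a)" using dim_hkz[OF assms] .
  then have "span (b ` {..<DIM('a)}) = UNIV" using dim_eq_full by blast
  then show ?thesis
    using hkz_zspan[OF assms] zspan_subset[of "DIM('a)" b] hkz_in[OF assms] by blast
qed

end

lemma covolume_hkz:
  fixes b :: "nat \<Rightarrow> real ^ 'n"
  assumes "full_lattice L" "hkz L b CARD('n)"
  shows "(lattice_det L)\<^sup>2 = (\<Prod>i<CARD('n). gsn b i)"
proof -
  interpret full_lattice L by fact
  obtain g :: "'n \<Rightarrow> nat" where g: "bij_betw g UNIV {..<CARD('n)}"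
    using ex_bij_betw_finite_nat[of "UNIV :: 'n set"] by (auto simp: atLeast0LessThan)
  have "L = zspan b CARD('n)" using zspan_eq[of b] assms(2) by simp
  then have "is_lattice_basis (\<lambda>i. b (g i)) L" using basis_zspan[OF g, of b] by simp
  then show ?thesis using lattice_det_eq[OF _ full] det_rows_gsn[OF g, of b] by simp
qed

section \<open>Even lattices of rank eight and small determinant\<close>

text \<open>The Gram form of the projected lattice. As a bilinear form it obeys the Schur complement
  formula \<open>perp_inner_insert\<close>, from which all concrete values are computed.\<close>

definition perp_inner :: "'a::euclidean_space set \<Rightarrow> 'a \<Rightarrow> 'a \<Rightarrow> real" where
  "perp_inner S y z = perp S y \<bullet> perp S z"

lemma perp_inner_span_empty: "perp_inner (span {}) y z = y \<bullet> z"
proof -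
  have "perp (span {}) x = x" for x :: 'a by (rule perp_span_unique) (auto simp: span_zero)
  then show ?thesis by (simp add: perp_inner_def)
qed

lemma perp_inner_insert:
  assumes S: "subspace S" and x: "x \<notin> S"
  shows "perp_inner (span (insert x S)) y z = perp_inner S y z - perp_inner S y x * perp_inner S z x / perp_inner S x x"
proof -
  have "perp S x \<bullet> perp S x \<noteq> 0" using x perp_eq_0[OF S] by simp
  then show ?thesis
    unfolding perp_inner_def perp_insert[OF assms] power2_norm_eq_inner
    by (simp add: inner_diff_left inner_diff_right inner_commute field_simps)
qed

lemma perp_inner_orthonormal:
  fixes e :: "nat \<Rightarrow> 'a::euclidean_space"
  assumes e: "\<And>i j. i < k \<Longrightarrow> j < k \<Longrightarrow> e i \<bullet> e j = (if i = j then 1 else 0)"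
  shows "perp_inner (span (e ` {..<k})) y z = y \<bullet> z - (\<Sum>i<k. (y \<bullet> e i) * (z \<bullet> e i))"
proof -
  define q where "q x = (\<Sum>i<k. (x \<bullet> e i) *\<^sub>R e i)" for x
  have qe: "q x \<bullet> e j = x \<bullet> e j" if "j < k" for x j
  proof -
    have "q x \<bullet> e j = (\<Sum>i<k. if i = j then x \<bullet> e i else 0)"
      unfolding q_def inner_sum_left by (rule sum.cong) (use e that in auto)
    then show ?thesis using that by simp
  qed
  have p: "perp (span (e ` {..<k})) x = x - q x" for x
  proof (rule perp_span_unique)
    show "x - (x - q x) \<in> span (e ` {..<k})"
      unfolding q_def by (auto intro!: span_sum span_scale intro: span_base)
  qed (auto simp: inner_diff_left qe)
  have 1: "y \<bullet> q z = (\<Sum>i<k. (y \<bullet> e i) * (z \<bullet> e i))" for y z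
    by (simp add: q_def inner_sum_right mult.commute)
  have 2: "q y \<bullet> q z = (\<Sum>i<k. (y \<bullet> e i) * (z \<bullet> e i))"
    unfolding 1 by (intro sum.cong) (auto simp: qe)
  have 3: "q y \<bullet> z = (\<Sum>i<k. (y \<bullet> e i) * (z \<bullet> e i))"
    using 1[of z y] by (simp add: inner_commute mult.commute)
  show ?thesis
    by (simp only: perp_inner_def p inner_diff_left inner_diff_right 2 3 1[of y z] diff_self diff_0_right)
qed

lemma perp_inner_pos: "subspace S \<Longrightarrow> x \<notin> S \<Longrightarrow> perp_inner S x x > 0"
  using perp_eq_0[of S x] by (simp add: perp_inner_def)

lemma norm_perp_perp_inner: "(norm (perp S x))\<^sup>2 = perp_inner S x x"
  by (simp add: perp_inner_def power2_norm_eq_inner)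

lemma span_insert_span: "span (insert x (span A)) = span (insert x A)"
  unfolding span_eq by (auto intro: span_base span_mono[THEN subsetD, rotated])

text \<open>
  Here \<open>D\<close> is the squared covolume of the sublattice \<open>L \<inter> S\<close>, of rank \<open>k\<close>.
\<close>
definition flag :: "'a::euclidean_space set \<Rightarrow> nat \<Rightarrow> 'a set \<Rightarrow> real \<Rightarrow> bool" where
  "flag L k S D \<longleftrightarrow> (\<exists>b. hkz L b k \<and> S = span (b ` {..<k}) \<and> D = (\<Prod>i<k. gsn b i))"

lemma flag_0: "flag L 0 (span {}) 1"
  by (auto simp: flag_def hkz_def)

lemma flag_Suc:
  assumes "flag L k S D" "minv L S x"
  shows "flag L (Suc k) (span (insert x S)) (D * perp_inner S x x)"
proof -
  obtain b where b: "hkz L b k" "S = span (b ` {..<k})" "D = (\<Prod>i<k. gsn b i)"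
    using assms(1) by (auto simp: flag_def)
  show ?thesis unfolding flag_def
  proof (intro exI[of _ "b(k := x)"] conjI)
    show "hkz L (b(k := x)) (Suc k)" using hkz_upd[OF b(1)] assms(2) b(2) by simp
    show "span (insert x S) = span ((b(k := x)) ` {..<Suc k})"
      unfolding span_image_Suc b(2) by (simp add: image_upd_lessThan del: fun_upd_apply) simp
    show "D * perp_inner S x x = (\<Prod>i<Suc k. gsn (b(k := x)) i)"
      unfolding prod_gsn_upd b(3) norm_perp_perp_inner b(2) ..
  qed
qed

lemma minv_perp_inner:
  assumes "minv L S x" "y \<in> L" "y \<notin> S"
  shows "perp_inner S x x \<le> perp_inner S y y"
  using assms unfolding minv_def norm_perp_perp_inner[symmetric] by (auto intro!: power_mono)

text \<open>The determinant is bounded through its square because the product of the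
  \<open>gsn\<close> is the squared covolume; 100/81 is the square of 10/9.\<close>

locale even_lattice = full_lattice L for L :: "(real ^ 8) set" +
  assumes even: "x \<in> L \<Longrightarrow> \<exists>k::int. x \<bullet> x = 2 * of_int k"
    and covol: "(lattice_det L)\<^sup>2 \<le> 100 / 81"
begin

text \<open>Polarisation; the factor 2 is cancelled by the evenness of all three norms.\<close>

lemma inner_int:
  assumes "x \<in> L" "y \<in> L"
  obtains k :: int where "x \<bullet> y = of_int k"
proof -
  obtain a b c :: int where "x \<bullet> x = 2 * of_int a" "y \<bullet> y = 2 * of_int b"
    "(x + y) \<bullet> (x + y) = 2 * of_int c" using even assms add by metis
  then have "x \<bullet> y = of_int (c - a - b)" by (simp add: inner_add_left inner_add_right inner_commute)
  then show ?thesis using that by blast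
qed

lemma even_pos:
  assumes "x \<in> L" "x \<noteq> 0"
  obtains k :: int where "x \<bullet> x = 2 * of_int k" "k \<ge> 1"
proof -
  obtain k :: int where k: "x \<bullet> x = 2 * of_int k" using even assms by blast
  have "x \<bullet> x > 0" using assms by simp
  then have "k \<ge> 1" using k by simp
  then show ?thesis using that k by blast
qed

lemma flag_min:
  assumes "flag L k S D" "k < 8"
  obtains x where "minv L S x"
proof -
  obtain b where "hkz L b k" "S = span (b ` {..<k})" using assms by (auto simp: flag_def)
  then show ?thesis using minv_exists[of k b] hkz_in[of b k] dim_hkz[of L b k] assms(2) that by auto
qed

text \<open>
  In the applications \<open>c\<close> is a rational number slightly above the bound
  \<open>(4/3)\<^bsup>m/2\<^esup> (100 / (81 D))\<^bsup>1/(m+1)\<^esup>\<close> on the next squared Gram-Schmidt norm.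
\<close>
lemma flag_bound:
  assumes f: "flag L k S D" and x: "minv L S x" and k: "k + Suc m = 8"
    and c: "0 \<le> c" "D * c ^ Suc m * (3 / 4) ^ (m * Suc m div 2) > 100 / 81"
  shows "perp_inner S x x < c"
proof (rule ccontr)
  assume "\<not> perp_inner S x x < c"
  then have ge: "c \<le> perp_inner S x x" by simp
  obtain b where b: "hkz L b k" "S = span (b ` {..<k})" "D = (\<Prod>i<k. gsn b i)"
    using f by (auto simp: flag_def)
  have "\<exists>b'. hkz L b' 8 \<and> D * (perp_inner S x x) ^ Suc m * (3 / 4) ^ (\<Sum>{..m}) \<le> (\<Prod>i<8. gsn b' i)"
    using hermite[OF b(1), of x m] x k unfolding b(2,3) norm_perp_perp_inner by simp
  then obtain b' where b': "hkz L b' 8"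
    "D * (perp_inner S x x) ^ Suc m * (3 / 4) ^ (\<Sum>{..m}) \<le> (\<Prod>i<8. gsn b' i)" by blast
  have "(\<Prod>i<8. gsn b' i) \<le> 100 / 81"
    using covolume_hkz[OF full_lattice_axioms, of b'] b'(1) covol by simp
  moreover have "D \<ge> 0" unfolding b(3) by (simp add: prod_nonneg gsn_def)
  then have "D * c ^ Suc m * (3 / 4) ^ (\<Sum>{..m}) \<le> D * (perp_inner S x x) ^ Suc m * (3 / 4) ^ (\<Sum>{..m})"
    using ge c(1) by (intro mult_right_mono mult_left_mono power_mono) auto
  moreover have "\<Sum>{..m} = m * Suc m div 2"
    using gauss_sum_nat[of m] by (simp add: atMost_atLeast0)
  ultimately show False using b'(2) c(2) by simp
qed

text \<open>Allows a minimal vector to be replaced by the most convenient representative of its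
  coset modulo \<open>L \<inter> S\<close>.\<close>

lemma minv_sub:
  assumes "subspace S" "minv L S x" "s \<in> L" "s \<in> S"
  shows "minv L S (x - s)"
  using minv_translate[OF assms(1,2), of "- s"] assms neg by (simp add: subspace_neg)

text \<open>
  If no vector of norm \<open>2\<close> has inner product \<open>1\<close> with the first minimal vector \<open>v\<close>, then the bounds
  leave only \<open>A\<^sub>1 + A\<^sub>1\<close>, then \<open>A\<^sub>1 + A\<^sub>2\<close>, and then a sublattice of rank four with Gram determinant
  \<open>7\<close>. Such a determinant is \<open>0\<close> or \<open>1\<close> modulo \<open>4\<close> in an even lattice.
\<close>
lemma ex_A2:
  obtains v w where "v \<in> L" "w \<in> L" "v \<bullet> v = 2" "w \<bullet> w = 2" "v \<bullet> w = 1" "flag L 2 (span {w, v}) 3"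
    "v \<noteq> 0" "w \<notin> span {v}"
proof -
  obtain v where v: "minv L (span {}) v" using flag_min[OF flag_0] by auto
  have vL: "v \<in> L" and v0: "v \<noteq> 0" using v by (auto simp: minv_def span_zero)
  \<comment> \<open>The Hermite bound exceeds 2, but 2 is the only positive even integer below
    4.\<close>
  have "v \<bullet> v < 4" using flag_bound[OF flag_0 v, of 7 4] unfolding perp_inner_span_empty by (simp add: power_divide)
  then have vv: "v \<bullet> v = 2" using even_pos[OF vL v0] by fastforce
  let ?S1 = "span {v}"
  have f1: "flag L 1 ?S1 2"
    using flag_Suc[OF flag_0 v] unfolding perp_inner_span_empty span_insert_span vv by simp
  have bp1: "perp_inner ?S1 y z = y \<bullet> z - (y \<bullet> v) * (z \<bullet> v) / 2" for y z
    using perp_inner_insert[of "span {}" v y z] v0 unfolding perp_inner_span_empty span_insert_span vv by simp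
  obtain x0 where x0: "minv L ?S1 x0" using flag_min[OF f1] by auto
  have x0L: "x0 \<in> L" using x0 by (simp add: minv_def)
  obtain p0 :: int where p0: "x0 \<bullet> v = of_int p0" using inner_int[OF x0L vL] .
  \<comment> \<open>Since \<open>v \<bullet> v = 2\<close>, multiples of \<open>v\<close> reduce the
    inner product with \<open>v\<close> modulo 2.\<close>
  define x where "x = x0 - of_int (p0 div 2) *\<^sub>R v"
  have x: "minv L ?S1 x" unfolding x_def
    by (rule minv_sub) (auto intro!: scale_int x0 vL span_scale intro: span_base)
  then have xL: "x \<in> L" and xS: "x \<notin> ?S1" by (auto simp: minv_def)
  have x_ne: "x \<noteq> 0" using xS span_zero by metis
  have "x \<bullet> v = of_int (p0 mod 2)"
    by (simp add: x_def inner_diff_left p0 vv minus_div_mult_eq_mod[symmetric])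
  moreover have "p0 mod 2 = 0 \<or> p0 mod 2 = 1" by auto
  ultimately consider "x \<bullet> v = 1" | "x \<bullet> v = 0" by fastforce
  then show ?thesis
  proof cases
    case 1
    have "perp_inner ?S1 x x < 9 / 4" using flag_bound[OF f1 x, of 6 "9 / 4"] by (simp add: power_divide)
    then have "x \<bullet> x < 11 / 4" by (simp add: bp1 1)
    then have xx: "x \<bullet> x = 2" using even_pos[OF xL x_ne] by fastforce
    have "flag L 2 (span {x, v}) 3"
      using flag_Suc[OF f1 x] by (simp add: span_insert_span bp1 xx 1 numeral_2_eq_2)
    then show ?thesis using that[of v x] vL xL vv xx 1 v0 xS by (simp add: inner_commute)
  next
    case 2
    have "perp_inner ?S1 x x < 9 / 4" using flag_bound[OF f1 x, of 6 "9 / 4"] by (simp add: power_divide)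
    then have "x \<bullet> x < 9 / 4" by (simp add: bp1 2)
    then have xx: "x \<bullet> x = 2" using even_pos[OF xL x_ne] by fastforce
    let ?S2 = "span {x, v}"
    have f2: "flag L 2 ?S2 4"
      using flag_Suc[OF f1 x] by (simp add: span_insert_span bp1 xx 2 numeral_2_eq_2)
    have bp2: "perp_inner ?S2 y z = y \<bullet> z - (y \<bullet> v) * (z \<bullet> v) / 2 - (y \<bullet> x) * (z \<bullet> x) / 2" for y z
      using perp_inner_insert[of ?S1 x y z] xS by (simp add: span_insert_span bp1 xx 2)
    obtain y0 where y0: "minv L ?S2 y0" using flag_min[OF f2] by auto
    have y0L: "y0 \<in> L" using y0 by (simp add: minv_def)
    obtain p q :: int where pq: "y0 \<bullet> v = of_int p" "y0 \<bullet> x = of_int q"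
      using inner_int[OF y0L vL] inner_int[OF y0L xL] by metis
    define y where "y = y0 - (of_int (p div 2) *\<^sub>R v + of_int (q div 2) *\<^sub>R x)"
    have y: "minv L ?S2 y" unfolding y_def
      by (rule minv_sub) (auto intro!: scale_int y0 vL xL span_scale span_add add intro: span_base)
    then have yL: "y \<in> L" and yS: "y \<notin> ?S2" by (auto simp: minv_def)
    have y_ne: "y \<noteq> 0" using yS span_zero by metis
    obtain j :: int where j: "y \<bullet> y = 2 * of_int j" "j \<ge> 1" using even_pos[OF yL y_ne] .
    have pq': "y \<bullet> v = of_int (p mod 2)" "y \<bullet> x = of_int (q mod 2)"
      by (simp_all add: y_def inner_diff_left inner_add_left pq vv xx 2 inner_commute[of v x]
          minus_div_mult_eq_mod[symmetric])
    have up: "perp_inner ?S2 y y < 17 / 10" using flag_bound[OF f2 y, of 5 "17 / 10"] by (simp add: power_divide)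
    have lo: "3 / 2 \<le> perp_inner ?S2 y y"
      using minv_step[OF _ x, of y] y unfolding norm_perp_perp_inner span_insert_span by (simp add: bp1 xx 2)
    have cp: "p mod 2 = 0 \<or> p mod 2 = 1" and cq: "q mod 2 = 0 \<or> q mod 2 = 1" by auto
    \<comment> \<open>Each inner product equal to 1 lowers the projected norm by 1/2. As that norm
      lies in [3/2, 17/10), \<open>y\<close> has norm 2 and meets exactly one of \<open>v\<close>
      and \<open>x\<close>.\<close>
    have *: "y \<bullet> v = 0 \<and> y \<bullet> x = 1 \<or> y \<bullet> v = 1 \<and> y \<bullet> x = 0 \<and> y \<bullet> y = 2"
    proof -
      have jc: "real_of_int j = 1 \<or> real_of_int j \<ge> 2" using j(2) by auto
      have b: "perp_inner ?S2 y y = 2 * of_int j - (of_int (p mod 2))\<^sup>2 / 2 - (of_int (q mod 2))\<^sup>2 / 2"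
        unfolding bp2 j(1) pq' by (simp add: power2_eq_square)
      show ?thesis
        using cp cq
      proof (elim disjE)
        assume "p mod 2 = 0" "q mod 2 = 0"
        then have "perp_inner ?S2 y y = 2 * of_int j" unfolding b by simp
        then have False using jc up lo by argo
        then show ?thesis ..
      next
        assume "p mod 2 = 0" "q mod 2 = 1"
        then show ?thesis using pq' by simp
      next
        assume "p mod 2 = 1" "q mod 2 = 0"
        then have "perp_inner ?S2 y y = 2 * of_int j - 1 / 2" "y \<bullet> v = 1" "y \<bullet> x = 0"
          unfolding b pq' by simp_all
        moreover from this have "real_of_int j = 1" using jc up lo by argo
        ultimately show ?thesis using j(1) by simp
      next
        assume "p mod 2 = 1" "q mod 2 = 1"
        then have "perp_inner ?S2 y y = 2 * of_int j - 1" unfolding b by simp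
        then have False using jc up lo by argo
        then show ?thesis ..
      qed
    qed
    \<comment> \<open>If \<open>y\<close> met \<open>v\<close> instead of \<open>x\<close>, its norm
      modulo \<open>v\<close> would be 3/2, less than the value 2 of the minimal vector
      \<open>x\<close>.\<close>
    have "y \<notin> ?S1" using yS span_mono[of "{v}" "{x, v}"] by auto
    then have "2 \<le> perp_inner ?S1 y y" using minv_perp_inner[OF x yL] by (simp add: bp1 xx 2)
    then have yy: "y \<bullet> v = 0" "y \<bullet> x = 1" using * by (auto simp: bp1)
    then have "y \<bullet> y = 2" using up j by (auto simp: bp2)
    let ?S3 = "span {y, x, v}"
    have f3: "flag L 3 ?S3 6"
      using flag_Suc[OF f2 y] by (simp add: span_insert_span bp2 yy \<open>y \<bullet> y = 2\<close> numeral_3_eq_3 numeral_2_eq_2)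
    have bp3: "perp_inner ?S3 a a = perp_inner ?S2 a a - (a \<bullet> y - (a \<bullet> x) / 2)\<^sup>2 * 2 / 3" for a
      using perp_inner_insert[of ?S2 y a a] yS
      by (simp add: span_insert_span bp2 yy \<open>y \<bullet> y = 2\<close> power2_eq_square)
    obtain z where z: "minv L ?S3 z" using flag_min[OF f3] by auto
    then have zL: "z \<in> L" by (auto simp: minv_def)
    have up3: "perp_inner ?S3 z z < 13 / 10" using flag_bound[OF f3 z, of 4 "13 / 10"] by (simp add: power_divide)
    have lo3: "9 / 8 \<le> perp_inner ?S3 z z"
      using minv_step[OF _ y, of z] z unfolding norm_perp_perp_inner span_insert_span
      by (simp add: bp2 yy \<open>y \<bullet> y = 2\<close>)
    obtain k a b c :: int where k: "z \<bullet> z = 2 * of_int k" "z \<bullet> v = of_int a" "z \<bullet> x = of_int b" "z \<bullet> y = of_int c"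
      using even[OF zL] inner_int[OF zL vL] inner_int[OF zL xL] inner_int[OF zL yL] by metis
    \<comment> \<open>The Gram determinant of \<open>v\<close>, \<open>x\<close>, \<open>y\<close>,
      \<open>z\<close>. Modulo 4 only \<open>- 3 * a\<^sup>2\<close> remains, which is congruent to
      \<open>a\<^sup>2\<close>.\<close>
    define N where "N = 12 * k - 3 * a\<^sup>2 - 4 * b\<^sup>2 - 4 * c\<^sup>2 + 4 * (b * c)"
    have "6 * perp_inner ?S3 z z = of_int N"
      by (simp add: N_def bp3 bp2 k power2_eq_square field_simps)
    then have "of_int N < (8::real)" "of_int N > (6::real)" using up3 lo3 by auto
    then have N: "N = 7" by linarith
    have "a\<^sup>2 mod 4 = 0 \<or> a\<^sup>2 mod 4 = 1"
    proof (cases "even a")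
      case True
      then obtain d where "a = 2 * d" by blast
      then show ?thesis by (simp add: power2_eq_square)
    next
      case False
      then obtain d where "a = 2 * d + 1" by (rule oddE)
      then have "a\<^sup>2 = 4 * (d * d + d) + 1" by (simp add: power2_eq_square algebra_simps)
      then show ?thesis by presburger
    qed
    then have False using N unfolding N_def by presburger
    then show ?thesis ..
  qed
qed

text \<open>
  In other words, \<open>e\<close> is orthonormal and \<open>L\<close> contains the root lattice \<open>D\<^sub>k\<close> generated by all
  \<open>e i \<plusminus> e j\<close>; the case \<open>i = 0\<close> of the last condition is \<open>2 *\<^sub>R e 0 \<in> L\<close>.
\<close>
definition frame :: "nat \<Rightarrow> (nat \<Rightarrow> real ^ 8) \<Rightarrow> bool" where
  "frame k e \<longleftrightarrow> (\<forall>i<k. \<forall>j<k. e i \<bullet> e j = (if i = j then 1 else 0)) \<and> (\<forall>i<k. e 0 + e i \<in> L)"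

lemma frame_inner: "frame k e \<Longrightarrow> i < k \<Longrightarrow> j < k \<Longrightarrow> e i \<bullet> e j = (if i = j then 1 else 0)"
  by (simp add: frame_def)

lemma frame_in: "frame k e \<Longrightarrow> i < k \<Longrightarrow> e 0 + e i \<in> L"
  by (simp add: frame_def)

text \<open>Writing each \<open>e i\<close> as (e 0 + e i) - e 0 leaves an even multiple of
  \<open>e 0\<close>, and twice \<open>e 0\<close> is e 0 + e 0.\<close>

lemma frame_combination:
  assumes e: "frame k e" and k: "k > 0" and n: "even (\<Sum>i<k. n i)"
  shows "(\<Sum>i<k. of_int (n i) *\<^sub>R e i) \<in> L"
proof -
  obtain N where N: "(\<Sum>i<k. n i) = 2 * N" using n by blast
  have "(\<Sum>i<k. of_int (n i) *\<^sub>R e i)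
      = (\<Sum>i<k. of_int (n i) *\<^sub>R (e 0 + e i)) - of_int (\<Sum>i<k. n i) *\<^sub>R e 0"
    by (simp add: scaleR_add_right sum.distrib scaleR_sum_left)
  also have "of_int (\<Sum>i<k. n i) *\<^sub>R e 0 = of_int N *\<^sub>R (e 0 + e 0)"
    unfolding N by (simp flip: scaleR_2)
  finally have *: "(\<Sum>i<k. of_int (n i) *\<^sub>R e i)
      = (\<Sum>i<k. of_int (n i) *\<^sub>R (e 0 + e i)) - of_int N *\<^sub>R (e 0 + e 0)" .
  show ?thesis
    unfolding * by (intro diff sum_in scale_int frame_in[OF e]) (use k in auto)
qed

lemma frame_combination_inner:
  assumes e: "frame k e" and j: "j < k"
  shows "(\<Sum>i<k. t i *\<^sub>R e i) \<bullet> e j = t j"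
proof -
  have "(\<Sum>i<k. t i *\<^sub>R e i) \<bullet> e j = (\<Sum>i<k. if i = j then t i else 0)"
    unfolding inner_sum_left by (rule sum.cong) (use frame_inner[OF e] j in auto)
  then show ?thesis using j by simp
qed

lemma frame_span: "(\<Sum>i<k. t i *\<^sub>R e i) \<in> span (e ` {..<k})"
  by (auto intro!: span_sum span_scale intro: span_base)

text \<open>The dual of D_k: inner products with all e 0 + e i are integral. For i = 0 this makes
  \<open>x \<bullet> e 0\<close> integral or half-integral, and the other coordinates follow
  it.\<close>

lemma frame_types:
  assumes e: "frame k e" and k: "k > 0" and x: "x \<in> L"
  obtains (int) c :: "nat \<Rightarrow> int" where "\<And>i. i < k \<Longrightarrow> x \<bullet> e i = of_int (c i)"
  | (half) c :: "nat \<Rightarrow> int" where "\<And>i. i < k \<Longrightarrow> x \<bullet> e i = of_int (c i) + 1 / 2"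
proof -
  have "\<exists>m::int. x \<bullet> (e 0 + e i) = of_int m" if "i < k" for i
    using inner_int[OF x frame_in[OF e that]] by metis
  then obtain m :: "nat \<Rightarrow> int" where m: "\<And>i. i < k \<Longrightarrow> x \<bullet> (e 0 + e i) = of_int (m i)" by metis
  have 0: "2 * (x \<bullet> e 0) = of_int (m 0)" using m[OF k] unfolding inner_add_right by simp
  show ?thesis
  proof (cases "even (m 0)")
    case True
    then obtain n where "m 0 = 2 * n" by blast
    then have "x \<bullet> e 0 = of_int n" using 0 by simp
    then have "x \<bullet> e i = of_int (m i - n)" if "i < k" for i
      using m[OF that] by (simp add: inner_add_right)
    then show ?thesis by (rule int)
  next
    case False
    then obtain n where "m 0 = 2 * n + 1" by (rule oddE)
    then have "x \<bullet> e 0 = of_int n + 1 / 2" using 0 by simp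
    then have "x \<bullet> e i = of_int (m i - n - 1) + 1 / 2" if "i < k" for i
      using m[OF that] by (simp add: inner_add_right)
    then show ?thesis by (rule half)
  qed
qed

text \<open>This sign change preserves D_k and exchanges its two spinor classes.\<close>

lemma frame_flip:
  assumes e: "frame k e" and k: "k > 0"
  shows "frame k (e(0 := - e 0))" "span ((e(0 := - e 0)) ` {..<k}) = span (e ` {..<k})"
proof -
  have "- e 0 + e i = (e 0 + e i) - (e 0 + e 0)" for i by simp
  then have "- e 0 + e i \<in> L" if "i < k" for i
    using frame_in[OF e that] frame_in[OF e k] diff by metis
  moreover have "- e 0 + - e 0 \<in> L" using neg[OF frame_in[OF e k]] by simp
  ultimately show "frame k (e(0 := - e 0))"
    using frame_inner[OF e] k unfolding frame_def by auto
  have a: "(e(0 := - e 0)) ` {..<k} \<subseteq> span (e ` {..<k})"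
    using k by (auto intro!: span_neg intro: span_base)
  have "e i \<in> span ((e(0 := - e 0)) ` {..<k})" if "i < k" for i
  proof (cases "i = 0")
    case True
    have "- e 0 \<in> (e(0 := - e 0)) ` {..<k}" using k by (intro image_eqI[of _ _ 0]) auto
    then have "- (- e 0) \<in> span ((e(0 := - e 0)) ` {..<k})" by (intro span_neg span_base)
    then show ?thesis using True by simp
  next
    case False
    then have "e i \<in> (e(0 := - e 0)) ` {..<k}" using that by (intro image_eqI[of _ _ i]) auto
    then show ?thesis by (rule span_base)
  qed
  then show "span ((e(0 := - e 0)) ` {..<k}) = span (e ` {..<k})"
    using a unfolding span_eq by auto
qed

text \<open>The four cosets of D_k in its dual are the zero class, the vector class and two spinor
  classes; \<open>frame_flip\<close> identifies the last two. The representative chosen has the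
  smallest coordinates of its coset.\<close>

lemma frame_classify:
  assumes e: "frame k e" and k: "k > 0" and x: "minv L (span (e ` {..<k})) x"
  obtains (zero) x' where "minv L (span (e ` {..<k})) x'" "\<And>i. i < k \<Longrightarrow> x' \<bullet> e i = 0"
  | (one) x' where "minv L (span (e ` {..<k})) x'"
      "\<And>i. i < k \<Longrightarrow> x' \<bullet> e i = (if i = 0 then 1 else 0)"
  | (half) x' e' where "frame k e'" "span (e' ` {..<k}) = span (e ` {..<k})"
      "minv L (span (e ` {..<k})) x'" "\<And>i. i < k \<Longrightarrow> x' \<bullet> e' i = 1 / 2"
proof -
  have xL: "x \<in> L" using x by (simp add: minv_def)
  have red: "minv L (span (e ` {..<k})) (x - (\<Sum>i<k. of_int (n i) *\<^sub>R e i))"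
    "\<And>j. j < k \<Longrightarrow> (x - (\<Sum>i<k. of_int (n i) *\<^sub>R e i)) \<bullet> e j = x \<bullet> e j - of_int (n j)"
    if "even (\<Sum>i<k. n i)" for n :: "nat \<Rightarrow> int"
    using that frame_combination[OF e k that]
    by (auto simp: inner_diff_left frame_combination_inner[OF e] intro!: minv_sub x frame_span)
  \<comment> \<open>Correcting coordinate 0 alone puts the subtracted vector into D_k. What is left
    there is r in the integral case and 1/2 - r, that is \<plusminus>1/2, in the half-integral
    case.\<close>
  have parity: "even (\<Sum>i<k. (c(0 := c 0 + (\<Sum>i<k. c i) mod 2)) i)"
    "even (\<Sum>i<k. (c(0 := c 0 - (\<Sum>i<k. c i) mod 2)) i)" for c :: "nat \<Rightarrow> int"
  proof -
    have s: "(\<Sum>i<k. (c(0 := d)) i) = (\<Sum>i<k. c i) - c 0 + d" for d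
    proof -
      obtain l where "k = Suc l" using k gr0_implies_Suc by blast
      then show ?thesis by (simp only: sum.lessThan_Suc_shift) simp
    qed
    show "even (\<Sum>i<k. (c(0 := c 0 + (\<Sum>i<k. c i) mod 2)) i)"
      "even (\<Sum>i<k. (c(0 := c 0 - (\<Sum>i<k. c i) mod 2)) i)"
      unfolding s by presburger+
  qed
  from e k xL show ?thesis
  proof (cases rule: frame_types)
    case (int c)
    define r where "r = (\<Sum>i<k. c i) mod 2"
    define z where "z = x - (\<Sum>i<k. of_int ((c(0 := c 0 - r)) i) *\<^sub>R e i)"
    have m: "minv L (span (e ` {..<k})) z" using red(1)[OF parity(2)[of c]] by (simp add: r_def z_def)
    have i: "z \<bullet> e i = (if i = 0 then of_int r else 0)" if "i < k" for i
      using red(2)[OF parity(2)[of c] that] int[OF that] by (simp add: r_def z_def)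
    have "r = 0 \<or> r = 1" unfolding r_def by auto
    then show ?thesis
    proof
      assume "r = 0"
      then show ?thesis using zero[OF m] i by simp
    next
      assume "r = 1"
      then show ?thesis using one[OF m] i by simp
    qed
  next
    case (half c)
    define r where "r = (\<Sum>i<k. c i) mod 2"
    define z where "z = x - (\<Sum>i<k. of_int ((c(0 := c 0 + r)) i) *\<^sub>R e i)"
    have m: "minv L (span (e ` {..<k})) z" using red(1)[OF parity(1)[of c]] by (simp add: r_def z_def)
    have i: "z \<bullet> e i = (if i = 0 then 1 / 2 - of_int r else 1 / 2)" if "i < k" for i
      using red(2)[OF parity(1)[of c] that] half[OF that] by (simp add: r_def z_def)
    have "r = 0 \<or> r = 1" unfolding r_def by auto
    then show ?thesis
    proof
      assume "r = 0"
      then show ?thesis using that(3)[OF e refl m] i by simp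
    next
      assume "r = 1"
      then have "z \<bullet> (e(0 := - e 0)) i = 1 / 2" if "i < k" for i
        using i[OF that] \<open>r = 1\<close> by (cases "i = 0") simp_all
      then show ?thesis using that(3)[OF frame_flip[OF e k] m] by blast
    qed
  qed
qed


lemma frame_perp_inner:
  assumes "frame k e"
  shows "perp_inner (span (e ` {..<k})) y z = y \<bullet> z - (\<Sum>i<k. (y \<bullet> e i) * (z \<bullet> e i))"
  using perp_inner_orthonormal[of k e y z] frame_inner[OF assms] by blast

text \<open>
  From \<open>A\<^sub>2\<close> the bound leaves only \<open>A\<^sub>3 = D\<^sub>3\<close>.
\<close>
lemma ex_D3:
  obtains e where "frame 3 e" "flag L 3 (span (e ` {..<3})) 4"
proof -
  obtain v w where vw: "v \<in> L" "w \<in> L" "v \<bullet> v = 2" "w \<bullet> w = 2" "v \<bullet> w = 1"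
    "flag L 2 (span {w, v}) 3" "v \<noteq> 0" "w \<notin> span {v}"
    by (rule ex_A2)
  let ?S = "span {w, v}"
  have bp1: "perp_inner (span {v}) y z = y \<bullet> z - (y \<bullet> v) * (z \<bullet> v) / 2" for y z
    using perp_inner_insert[of "span {}" v y z] vw(3,7) unfolding perp_inner_span_empty span_insert_span by simp
  have bp2: "perp_inner ?S y y = y \<bullet> y - (y \<bullet> v)\<^sup>2 / 2 - (y \<bullet> w - (y \<bullet> v) / 2)\<^sup>2 * 2 / 3" for y
    using perp_inner_insert[of "span {v}" w y y] vw
    by (simp add: span_insert_span bp1 inner_commute[of w v] power2_eq_square)
  obtain x0 where x0: "minv L ?S x0" using flag_min[OF vw(6)] by auto
  have S: "subspace ?S" by simp
  have x0L: "x0 \<in> L" using x0 by (simp add: minv_def)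
  obtain p0 q0 :: int where pq0: "x0 \<bullet> v = of_int p0" "x0 \<bullet> w = of_int q0"
    using inner_int[OF x0L vw(1)] inner_int[OF x0L vw(2)] by metis
  obtain x1 t and p q :: int where x1: "minv L ?S x1" and t: "t = 0 \<or> t = (1::int)"
    and pq: "x1 \<bullet> v = of_int p" "x1 \<bullet> w = of_int q" "(p + q) mod 3 = t"
  proof (cases "(p0 + q0) mod 3 = 2")
    case True
    then have "(- p0 + - q0) mod 3 = 1" by presburger
    then show thesis
      by (intro that[of "- x0" 1 "- p0" "- q0"] minv_uminus[OF S x0]) (simp_all only: pq0 inner_minus_left of_int_minus simp_thms)
  next
    case False
    then have "(p0 + q0) mod 3 = 0 \<or> (p0 + q0) mod 3 = 1" by presburger
    then show thesis by (rule that[OF x0 _ pq0 refl])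
  qed
  define r where "r = (p + q) div 3"
  have "p + q = 3 * r + t" unfolding r_def using pq(3) by (metis mult_div_mod_eq)
  \<comment> \<open>The solution of 2 m + n = p - t and m + 2 n = q, the system that makes the inner
    products of \<open>x\<close> with \<open>v\<close> and \<open>w\<close> equal to t and
    0.\<close>
  define m n where "m = 2 * r - q" and "n = q - r"
  have mn: "2 * m + n = p - t" "m + 2 * n = q"
    using \<open>p + q = 3 * r + t\<close> by (simp_all add: m_def n_def)
  define x where "x = x1 - (of_int m *\<^sub>R v + of_int n *\<^sub>R w)"
  have x: "minv L ?S x" unfolding x_def
    by (rule minv_sub) (auto intro!: scale_int x1 vw span_scale span_add add intro: span_base)
  then have xL: "x \<in> L" and xS: "x \<notin> ?S" by (auto simp: minv_def)
  have x_ne: "x \<noteq> 0" using xS span_zero by metis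
  have "x \<bullet> v = of_int p - (2 * of_int m + of_int n)"
    by (simp add: x_def inner_diff_left inner_add_left pq vw inner_commute[of w v])
  also have "\<dots> = of_int t" using arg_cong[OF mn(1), of real_of_int] by simp
  finally have xv: "x \<bullet> v = of_int t" .
  have "x \<bullet> w = of_int q - (of_int m + 2 * of_int n)"
    by (simp add: x_def inner_diff_left inner_add_left pq vw)
  also have "\<dots> = 0" using arg_cong[OF mn(2), of real_of_int] by simp
  finally have xw: "x \<bullet> w = 0" .
  have up: "perp_inner ?S x x < 9 / 5" using flag_bound[OF vw(6) x, of 5 "9 / 5"] by (simp add: power_divide)
  obtain j :: int where j: "x \<bullet> x = 2 * of_int j" "j \<ge> 1" using even_pos[OF xL x_ne] .
  have "t \<noteq> 0"
  proof
    assume "t = 0"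
    then show False using up j by (simp add: bp2 xv xw)
  qed
  then have xv: "x \<bullet> v = 1" using xv t by simp
  have xx: "x \<bullet> x = 2" using up j by (simp add: bp2 xv xw power2_eq_square)
  have f: "flag L 3 (span {x, w, v}) 4"
    using flag_Suc[OF vw(6) x]
    by (simp add: span_insert_span bp2 xv xw xx power2_eq_square numeral_3_eq_3 numeral_2_eq_2)
  \<comment> \<open>Dictated by the model w = a + c, x = a - c, v = a + b of A_3 as D_3.\<close>
  define a b c where "a = (1 / 2) *\<^sub>R (w + x)" and "b = v - a" and "c = (1 / 2) *\<^sub>R (w - x)"
  define e where "e i = (if i = 0 then a else if i = 1 then b else c)" for i :: nat
  have three: "i < 3 \<longleftrightarrow> i = 0 \<or> i = 1 \<or> i = 2" for i :: nat by auto
  have sym: "v \<bullet> x = 1" "w \<bullet> x = 0" "w \<bullet> v = 1"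
    using xv xw vw(5) by (simp_all add: inner_commute)
  have abc: "a \<bullet> a = 1" "b \<bullet> b = 1" "c \<bullet> c = 1" "a \<bullet> b = 0" "a \<bullet> c = 0" "b \<bullet> c = 0"
    by (simp_all add: a_def b_def c_def inner_diff_left inner_diff_right inner_add_left
        inner_add_right vw xx xv xw sym)
  have "frame 3 e"
    unfolding frame_def three
  proof (intro conjI allI impI)
    fix i j :: nat assume "i = 0 \<or> i = 1 \<or> i = 2" "j = 0 \<or> j = 1 \<or> j = 2"
    then show "e i \<bullet> e j = (if i = j then 1 else 0)"
      using abc by (auto simp: e_def inner_commute)
  next
    fix i :: nat assume "i = 0 \<or> i = 1 \<or> i = 2"
    moreover have "a + a = w + x" "a + b = v" "a + c = w"
      by (simp_all add: a_def b_def c_def scaleR_add_right scaleR_diff_right flip: scaleR_add_left)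
    ultimately show "e 0 + e i \<in> L" using vw xL add by (auto simp: e_def)
  qed
  moreover have "span (e ` {..<3}) = span {x, w, v}"
  proof -
    have "e ` {..<3} = {a, b, c}" by (auto simp: e_def three image_iff)
    moreover have "a \<in> span {x, w, v}" "c \<in> span {x, w, v}"
      unfolding a_def c_def by (auto intro!: span_scale span_add span_diff intro: span_base)
    moreover from this have "b \<in> span {x, w, v}"
      unfolding b_def by (auto intro!: span_diff intro: span_base)
    moreover have "x = a - c" "w = a + c" "v = a + b"
      by (simp_all add: a_def b_def c_def scaleR_add_right scaleR_diff_right flip: scaleR_add_left)
    then have "x \<in> span {a, b, c}" "w \<in> span {a, b, c}" "v \<in> span {a, b, c}"
      by (auto intro!: span_add span_diff intro: span_base)
    ultimately show ?thesis unfolding span_eq by simp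
  qed
  ultimately show ?thesis using that f by metis
qed

text \<open>Here \<open>x - e 0\<close> is a unit vector orthogonal to the frame, so D_k grows to
  D_(k+1). The projected norm of \<open>x\<close> is 1, which is why the squared covolume stays
  4.\<close>

lemma frame_extend:
  assumes e: "frame k e" and k: "k > 0" and f: "flag L k (span (e ` {..<k})) 4"
    and x: "minv L (span (e ` {..<k})) x" and xe: "\<And>i. i < k \<Longrightarrow> x \<bullet> e i = (if i = 0 then 1 else 0)"
    and xx: "x \<bullet> x = 2"
  shows "\<exists>e'. frame (Suc k) e' \<and> flag L (Suc k) (span (e' ` {..<Suc k})) 4"
proof (intro exI conjI)
  let ?e = "e(k := x - e 0)"
  have xL: "x \<in> L" using x by (simp add: minv_def)
  have ke: "(x - e 0) \<bullet> e i = 0" if "i < k" for i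
    using frame_inner[OF e k that] xe[OF that] by (auto simp: inner_diff_left)
  have kk: "(x - e 0) \<bullet> (x - e 0) = 1"
    using frame_inner[OF e k k] xe[OF k] xx by (simp add: inner_diff_left inner_diff_right inner_commute)
  show "frame (Suc k) ?e"
    unfolding frame_def
  proof (intro conjI allI impI)
    fix i j assume "i < Suc k" "j < Suc k"
    then show "?e i \<bullet> ?e j = (if i = j then 1 else 0)"
      using frame_inner[OF e] ke kk by (auto simp: less_Suc_eq inner_commute)
  next
    fix i assume "i < Suc k"
    then show "?e 0 + ?e i \<in> L"
      using k xL frame_in[OF e] by (auto simp: less_Suc_eq)
  qed
  have "perp_inner (span (e ` {..<k})) x x = 2 - (\<Sum>i<k. if i = 0 then 1 else 0)"
    unfolding frame_perp_inner[OF e] xx by (intro arg_cong2[of _ _ _ _ "(-)"] sum.cong) (auto simp: xe)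
  also have "\<dots> = 1" using k by simp
  finally have D: "perp_inner (span (e ` {..<k})) x x = 1" .
  have "span (insert x (span (e ` {..<k}))) = span (?e ` {..<Suc k})"
  proof -
    have "?e ` {..<Suc k} = insert (x - e 0) (e ` {..<k})"
      by (auto simp: image_upd_lessThan lessThan_Suc simp del: fun_upd_apply) (auto simp: image_iff)
    moreover have "x - e 0 \<in> span (insert x (e ` {..<k}))"
      using k by (intro span_diff) (auto intro: span_base)
    moreover have "(x - e 0) + e 0 \<in> span (insert (x - e 0) (e ` {..<k}))"
      using k by (intro span_add) (auto intro: span_base)
    then have "x \<in> span (insert (x - e 0) (e ` {..<k}))" by simp
    ultimately show ?thesis
      unfolding span_insert_span span_eq by (auto intro: span_base)
  qed
  then show "flag L (Suc k) (span (?e ` {..<Suc k})) 4"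
    using flag_Suc[OF f x] D by simp
qed

lemma sum_halves:
  fixes k :: nat
  assumes "\<And>i. i < k \<Longrightarrow> x \<bullet> e i = 1 / 2"
  shows "(\<Sum>i<k. (x \<bullet> e i) * (x \<bullet> e i)) = real k / 4"
proof -
  have "(\<Sum>i<k. (x \<bullet> e i) * (x \<bullet> e i)) = (\<Sum>i<k. 1 / 4)"
    by (rule sum.cong) (auto simp: assms)
  then show ?thesis by simp
qed

lemma sum_one:
  assumes "0 < (k::nat)" "\<And>i. i < k \<Longrightarrow> x \<bullet> e i = (if i = 0 then 1 else 0 :: real)"
  shows "(\<Sum>i<k. (x \<bullet> e i) * (x \<bullet> e i)) = 1"
proof -
  have "(\<Sum>i<k. (x \<bullet> e i) * (x \<bullet> e i)) = (\<Sum>i<k. if i = 0 then 1 else 0)"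
    by (rule sum.cong) (auto simp: assms(2))
  then show ?thesis using assms(1) by simp
qed

lemma minv_nonzero:
  assumes "minv L (span A) x"
  obtains j :: int where "x \<in> L" "x \<bullet> x = 2 * of_int j" "j \<ge> 1"
proof -
  have "x \<in> L" "x \<noteq> 0" using assms span_zero unfolding minv_def by metis+
  then show ?thesis using that even_pos by metis
qed

text \<open>For odd k the quotient of the dual of D_k by D_k is cyclic of order 4 and generated by
  the spinor class of \<open>x\<close>. Hence a multiple of \<open>x\<close> and a vector of D_k
  cancel all frame coordinates.\<close>

lemma clear_frame:
  assumes e: "frame k e" and k: "k > 1" and x: "x \<in> L" "\<And>i. i < k \<Longrightarrow> x \<bullet> e i = 1 / 2"
    and kodd: "odd k"
    and S: "subspace S" "x \<in> S" "e ` {..<k} \<subseteq> S" and y: "minv L S y"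
  obtains y' where "minv L S y'" "\<And>i. i < k \<Longrightarrow> y' \<bullet> e i = 0"
proof -
  note goal = that
  have k0: "k > 0" using k by simp
  have int0: thesis if y: "minv L S y" and c: "\<And>i. i < k \<Longrightarrow> y \<bullet> e i = of_int (c i)" for y and c :: "nat \<Rightarrow> int"
  proof -
    \<comment> \<open>Twice \<open>x\<close> has all frame coordinates 1; since k is odd,
      subtracting them changes the parity of the coordinate sum.\<close>
    define par where "par = (\<Sum>i<k. c i) mod 2"
    define n where "n i = c i - par" for i
    have "(\<Sum>i<k. n i) = (\<Sum>i<k. c i) - int k * par"
      unfolding n_def by (simp add: sum_subtractf)
    then have ev: "even (\<Sum>i<k. n i)" using kodd unfolding par_def by (auto simp: even_mod_2_iff)
    let ?s = "of_int (2 * par) *\<^sub>R x + (\<Sum>i<k. of_int (n i) *\<^sub>R e i)"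
    have sL: "?s \<in> L" by (intro add scale_int x frame_combination[OF e k0 ev])
    have sS: "?s \<in> S" by (intro subspace_add[OF S(1)] subspace_scale[OF S(1)] subspace_sum[OF S(1)] S(2)) (use S(3) in auto)
    have "(y - ?s) \<bullet> e i = 0" if "i < k" for i
      using that by (simp add: inner_diff_left inner_add_left frame_combination_inner[OF e that] c x(2) n_def)
    then show thesis using goal[OF minv_sub[OF S(1) y sL sS]] by blast
  qed
  have yL: "y \<in> L" using y by (simp add: minv_def)
  from e k0 yL show thesis
  proof (cases rule: frame_types)
    case (int c)
    then show thesis using int0[OF y] by blast
  next
    case (half c)
    have "minv L S (y - x)" by (rule minv_sub[OF S(1) y x(1) S(2)])
    moreover have "(y - x) \<bullet> e i = of_int (c i)" if "i < k" for i
      using half[OF that] x(2)[OF that] by (simp add: inner_diff_left)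
    ultimately show thesis by (rule int0)
  qed
qed

text \<open>
  The alternative is \<open>A\<^sub>4\<close>, of determinant \<open>5\<close>. The Gram determinant of the next step is then an even
  integer, but the bounds on it leave only \<open>5\<close>.
\<close>
lemma ex_D4:
  obtains e where "frame 4 e" "flag L 4 (span (e ` {..<4})) 4"
proof -
  obtain e where e: "frame 3 e" "flag L 3 (span (e ` {..<3})) 4" by (rule ex_D3)
  let ?S = "span (e ` {..<3})"
  obtain x0 where x0: "minv L ?S x0" using flag_min[OF e(2)] by auto
  have up: "perp_inner ?S x x < 141 / 100" if "minv L ?S x" for x
    using flag_bound[OF e(2) that, of 4 "141 / 100"] by (simp add: power_divide)
  show ?thesis
  proof (cases rule: frame_classify[OF e(1) zero_less_numeral x0, case_names zero one half])
    \<comment> \<open>The projection preserves the norm of a vector orthogonal to the frame, so its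
      value would be at least 2, above the bound.\<close>
    case (zero x)
    obtain j :: int where "x \<bullet> x = 2 * of_int j" "j \<ge> 1" using minv_nonzero[OF zero(1)] by metis
    then show ?thesis using up[OF zero(1)] zero(2) by (simp add: frame_perp_inner[OF e(1)])
  next
    case (one x)
    obtain j :: int where j: "x \<bullet> x = 2 * of_int j" "j \<ge> 1" using minv_nonzero[OF one(1)] by metis
    have "perp_inner ?S x x = x \<bullet> x - 1" unfolding frame_perp_inner[OF e(1)] using sum_one[of 3 x e] one(2) by simp
    then have "x \<bullet> x = 2" using up[OF one(1)] j by simp
    then have "\<exists>e'. frame (Suc 3) e' \<and> flag L (Suc 3) (span (e' ` {..<Suc 3})) 4"
      using one by (intro frame_extend[OF e(1) _ e(2)]) auto
    then show ?thesis using that by auto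
  next
    case (half x e')
    obtain j :: int where j: "x \<in> L" "x \<bullet> x = 2 * of_int j" "j \<ge> 1" using minv_nonzero[OF half(3)] by metis
    have bpS: "perp_inner ?S y z = y \<bullet> z - (\<Sum>i<3. (y \<bullet> e' i) * (z \<bullet> e' i))" for y z
      using frame_perp_inner[OF half(1)] half(2) by simp
    have "perp_inner ?S x x = x \<bullet> x - 3 / 4" unfolding bpS by (subst sum_halves[OF half(4)]) simp_all
    then have bx: "perp_inner ?S x x = 5 / 4" using up[OF half(3)] j by simp
    let ?T = "span (insert x ?S)"
    have f: "flag L 4 ?T 5" using flag_Suc[OF e(2) half(3)] bx by simp
    obtain y0 where y0: "minv L ?T y0" using flag_min[OF f] by auto
    obtain y where y: "minv L ?T y" "\<And>i. i < 3 \<Longrightarrow> y \<bullet> e' i = 0"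
    proof (rule clear_frame[OF half(1) _ j(1) half(4) _ _ _ _ y0])
      have "e' ` {..<3} \<subseteq> ?S" using half(2) span_superset by metis
      then show "e' ` {..<3} \<subseteq> ?T" using span_superset by (metis (no_types, lifting) insert_subset order_trans)
    qed (auto intro: span_base)
    have up2: "perp_inner ?T y y < 11 / 10" using flag_bound[OF f y(1), of 3 "11 / 10"] by (simp add: power_divide)
    have lo2: "15 / 16 \<le> perp_inner ?T y y"
      using minv_step[OF _ half(3) y(1)] unfolding norm_perp_perp_inner bx by simp
    have yL: "y \<in> L" using y by (simp add: minv_def)
    obtain m t :: int where mt: "y \<bullet> y = 2 * of_int m" "y \<bullet> x = of_int t"
      using even[OF yL] inner_int[OF yL j(1)] by metis
    have "perp_inner ?S y y = y \<bullet> y" "perp_inner ?S y x = y \<bullet> x" using y(2) by (simp_all add: bpS)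
    then have "perp_inner ?T y y = 2 * of_int m - (of_int t)\<^sup>2 * 4 / 5"
      using perp_inner_insert[of ?S x y y] half(3) bx mt by (simp add: minv_def power2_eq_square)
    then have "5 * perp_inner ?T y y = of_int (10 * m - 4 * t\<^sup>2)" by simp
    then have "of_int (10 * m - 4 * t\<^sup>2) < (6 :: real)" "of_int (10 * m - 4 * t\<^sup>2) > (4 :: real)"
      using up2 lo2 by linarith+
    then have "10 * m - 4 * t\<^sup>2 = 5" by linarith
    then have False by presburger
    then show ?thesis ..
  qed
qed

text \<open>
  The spinor classes of \<open>D\<^sub>4\<close> are turned into the vector class by triality, that is by passing to the
  Hadamard frame \<open>f\<close>.
\<close>
lemma ex_D5:
  obtains e where "frame 5 e" "flag L 5 (span (e ` {..<5})) 4"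
proof -
  obtain e where e: "frame 4 e" "flag L 4 (span (e ` {..<4})) 4" by (rule ex_D4)
  let ?S = "span (e ` {..<4})"
  obtain x0 where x0: "minv L ?S x0" using flag_min[OF e(2)] by auto
  have up: "perp_inner ?S x x < 115 / 100" if "minv L ?S x" for x
    using flag_bound[OF e(2) that, of 3 "115 / 100"] by (simp add: power_divide)
  have ext: thesis if "frame 4 e'" "flag L 4 (span (e' ` {..<4})) 4" "minv L (span (e' ` {..<4})) x"
    "\<And>i. i < 4 \<Longrightarrow> x \<bullet> e' i = (if i = 0 then 1 else 0)" "x \<bullet> x = 2" for x e'
  proof -
    have "\<exists>e''. frame (Suc 4) e'' \<and> flag L (Suc 4) (span (e'' ` {..<Suc 4})) 4"
      using that by (intro frame_extend[of 4 e' x]) auto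
    then show thesis using \<open>\<And>e. frame 5 e \<Longrightarrow> _ \<Longrightarrow> thesis\<close> by auto
  qed
  show ?thesis
  proof (cases rule: frame_classify[OF e(1) zero_less_numeral x0, case_names zero one half])
    case (zero x)
    obtain j :: int where "x \<bullet> x = 2 * of_int j" "j \<ge> 1" using minv_nonzero[OF zero(1)] by metis
    then show ?thesis using up[OF zero(1)] zero(2) by (simp add: frame_perp_inner[OF e(1)])
  next
    case (one x)
    obtain j :: int where j: "x \<bullet> x = 2 * of_int j" "j \<ge> 1" using minv_nonzero[OF one(1)] by metis
    have "perp_inner ?S x x = x \<bullet> x - 1" unfolding frame_perp_inner[OF e(1)] using sum_one[of 4 x e] one(2) by simp
    then have "x \<bullet> x = 2" using up[OF one(1)] j by simp
    then show ?thesis using one by (intro ext[OF e]) auto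
  next
    case (half x e')
    obtain j :: int where j: "x \<in> L" "x \<bullet> x = 2 * of_int j" "j \<ge> 1" using minv_nonzero[OF half(3)] by metis
    have bpS: "perp_inner ?S y z = y \<bullet> z - (\<Sum>i<4. (y \<bullet> e' i) * (z \<bullet> e' i))" for y z
      using frame_perp_inner[OF half(1)] half(2) by simp
    have "perp_inner ?S x x = x \<bullet> x - 1" unfolding bpS by (subst sum_halves[OF half(4)]) simp_all
    then have xx: "x \<bullet> x = 2" using up[OF half(3)] j by simp
    \<comment> \<open>Half the rows of a Hadamard matrix applied to the frame. \<open>f 0\<close> is
      the projection of \<open>x\<close> to the span of the frame, so \<open>x\<close> has
      coordinates 1, 0, 0, 0.\<close>
    define f where "f i = (1 / 2) *\<^sub>R (if i = 0 then e' 0 + e' 1 + e' 2 + e' 3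
      else if i = 1 then e' 0 + e' 1 - e' 2 - e' 3
      else if i = 2 then e' 0 - e' 1 + e' 2 - e' 3 else e' 0 - e' 1 - e' 2 + e' 3)" for i :: nat
    have four: "i < 4 \<longleftrightarrow> i = 0 \<or> i = 1 \<or> i = 2 \<or> i = 3" for i :: nat by auto
    have ee: "e' 0 \<bullet> e' 0 = 1" "e' 1 \<bullet> e' 1 = 1" "e' 2 \<bullet> e' 2 = 1" "e' 3 \<bullet> e' 3 = 1"
      "e' 0 \<bullet> e' 1 = 0" "e' 0 \<bullet> e' 2 = 0" "e' 0 \<bullet> e' 3 = 0" "e' 1 \<bullet> e' 0 = 0" "e' 1 \<bullet> e' 2 = 0"
      "e' 1 \<bullet> e' 3 = 0" "e' 2 \<bullet> e' 0 = 0" "e' 2 \<bullet> e' 1 = 0" "e' 2 \<bullet> e' 3 = 0" "e' 3 \<bullet> e' 0 = 0"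
      "e' 3 \<bullet> e' 1 = 0" "e' 3 \<bullet> e' 2 = 0"
      using frame_inner[OF half(1)] by auto
    have "frame 4 f" unfolding frame_def four
    proof (intro conjI allI impI)
      fix i j :: nat assume "i = 0 \<or> i = 1 \<or> i = 2 \<or> i = 3" "j = 0 \<or> j = 1 \<or> j = 2 \<or> j = 3"
      then show "f i \<bullet> f j = (if i = j then 1 else 0)"
        by (elim disjE) (simp_all add: f_def inner_add_left inner_add_right inner_diff_left
            inner_diff_right ee del: One_nat_def)
    next
      fix i :: nat assume i: "i = 0 \<or> i = 1 \<or> i = 2 \<or> i = 3"
      have eL: "e' 0 + e' 1 \<in> L" "e' 0 + e' 2 \<in> L" "e' 0 + e' 3 \<in> L" "e' 0 + e' 0 \<in> L"
        by (rule frame_in[OF half(1)]; simp)+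
      have "f 0 + f 0 = (e' 0 + e' 1) + (e' 0 + e' 2) + (e' 0 + e' 3) - (e' 0 + e' 0)"
        "f 0 + f 1 = e' 0 + e' 1" "f 0 + f 2 = e' 0 + e' 2" "f 0 + f 3 = e' 0 + e' 3"
        unfolding f_def by (simp_all add: vec_eq_iff field_simps)
      moreover have "(e' 0 + e' 1) + (e' 0 + e' 2) + (e' 0 + e' 3) - (e' 0 + e' 0) \<in> L"
        by (intro add diff eL)
      ultimately show "f 0 + f i \<in> L" using i eL by auto
    qed
    moreover have fS: "span (f ` {..<4}) = span (e' ` {..<4})"
    proof -
      have e4: "e' 0 \<in> span (e' ` {..<4})" "e' 1 \<in> span (e' ` {..<4})" "e' 2 \<in> span (e' ` {..<4})"
        "e' 3 \<in> span (e' ` {..<4})" by (auto intro: span_base)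
      then have "f ` {..<4} \<subseteq> span (e' ` {..<4})"
        unfolding f_def by (auto intro!: span_scale span_add span_diff)
      moreover have "e' 0 = (1 / 2) *\<^sub>R (f 0 + f 1 + f 2 + f 3)" "e' 1 = (1 / 2) *\<^sub>R (f 0 + f 1 - f 2 - f 3)"
        "e' 2 = (1 / 2) *\<^sub>R (f 0 - f 1 + f 2 - f 3)" "e' 3 = (1 / 2) *\<^sub>R (f 0 - f 1 - f 2 + f 3)"
        unfolding f_def by (simp_all add: vec_eq_iff field_simps)
      moreover have "f 0 \<in> span (f ` {..<4})" "f 1 \<in> span (f ` {..<4})" "f 2 \<in> span (f ` {..<4})"
        "f 3 \<in> span (f ` {..<4})" by (auto intro: span_base)
      ultimately have "e' 0 \<in> span (f ` {..<4})" "e' 1 \<in> span (f ` {..<4})" "e' 2 \<in> span (f ` {..<4})"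
        "e' 3 \<in> span (f ` {..<4})" 
        by (metis span_scale span_add span_diff)+
      then have "e' ` {..<4} \<subseteq> span (f ` {..<4})" unfolding image_subset_iff by (auto simp: four)
      then show ?thesis using \<open>f ` {..<4} \<subseteq> _\<close> unfolding span_eq by simp
    qed
    moreover have "x \<bullet> f i = (if i = 0 then 1 else 0)" if "i < 4" for i
      using that half(4)[of 0] half(4)[of 1] half(4)[of 2] half(4)[of 3] unfolding four
      by (auto simp: f_def inner_add_right inner_diff_right)
    ultimately show ?thesis using half(2,3) e(2) xx by (intro ext[of f x]) auto
  qed
qed


text \<open>
  The chain continues with \<open>E\<^sub>6 \<subset> E\<^sub>7 \<subset> E\<^sub>8\<close>. In the coordinates of \<open>E\<^sub>8\<close> the vectors below are
  \<open>x = (e 0 + \<dots> + e 7) / 2\<close>, \<open>z = e 5 + e 6\<close>, \<open>u = e 5 + e 7\<close> and \<open>y = e 5 + e 6 + e 7\<close>, which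
  dictates the definition of \<open>f\<close>.
\<close>
lemma ex_E8_frame:
  obtains e where "frame 8 e" "(1 / 2) *\<^sub>R (\<Sum>i<8. e i) \<in> L"
proof -
  obtain e0 where e0: "frame 5 e0" "flag L 5 (span (e0 ` {..<5})) 4" by (rule ex_D5)
  let ?S = "span (e0 ` {..<5})"
  obtain x0 where x0: "minv L ?S x0" using flag_min[OF e0(2)] by auto
  have up: "perp_inner ?S x x < 91 / 100" if "minv L ?S x" for x
    using flag_bound[OF e0(2) that, of 2 "91 / 100"] by (simp add: power_divide)
  show ?thesis
  proof (cases rule: frame_classify[OF e0(1) zero_less_numeral x0, case_names zero one half])
    case (zero x)
    obtain j :: int where "x \<bullet> x = 2 * of_int j" "j \<ge> 1" using minv_nonzero[OF zero(1)] by metis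
    then show ?thesis using up[OF zero(1)] zero(2) by (simp add: frame_perp_inner[OF e0(1)])
  next
    case (one x)
    obtain j :: int where j: "x \<bullet> x = 2 * of_int j" "j \<ge> 1" using minv_nonzero[OF one(1)] by metis
    have "perp_inner ?S x x = x \<bullet> x - 1" unfolding frame_perp_inner[OF e0(1)] using sum_one[of 5 x e0] one(2) by simp
    then show ?thesis using up[OF one(1)] j by simp
  next
    case (half x e)
    note e = half(1) and xe = half(4)
    obtain j :: int where j: "x \<in> L" "x \<bullet> x = 2 * of_int j" "j \<ge> 1" using minv_nonzero[OF half(3)] by metis
    note xL = j(1)
    have bpS: "perp_inner ?S y z = y \<bullet> z - (\<Sum>i<5. (y \<bullet> e i) * (z \<bullet> e i))" for y z
      using frame_perp_inner[OF e] half(2) by simp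
    have "perp_inner ?S x x = x \<bullet> x - 5 / 4" unfolding bpS by (subst sum_halves[OF xe]) simp_all
    then have xx: "x \<bullet> x = 2" and bx: "perp_inner ?S x x = 3 / 4" using up[OF half(3)] j by simp_all
    define \<sigma> where "\<sigma> = (\<Sum>i<5. e i)"
    have \<sigma>e: "\<sigma> \<bullet> e i = 1" if "i < 5" for i
      using frame_combination_inner[OF e that, of "\<lambda>_. 1"] by (simp add: \<sigma>_def)
    have x\<sigma>: "x \<bullet> \<sigma> = 5 / 2" unfolding \<sigma>_def inner_sum_right by (simp add: xe)
    have \<sigma>\<sigma>: "\<sigma> \<bullet> \<sigma> = 5"
    proof -
      have "\<sigma> \<bullet> \<sigma> = (\<Sum>i<5. \<sigma> \<bullet> e i)" by (simp add: \<sigma>_def inner_sum_right)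
      also have "\<dots> = (\<Sum>i<5::nat. 1)" by (rule sum.cong) (auto simp: \<sigma>e)
      finally show ?thesis by simp
    qed
    have x\<sigma>': "\<sigma> \<bullet> x = 5 / 2" using x\<sigma> by (simp add: inner_commute)
    have \<sigma>2: "2 *\<^sub>R \<sigma> \<in> L"
      using frame_combination[OF e, of "\<lambda>_. 2"] by (simp add: \<sigma>_def scaleR_sum_right)
    have eS: "e ` {..<5} \<subseteq> ?S" using half(2) span_superset by metis
    have \<sigma>S: "\<sigma> \<in> ?S" unfolding \<sigma>_def using eS by (intro span_sum) auto
    let ?S6 = "span (insert x ?S)"
    have S6: "?S \<subseteq> ?S6" "x \<in> ?S6" by (auto intro: span_base)
    have f6: "flag L 6 ?S6 3" using flag_Suc[OF e0(2) half(3)] bx by simp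
    have xS: "x \<notin> ?S" using half(3) by (simp add: minv_def)
    have bp6: "perp_inner ?S6 y z = y \<bullet> z - (y \<bullet> x) * (z \<bullet> x) * 4 / 3"
      if "\<And>i. i < 5 \<Longrightarrow> y \<bullet> e i = 0" "\<And>i. i < 5 \<Longrightarrow> z \<bullet> e i = 0" for y z
    proof -
      have "perp_inner ?S y x = y \<bullet> x" "perp_inner ?S z x = z \<bullet> x" "perp_inner ?S y z = y \<bullet> z"
        using that by (simp_all add: bpS)
      then show ?thesis using perp_inner_insert[of ?S x y z] xS bx by simp
    qed
    \<comment> \<open>A lattice vector of the rank-six part orthogonal to the frame, with
      \<open>h \<bullet> x = 3\<close>: it shifts inner products with \<open>x\<close> by multiples
      of 3 and leaves the frame coordinates zero.\<close>
    define h where "h = 4 *\<^sub>R x - 2 *\<^sub>R \<sigma>"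
    have hL: "h \<in> L" unfolding h_def using diff[OF scale_int[OF xL, of 4] \<sigma>2] by simp
    have hS: "h \<in> ?S6" unfolding h_def using \<sigma>S S6 by (intro span_diff span_scale) auto
    have he: "h \<bullet> e i = 0" if "i < 5" for i
      using that by (simp add: h_def inner_diff_left xe \<sigma>e)
    have hx: "h \<bullet> x = 3" by (simp add: h_def inner_diff_left xx x\<sigma>')
    obtain z0 where z0: "minv L ?S6 z0" using flag_min[OF f6] by auto
    obtain z1 where z1: "minv L ?S6 z1" "\<And>i. i < 5 \<Longrightarrow> z1 \<bullet> e i = 0"
      by (rule clear_frame[OF e _ xL xe _ _ _ _ z0]) (use S6 eS in auto)
    have up6: "perp_inner ?S6 z z < 3 / 4" if "minv L ?S6 z" for z
      using flag_bound[OF f6 that, of 1 "3 / 4"] by (simp add: power_divide power2_eq_square)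
    have z1L: "z1 \<in> L" using z1 by (simp add: minv_def)
    obtain m t :: int where mt: "z1 \<bullet> z1 = 2 * of_int m" "z1 \<bullet> x = of_int t"
      using even[OF z1L] inner_int[OF z1L xL] by metis
    have "3 * perp_inner ?S6 z1 z1 = of_int (6 * m - 4 * t\<^sup>2)"
      by (simp add: bp6[OF z1(2) z1(2)] mt power2_eq_square)
    moreover have "perp_inner ?S6 z1 z1 > 0" using perp_inner_pos z1(1) by (auto simp: minv_def)
    ultimately have "of_int (6 * m - 4 * t\<^sup>2) < (3 :: real)" "of_int (6 * m - 4 * t\<^sup>2) > (0 :: real)"
      using up6[OF z1(1)] by linarith+
    then have "6 * m - 4 * t\<^sup>2 < 3" "6 * m - 4 * t\<^sup>2 > 0" by linarith+
    \<comment> \<open>The quantity \<open>6 * m - 4 * t\<^sup>2\<close> is even and strictly between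
      0 and 3, hence 2. This prevents 3 from dividing t, and a sign change then makes t congruent to
      1.\<close>
    then have mt2: "3 * m - 2 * t\<^sup>2 = 1" by presburger
    have t3: "t mod 3 \<noteq> 0"
    proof
      assume "t mod 3 = 0"
      then obtain d where "t = 3 * d" by (auto simp: mod_eq_0_iff_dvd)
      then have "3 * (m - 6 * d\<^sup>2) = 1" using mt2 by (simp add: power_mult_distrib)
      then show False by presburger
    qed
    obtain z2 and r :: int where z2: "minv L ?S6 z2" "\<And>i. i < 5 \<Longrightarrow> z2 \<bullet> e i = 0" "z2 \<bullet> x = of_int (3 * r + 1)"
    proof (cases "t mod 3 = 1")
      case True
      then have "t = 3 * (t div 3) + 1" by presburger
      then show thesis using that[OF z1, of "t div 3"] mt(2) by metis
    next
      case False
      then have "- t = 3 * ((- t) div 3) + 1" using t3 by presburger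
      moreover have "(- z1) \<bullet> x = of_int (- t)" using mt(2) by simp
      moreover have "(- z1) \<bullet> e i = 0" if "i < 5" for i using z1(2)[OF that] by simp
      ultimately show thesis using that[OF minv_uminus[OF _ z1(1)], of "(- t) div 3"] by simp
    qed
    define z where "z = z2 - of_int r *\<^sub>R h"
    have z: "minv L ?S6 z" unfolding z_def
      by (rule minv_sub[OF _ z2(1)]) (auto intro: scale_int hL span_scale hS)
    have ze: "z \<bullet> e i = 0" if "i < 5" for i
      using z2(2) he that by (simp add: z_def inner_diff_left)
    have zx: "z \<bullet> x = 1" by (simp add: z_def inner_diff_left z2(3) hx)
    obtain j where "z \<in> L" "z \<bullet> z = 2 * of_int j" "j \<ge> 1" using minv_nonzero[OF z] by metis
    then have zL: "z \<in> L" and zz: "z \<bullet> z = 2" using up6[OF z] by (simp_all add: bp6[OF ze ze] zx)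
    have bz: "perp_inner ?S6 z z = 2 / 3" by (simp add: bp6[OF ze ze] zx zz)
    let ?S7 = "span (insert z ?S6)"
    have f7: "flag L 7 ?S7 2" using flag_Suc[OF f6 z] bz by simp
    have S7: "?S6 \<subseteq> ?S7" "z \<in> ?S7" by (auto intro: span_base)
    have zS: "z \<notin> ?S6" using z by (simp add: minv_def)
    have bp7: "perp_inner ?S7 u u = u \<bullet> u - (u \<bullet> x)\<^sup>2 * 4 / 3 - (u \<bullet> z - (u \<bullet> x) * 4 / 3)\<^sup>2 * 3 / 2"
      if "\<And>i. i < 5 \<Longrightarrow> u \<bullet> e i = 0" for u
      using perp_inner_insert[of ?S6 z u u] zS
      by (simp add: bz bp6[OF that that] bp6[OF that ze] zx power2_eq_square)
    obtain u0 where u0: "minv L ?S7 u0" using flag_min[OF f7] by auto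
    obtain u1 where u1: "minv L ?S7 u1" "\<And>i. i < 5 \<Longrightarrow> u1 \<bullet> e i = 0"
    proof (rule clear_frame[OF e _ xL xe _ _ _ _ u0])
      show "x \<in> ?S7" using S6(2) S7(1) by blast
      show "e ` {..<5} \<subseteq> ?S7" using eS S6(1) S7(1) by blast
    qed auto
    have up7: "perp_inner ?S7 u u < 7 / 10" if "minv L ?S7 u" for u
      using flag_bound[OF f7 that, of 0 "7 / 10"] by simp
    have u1L: "u1 \<in> L" using u1 by (simp add: minv_def)
    obtain p t s :: int where pts: "u1 \<bullet> u1 = 2 * of_int p" "u1 \<bullet> x = of_int t" "u1 \<bullet> z = of_int s"
      using even[OF u1L] inner_int[OF u1L xL] inner_int[OF u1L zL] by metis
    have "2 * perp_inner ?S7 u1 u1 = of_int (4 * p - 8 * t\<^sup>2 - 3 * s\<^sup>2 + 8 * (s * t))"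
      by (simp add: bp7[OF u1(2)] pts power2_eq_square field_simps)
    moreover have "perp_inner ?S7 u1 u1 > 0" using perp_inner_pos u1(1) by (auto simp: minv_def)
    ultimately have "of_int (4 * p - 8 * t\<^sup>2 - 3 * s\<^sup>2 + 8 * (s * t)) < (2 :: real)"
      "of_int (4 * p - 8 * t\<^sup>2 - 3 * s\<^sup>2 + 8 * (s * t)) > (0 :: real)"
      using up7[OF u1(1)] by linarith+
    then have "4 * p - 8 * t\<^sup>2 - 3 * s\<^sup>2 + 8 * (s * t) = 1" by linarith
    \<comment> \<open>Modulo 2 only 3 S remains. Replacing the nonlinear terms by variables makes
      this a statement of linear arithmetic.\<close>
    moreover have "odd S" if "4 * p - 8 * T - 3 * S + 8 * w = 1" for p T S w :: int
      using that by presburger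
    ultimately have "odd (s\<^sup>2)" by blast
    then have "odd s" by simp
    then obtain n where n: "s = 2 * n + 1" by (rule oddE)
    \<comment> \<open>The vector h - 2 z has inner product 0 with \<open>z\<close> and 1 with
      \<open>x\<close>: the multiple of \<open>z\<close> adjusts \<open>u \<bullet> z\<close>, and
      the second term then adjusts \<open>u \<bullet> x\<close> independently.\<close>
    define u where "u = u1 - (of_int n *\<^sub>R z + of_int (t - n - 1) *\<^sub>R (h - 2 *\<^sub>R z))"
    have z2L: "2 *\<^sub>R z \<in> L" using scale_int[OF zL, of 2] by simp
    have u: "minv L ?S7 u" unfolding u_def
    proof (rule minv_sub[OF _ u1(1)])
      have "h - 2 *\<^sub>R z \<in> ?S7" "h - 2 *\<^sub>R z \<in> L"
        using subsetD[OF S7(1) hS] S7(2) by (intro span_diff span_scale diff hL z2L; simp)+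
      then show "of_int n *\<^sub>R z + of_int (t - n - 1) *\<^sub>R (h - 2 *\<^sub>R z) \<in> ?S7"
        "of_int n *\<^sub>R z + of_int (t - n - 1) *\<^sub>R (h - 2 *\<^sub>R z) \<in> L"
        using S7(2) zL by (intro span_add span_scale add scale_int; simp)+
    qed simp
    have ue: "u \<bullet> e i = 0" if "i < 5" for i
      using u1(2) he ze that by (simp add: u_def inner_diff_left inner_add_left)
    have hz: "h \<bullet> z = 4"
    proof -
      have "z \<bullet> \<sigma> = 0" unfolding \<sigma>_def inner_sum_right by (simp add: ze)
      then show ?thesis using zx by (simp add: h_def inner_diff_left inner_commute[of x z] inner_commute[of \<sigma> z])
    qed
    have uz: "u \<bullet> z = 1"
      by (simp add: u_def inner_diff_left inner_add_left pts zz hz n)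
    have ux: "u \<bullet> x = 1"
      by (simp add: u_def inner_diff_left inner_add_left pts zx hx)
    obtain j where "u \<in> L" "u \<bullet> u = 2 * of_int j" "j \<ge> 1" using minv_nonzero[OF u] by metis
    then have uL: "u \<in> L" and uu: "u \<bullet> u = 2"
      using up7[OF u] by (simp_all add: bp7[OF ue] ux uz power2_eq_square)
    define y where "y = 2 *\<^sub>R x - \<sigma>"
    have ye: "y \<bullet> e i = 0" if "i < 5" for i
      using that by (simp add: y_def inner_diff_left xe \<sigma>e)
    have yy: "y \<bullet> y = 3"
      by (simp add: y_def inner_diff_left inner_diff_right xx x\<sigma> x\<sigma>' \<sigma>\<sigma>)
    have y\<sigma>: "z \<bullet> \<sigma> = 0" "u \<bullet> \<sigma> = 0" unfolding \<sigma>_def inner_sum_right by (simp_all add: ze ue)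
    have zy: "z \<bullet> y = 2" "u \<bullet> y = 2" by (simp_all add: y_def inner_diff_right zx ux y\<sigma>)
    define f where "f i = (if i < 5 then e i else if i = 5 then z + u - y else if i = 6 then y - u else y - z)" for i
    have eight: "i < 8 \<longleftrightarrow> i < 5 \<or> i = 5 \<or> i = 6 \<or> i = 7" for i :: nat by auto
    have eo: "e i \<bullet> y = 0" "e i \<bullet> z = 0" "e i \<bullet> u = 0" if "i < 5" for i
      using ye[OF that] ze[OF that] ue[OF that] by (simp_all add: inner_commute)
    have sym: "y \<bullet> z = 2" "y \<bullet> u = 2" "z \<bullet> u = 1" using zy uz by (simp_all add: inner_commute)
    \<comment> \<open>\<open>y\<close> has norm 3 and so is not in \<open>L\<close>. Adding
      \<open>e 0\<close> repairs this, as \<open>\<sigma> - e 0\<close> is a sum of four frame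
      vectors and thus lies in D_5.\<close>
    have yL: "e 0 + y \<in> L"
    proof -
      have "(\<Sum>i<5. of_int (if i = 0 then 0 else 1) *\<^sub>R e i) \<in> L"
        by (rule frame_combination[OF e]) (simp_all add: eval_nat_numeral)
      moreover have "\<sigma> = e 0 + (\<Sum>i<5. of_int (if i = 0 then 0 else 1) *\<^sub>R e i)"
        unfolding \<sigma>_def by (simp add: eval_nat_numeral)
      ultimately have "\<sigma> - e 0 \<in> L" by simp
      then have "of_int 2 *\<^sub>R x - (\<sigma> - e 0) \<in> L" by (rule diff[OF scale_int[OF xL]])
      moreover have "of_int 2 *\<^sub>R x - (\<sigma> - e 0) = e 0 + y" by (simp add: y_def)
      ultimately show ?thesis by metis
    qed
    have "frame 8 f" unfolding frame_def eight
    proof (intro conjI allI impI)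
      fix i j :: nat assume "i < 5 \<or> i = 5 \<or> i = 6 \<or> i = 7" "j < 5 \<or> j = 5 \<or> j = 6 \<or> j = 7"
      then show "f i \<bullet> f j = (if i = j then 1 else 0)"
        by (elim disjE) (simp_all add: f_def frame_inner[OF e] eo ye ze ue inner_add_left inner_add_right
            inner_diff_left inner_diff_right yy zz uu zy uz sym)
    next
      fix i :: nat assume i: "i < 5 \<or> i = 5 \<or> i = 6 \<or> i = 7"
      have "f 0 + f 7 = (e 0 + y) - z" "f 0 + f 6 = (e 0 + y) - u"
        "f 0 + f 5 = z + u - (e 0 + y) + (e 0 + e 0)" by (simp_all add: f_def algebra_simps)
      moreover have "(e 0 + y) - z \<in> L" "(e 0 + y) - u \<in> L" "z + u - (e 0 + y) + (e 0 + e 0) \<in> L"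
        by (intro add diff yL zL uL frame_in[OF e]; simp)+
      moreover have "f 0 + f i \<in> L" if "i < 5" using frame_in[OF e that] that by (simp add: f_def)
      ultimately show "f 0 + f i \<in> L" using i by metis
    qed
    moreover have "(\<Sum>i<8. f i) = 2 *\<^sub>R x"
    proof -
      have "(\<Sum>i<8. f i) = (\<Sum>i<5. f i) + f 5 + f 6 + f 7" by (simp add: eval_nat_numeral add.assoc)
      also have "(\<Sum>i<5. f i) = \<sigma>" unfolding \<sigma>_def by (rule sum.cong) (auto simp: f_def)
      finally show ?thesis by (simp add: f_def y_def algebra_simps)
    qed
    then have "(1 / 2) *\<^sub>R (\<Sum>i<8. f i) \<in> L" using xL by simp
    ultimately show ?thesis using that by blast
  qed
qed

end

section \<open>A basis of the E8 lattice\<close>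

text \<open>Suited to the claim: for orthonormal \<open>e\<close> the vector at 0 has length 2 and
  all others have length sqrt 2. Linearity in \<open>e\<close> carries errors of a frame over to the
  basis.\<close>

definition e8_basis :: "(nat \<Rightarrow> 'a::real_vector) \<Rightarrow> nat \<Rightarrow> 'a" where
  "e8_basis e k = (if k = 0 then 2 *\<^sub>R e 0 else if k < 7 then e k - e (k - 1)
     else (1 / 2) *\<^sub>R (\<Sum>i<8. e i))"

text \<open>
  The inverse of \<open>e8_basis\<close>: it recovers the orthonormal frame from the basis vectors.
\<close>
definition e8_frame :: "(nat \<Rightarrow> 'a::real_vector) \<Rightarrow> nat \<Rightarrow> 'a" where
  "e8_frame U k = (if k < 7 then (1 / 2) *\<^sub>R U 0 + (\<Sum>j<k. U (Suc j))
     else 2 *\<^sub>R U 7 - (\<Sum>j<7. (1 / 2) *\<^sub>R U 0 + (\<Sum>i<j. U (Suc i))))"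

definition E8_coords :: "(nat \<Rightarrow> real) \<Rightarrow> bool" where
  "E8_coords x \<longleftrightarrow> ((\<forall>i<8. \<exists>m::int. x i = of_int m) \<or> (\<forall>i<8. \<exists>m::int. x i = of_int m + 1 / 2)) \<and>
     (\<exists>m::int. (\<Sum>i<8. x i) = 2 * of_int m)"

lemma all_less_8: "(\<forall>i<8::nat. P i) \<longleftrightarrow> P 0 \<and> P 1 \<and> P 2 \<and> P 3 \<and> P 4 \<and> P 5 \<and> P 6 \<and> P 7"
proof -
  have "i < 8 \<longleftrightarrow> i = 0 \<or> i = 1 \<or> i = 2 \<or> i = 3 \<or> i = 4 \<or> i = 5 \<or> i = 6 \<or> i = 7" for i :: nat
    by presburger
  then show ?thesis by metis
qed

lemma sum_less_8: "sum f {..<8::nat} = f 0 + f 1 + f 2 + f 3 + f 4 + f 5 + f 6 + (f 7 :: 'a::comm_monoid_add)"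
  by (simp add: eval_nat_numeral)

lemma sum_e8_basis:
  "(\<Sum>k<8. c k *\<^sub>R e8_basis e k)
     = (2 * c 0 - c 1 + c 7 / 2) *\<^sub>R e 0 + (c 1 - c 2 + c 7 / 2) *\<^sub>R e 1
     + (c 2 - c 3 + c 7 / 2) *\<^sub>R e 2 + (c 3 - c 4 + c 7 / 2) *\<^sub>R e 3
     + (c 4 - c 5 + c 7 / 2) *\<^sub>R e 4 + (c 5 - c 6 + c 7 / 2) *\<^sub>R e 5
     + (c 6 + c 7 / 2) *\<^sub>R e 6 + (c 7 / 2) *\<^sub>R (e 7 :: 'a::real_vector)"
  unfolding sum_less_8 e8_basis_def by (simp add: algebra_simps)

text \<open>The last coordinate gives \<open>c 7\<close>, and tail sums of the differences
  \<open>x i - x 7\<close> solve the telescoping equations. As \<open>c\<close> does not depend on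
  \<open>e\<close>, one computation serves both the frame found in a lattice and the standard
  axes.\<close>

lemma E8_coords_imp_e8_basis:
  assumes "E8_coords x"
  obtains c :: "nat \<Rightarrow> int" where "\<And>e :: nat \<Rightarrow> 'a::real_vector. (\<Sum>i<8. x i *\<^sub>R e i) = (\<Sum>k<8. of_int (c k) *\<^sub>R e8_basis e k)"
proof -
  obtain N :: int where N: "(\<Sum>i<8. x i) = 2 * of_int N" using assms by (auto simp: E8_coords_def)
  have "\<exists>h::int. 2 * x 7 = of_int h \<and> (\<forall>i<8. \<exists>m::int. x i - x 7 = of_int m)"
    using assms unfolding E8_coords_def
  proof (elim conjE disjE)
    assume *: "\<forall>i<8. \<exists>m::int. x i = of_int m"
    then obtain m where m: "\<And>i. i < 8 \<Longrightarrow> x i = of_int (m i :: int)" by metis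
    have "x i - x 7 = of_int (m i - m 7)" if "i < 8" for i using m[OF that] m[of 7] by simp
    moreover have "2 * x 7 = of_int (2 * m 7)" using m[of 7] by simp
    ultimately show ?thesis by blast
  next
    assume *: "\<forall>i<8. \<exists>m::int. x i = of_int m + 1 / 2"
    then obtain m where m: "\<And>i. i < 8 \<Longrightarrow> x i = of_int (m i :: int) + 1 / 2" by metis
    have "x i - x 7 = of_int (m i - m 7)" if "i < 8" for i using m[OF that] m[of 7] by simp
    moreover have "2 * x 7 = of_int (2 * m 7 + 1)" using m[of 7] by simp
    ultimately show ?thesis by blast
  qed
  then obtain h :: int and a :: "nat \<Rightarrow> int" where h: "2 * x 7 = of_int h"
    and a: "\<And>i. i < 8 \<Longrightarrow> x i - x 7 = of_int (a i)" by metis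
  \<comment> \<open>\<open>N - 2 * h\<close> is half the sum of the \<open>a i\<close>, because the
    eight terms h/2 contribute 4 h to the coordinate sum 2 N. Its integrality is the parity
    condition of E8.\<close>
  define c where "c k = (if k = 0 then N - 2 * h else if k = 7 then h else \<Sum>j=k..6. a j)" for k
  have x: "x i = of_int (a i) + of_int h / 2" if "i < 8" for i using a[OF that] h by simp
  have a7: "a 7 = 0" using a[of 7] by simp
  have S: "of_int (a 0) + of_int (a 1) + of_int (a 2) + of_int (a 3) + of_int (a 4) + of_int (a 5)
      + of_int (a 6) + 4 * of_int h = 2 * real_of_int N"
    using N unfolding sum_less_8 by (simp add: x a7)
  have c: "c 0 = N - 2 * h" "c 1 = a 1 + a 2 + a 3 + a 4 + a 5 + a 6" "c 2 = a 2 + a 3 + a 4 + a 5 + a 6"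
    "c 3 = a 3 + a 4 + a 5 + a 6" "c 4 = a 4 + a 5 + a 6" "c 5 = a 5 + a 6" "c 6 = a 6" "c 7 = h"
    by (simp_all add: c_def eval_nat_numeral sum.atLeast_Suc_atMost)
  have x0: "2 * of_int (c 0) - of_int (c 1) + of_int (c 7) / 2 = x 0"
    using S unfolding c by (simp add: x)
  have "(\<Sum>i<8. x i *\<^sub>R e i) = (\<Sum>k<8. of_int (c k) *\<^sub>R e8_basis e k)" for e :: "nat \<Rightarrow> 'a"
    unfolding sum_e8_basis x0 unfolding sum_less_8 c by (simp add: x a7)
  then show ?thesis by (rule that)
qed

lemma e8_basis_imp_E8_coords:
  fixes c :: "nat \<Rightarrow> int"
  obtains x where "E8_coords x" "\<And>e :: nat \<Rightarrow> 'a::real_vector. (\<Sum>i<8. x i *\<^sub>R e i) = (\<Sum>k<8. of_int (c k) *\<^sub>R e8_basis e k)"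
proof -
  define d where "d i = (if i = 0 then 2 * c 0 - c 1 else if i < 6 then c i - c (i + 1)
    else if i = 6 then c 6 else 0)" for i
  define x where "x i = of_int (d i) + of_int (c 7) / (2::real)" for i
  have "(\<Sum>i<8. x i) = 2 * of_int (c 0 + 2 * c 7)"
    unfolding sum_less_8 x_def d_def by (simp add: eval_nat_numeral)
  moreover have "(\<forall>i<8. \<exists>m::int. x i = of_int m) \<or> (\<forall>i<8. \<exists>m::int. x i = of_int m + 1 / 2)"
  proof (cases "even (c 7)")
    case True
    then obtain n where "c 7 = 2 * n" by blast
    then have "x i = of_int (d i + n)" for i by (simp add: x_def)
    then show ?thesis by blast
  next
    case False
    then obtain n where "c 7 = 2 * n + 1" by (rule oddE)
    then have "x i = of_int (d i + n) + 1 / 2" for i by (simp add: x_def field_simps)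
    then show ?thesis by blast
  qed
  ultimately have "E8_coords x" unfolding E8_coords_def by blast
  moreover have "(\<Sum>i<8. x i *\<^sub>R e i) = (\<Sum>k<8. of_int (c k) *\<^sub>R e8_basis e k)" for e :: "nat \<Rightarrow> 'a"
    unfolding sum_e8_basis unfolding sum_less_8 x_def d_def by (simp add: eval_nat_numeral)
  ultimately show ?thesis by (rule that)
qed

lemma e8_basis_e8_frame: "k < 8 \<Longrightarrow> e8_basis (e8_frame U) k = U k"
proof -
  have "\<forall>k<8. e8_basis (e8_frame U) k = U k"
    unfolding all_less_8 e8_basis_def sum_less_8 e8_frame_def
    by (simp add: eval_nat_numeral algebra_simps flip: scaleR_add_left)
  then show "k < 8 \<Longrightarrow> e8_basis (e8_frame U) k = U k" by blast
qed

lemma e8_frame_e8_basis: "k < 8 \<Longrightarrow> e8_frame (e8_basis e) k = e k"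
proof -
  have "\<forall>k<8. e8_frame (e8_basis e) k = e k"
    unfolding all_less_8 e8_frame_def e8_basis_def sum_less_8
    by (simp add: eval_nat_numeral algebra_simps flip: scaleR_add_left)
  then show "k < 8 \<Longrightarrow> e8_frame (e8_basis e) k = e k" by blast
qed

lemma norm_e8_basis_le:
  fixes e :: "nat \<Rightarrow> 'a::real_normed_vector"
  assumes "\<And>i. i < 8 \<Longrightarrow> norm (e i) \<le> B" "k < 8" 
  shows "norm (e8_basis e k) \<le> 4 * B"
proof -
  have B: "0 \<le> B" using order_trans[OF norm_ge_zero assms(1)[of 0]] by simp
  have "norm (e k - e (k - 1)) \<le> 2 * B"
    using norm_triangle_ineq4[of "e k" "e (k - 1)"] assms(1)[of k] assms(1)[of "k - 1"] assms(2) by fastforce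
  moreover have "norm (\<Sum>i<8. e i) \<le> 8 * B"
    using sum_norm_le[of "{..<8}" e "\<lambda>_. B"] assms(1) by simp
  moreover have "norm (e 0) \<le> B" using assms(1)[of 0] by simp
  ultimately show ?thesis using B unfolding e8_basis_def by auto
qed

lemma e8_basis_diff: "e8_basis (\<lambda>i. a i - q i) k = e8_basis a k - e8_basis q k"
  by (simp add: e8_basis_def scaleR_diff_right sum_subtractf)

lemma e8_basis_linear:
  assumes "linear f"
  shows "f (e8_basis e k) = e8_basis (\<lambda>i. f (e i)) k"
  using assms by (simp add: e8_basis_def linear_scale linear_diff linear_sum)

lemma tendsto_e8_frame:
  fixes U :: "nat \<Rightarrow> nat \<Rightarrow> 'a::real_normed_vector"
  assumes "\<And>i. i < 8 \<Longrightarrow> (\<lambda>n. U n i) \<longlonglongrightarrow> V i" "k < 8"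
  shows "(\<lambda>n. e8_frame (U n) k) \<longlonglongrightarrow> e8_frame V k"
  unfolding e8_frame_def
  using assms by (cases "k < 7") (auto intro!: tendsto_intros)

text \<open>In E8 the frame vectors have norm 1 and lie outside the lattice; only their doubles can
  be fed to the hypothesis on norms.\<close>

lemma (in full_lattice) e8_frame_in:
  assumes "\<And>i. i < 8 \<Longrightarrow> U i \<in> L" "k < 8"
  shows "2 *\<^sub>R e8_frame U k \<in> L"
proof -
  have p: "2 *\<^sub>R ((1 / 2) *\<^sub>R U 0 + (\<Sum>j<k. U (Suc j))) \<in> L" if "k < 7" for k
  proof -
    have "2 *\<^sub>R ((1 / 2) *\<^sub>R U 0 + (\<Sum>j<k. U (Suc j))) = U 0 + of_int 2 *\<^sub>R (\<Sum>j<k. U (Suc j))"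
      by (simp add: scaleR_add_right)
    also have "\<dots> \<in> L" using that assms(1) by (intro add scale_int sum_in) auto
    finally show ?thesis .
  qed
  show ?thesis
  proof (cases "k < 7")
    case True
    then show ?thesis using p by (simp add: e8_frame_def)
  next
    case False
    then have "2 *\<^sub>R e8_frame U k = of_int 4 *\<^sub>R U 7
        - (\<Sum>j<7. 2 *\<^sub>R ((1 / 2) *\<^sub>R U 0 + (\<Sum>i<j. U (Suc i))))"
      by (simp add: e8_frame_def scaleR_diff_right scaleR_sum_right)
    also have "\<dots> \<in> L" using assms(1) p by (intro diff scale_int sum_in) auto
    finally show ?thesis .
  qed
qed

text \<open>Self-duality of E8: a vector of \<open>L\<close> has integral inner products with D_8
  and with the half sum, which give the two conditions of \<open>E8_coords\<close>
  respectively.\<close>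

lemma (in even_lattice) lattice_eq_zspan_e8_basis:
  assumes e: "frame 8 e" and h: "(1 / 2) *\<^sub>R (\<Sum>i<8. e i) \<in> L"
  shows "L = zspan (e8_basis e) 8"
proof
  have "e8_basis e k \<in> L" if "k < 8" for k
  proof -
    have "e 0 + e 0 \<in> L" using frame_in[OF e, of 0] by simp
    then have "2 *\<^sub>R e 0 \<in> L" by (simp add: scaleR_2)
    moreover have "(e 0 + e k) - (e 0 + e (k - 1)) \<in> L"
      using frame_in[OF e] that by (intro diff) auto
    then have "e k - e (k - 1) \<in> L" by simp
    ultimately show ?thesis using h by (simp add: e8_basis_def)
  qed
  then show "zspan (e8_basis e) 8 \<subseteq> L" by (rule zspan_subset)
  show "L \<subseteq> zspan (e8_basis e) 8"
  proof
    fix y assume y: "y \<in> L"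
    have inj: "inj_on e {..<8}"
    proof (rule inj_onI)
      fix i j assume "i \<in> {..<8::nat}" "j \<in> {..<8}" "e i = e j"
      then show "i = j" using frame_inner[OF e, of i j] frame_inner[OF e, of j j] by (auto split: if_splits)
    qed
    have "pairwise orthogonal (e ` {..<8})"
      using frame_inner[OF e] by (auto simp: pairwise_def orthogonal_def)
    moreover have "0 \<notin> e ` {..<8}" using frame_inner[OF e] by force
    ultimately have "independent (e ` {..<8})" by (rule pairwise_orthogonal_independent)
    then have "dim (e ` {..<8}) = 8" using inj by (simp add: dim_eq_card_independent card_image)
    then have "span (e ` {..<8}) = UNIV" using dim_eq_full[of "e ` {..<8}"] by simp
    then obtain t where t: "y = (\<Sum>i<8. t i *\<^sub>R e i)" using span_image_lessThan[of y e 8] by blast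
    have te: "t i = y \<bullet> e i" if "i < 8" for i using frame_combination_inner[OF e that, of t] t by simp
    have "E8_coords t"
    proof -
      obtain N :: int where N: "y \<bullet> ((1 / 2) *\<^sub>R (\<Sum>i<8. e i)) = of_int N" using inner_int[OF y h] .
      have "(\<Sum>i<8. t i) = (\<Sum>i<8. y \<bullet> e i)" by (rule sum.cong) (auto simp: te)
      then have "(\<Sum>i<8. t i) = 2 * of_int N" using N by (simp add: inner_sum_right)
      moreover have "(\<forall>i<8. \<exists>m::int. t i = of_int m) \<or> (\<forall>i<8. \<exists>m::int. t i = of_int m + 1 / 2)"
        by (cases rule: frame_types[OF e zero_less_numeral y, case_names int half])
          (use te in auto)
      ultimately show ?thesis unfolding E8_coords_def by blast
    qed
    then obtain c :: "nat \<Rightarrow> int" where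
      "\<And>e :: nat \<Rightarrow> real ^ 8. (\<Sum>i<8. t i *\<^sub>R e i) = (\<Sum>k<8. of_int (c k) *\<^sub>R e8_basis e k)"
      using E8_coords_imp_e8_basis[of t] by blast
    then show "y \<in> zspan (e8_basis e) 8" unfolding t by (intro zspanI)
  qed
qed

lemma E8_basis:
  fixes g :: "8 \<Rightarrow> nat"
  assumes g: "bij_betw g UNIV {..<8}"
  shows "is_lattice_basis (\<lambda>i. e8_basis (\<lambda>k. axis (inv_into UNIV g k) 1) (g i)) E8_lattice"
proof -
  let ?ax = "\<lambda>k. axis (inv_into UNIV g k) 1 :: real ^ 8"
  let ?h = "inv_into UNIV g"
  have hg: "?h (g i) = i" for i using g by (simp add: bij_betw_def)
  have gl: "g i < 8" for i using bij_betwE[OF g] by auto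
  have h: "bij_betw ?h {..<8} UNIV" using g by (rule bij_betw_inv_into)
  have gh: "g (?h k) = k" if "k < 8" for k
    using bij_betw_inv_into_right[OF g] that by auto
  have ev: "x = (\<Sum>k<8. (x $ ?h k) *\<^sub>R ?ax k)" for x :: "real ^ 8"
  proof -
    have "(\<Sum>k<8. (x $ ?h k) *\<^sub>R ?ax k) = (\<Sum>i\<in>UNIV. (x $ i) *\<^sub>R axis i 1)"
      using sum.reindex_bij_betw[OF h, of "\<lambda>i. (x $ i) *\<^sub>R axis i 1"] by simp
    also have "\<dots> = x" using basis_expansion[of x] by (simp add: scalar_mult_eq_scaleR)
    finally show ?thesis ..
  qed
  have comp: "(\<Sum>k<8. t k *\<^sub>R ?ax k) $ ?h j = t j" if "j < 8" for t j
  proof -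
    have "(\<Sum>k<8. t k *\<^sub>R ?ax k) $ ?h j = (\<Sum>k<8. if k = j then t k else 0)"
      unfolding sum_component
      by (rule sum.cong) (use gh that in \<open>auto simp: axis_def\<close>, metis gh)
    then show ?thesis using that by simp
  qed
  have E: "x \<in> E8_lattice \<longleftrightarrow> E8_coords (\<lambda>k. x $ ?h k)" for x
  proof -
    have all: "(\<forall>i. P i) \<longleftrightarrow> (\<forall>k<8. P (?h k))" for P using hg gl by metis
    have "(\<Sum>i\<in>UNIV. x $ i) = (\<Sum>k<8. x $ ?h k)"
      using sum.reindex_bij_betw[OF h, of "\<lambda>i. x $ i"] by simp
    moreover have "r \<in> \<int> \<longleftrightarrow> (\<exists>m::int. r = of_int m)" for r :: real by (auto elim: Ints_cases)
    ultimately show ?thesis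
      unfolding E8_lattice_def E8_coords_def mem_Collect_eq
      using all[of "\<lambda>i. x $ i \<in> \<int>"] all[of "\<lambda>i. \<exists>m::int. x $ i = of_int m + 1 / 2"] by simp
  qed
  have "E8_lattice = zspan (e8_basis ?ax) 8"
  proof (intro equalityI subsetI)
    fix x :: "real ^ 8" assume "x \<in> E8_lattice"
    then have "E8_coords (\<lambda>k. x $ ?h k)" by (simp add: E)
    then obtain c :: "nat \<Rightarrow> int" where
      "\<And>e :: nat \<Rightarrow> real ^ 8. (\<Sum>i<8. (x $ ?h i) *\<^sub>R e i) = (\<Sum>k<8. of_int (c k) *\<^sub>R e8_basis e k)"
      using E8_coords_imp_e8_basis[of "\<lambda>k. x $ ?h k"] by blast
    then have "x = (\<Sum>k<8. of_int (c k) *\<^sub>R e8_basis ?ax k)" using ev[of x] by metis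
    then show "x \<in> zspan (e8_basis ?ax) 8" by (rule zspanI)
  next
    fix x assume "x \<in> zspan (e8_basis ?ax) 8"
    then obtain c :: "nat \<Rightarrow> int" where c: "x = (\<Sum>k<8. of_int (c k) *\<^sub>R e8_basis ?ax k)" by (auto simp: zspan_def)
    obtain t where t: "E8_coords t"
      "\<And>e :: nat \<Rightarrow> real ^ 8. (\<Sum>i<8. t i *\<^sub>R e i) = (\<Sum>k<8. of_int (c k) *\<^sub>R e8_basis e k)"
      using e8_basis_imp_E8_coords[of c] by blast
    have "x $ ?h j = t j" if "j < 8" for j unfolding c t(2)[symmetric] using comp[OF that] .
    then show "x \<in> E8_lattice" using t(1) unfolding E E8_coords_def by simp
  qed
  moreover have "bij_betw g UNIV {..<CARD(8)}" using g by simp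
  ultimately show ?thesis using basis_zspan[of g "e8_basis ?ax"] by simp
qed

section \<open>Stability of orthonormalisation\<close>

text \<open>Gram-Schmidt with errors. If the first n vectors are within K of orthonormal ones, the
  next has inner products at most 3 K with these, hence a component of length at most 8 * 3 K = 24
  K. The rest has length within 25 K of 1, and normalising it gives 49 K, rounded up to 64
  K.\<close>

lemma orthonormal_stable:
  fixes a :: "nat \<Rightarrow> 'a::real_inner"
  assumes "\<And>i j. i < n \<Longrightarrow> j < n \<Longrightarrow> \<bar>a i \<bullet> a j - (if i = j then 1 else 0)\<bar> \<le> d"
    and "0 \<le> d" "64 ^ n * d \<le> 1 / 2" "n \<le> 8"
  shows "\<exists>q. (\<forall>i<n. \<forall>j<n. q i \<bullet> q j = (if i = j then 1 else 0)) \<and> (\<forall>i<n. norm (a i - q i) \<le> 64 ^ n * d)"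
  using assms
proof (induction n)
  case 0
  then show ?case by simp
next
  case (Suc n)
  define K where "K = 64 ^ n * d"
  have "1 * d \<le> 64 ^ n * d" using Suc.prems(2) by (intro mult_right_mono) auto
  then have dK: "d \<le> K" by (simp add: K_def)
  have K: "0 \<le> K" "64 * K \<le> 1 / 2" using Suc.prems(2,3) by (simp_all add: K_def)
  obtain q where q: "\<And>i j. i < n \<Longrightarrow> j < n \<Longrightarrow> q i \<bullet> q j = (if i = j then 1 else 0)"
    "\<And>i. i < n \<Longrightarrow> norm (a i - q i) \<le> K"
    using Suc.IH[OF Suc.prems(1) Suc.prems(2)] K Suc.prems(4) unfolding K_def by force
  have an: "\<bar>(norm (a n))\<^sup>2 - 1\<bar> \<le> d" using Suc.prems(1)[of n n] by (simp add: power2_norm_eq_inner)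
  have an1: "\<bar>norm (a n) - 1\<bar> \<le> d"
  proof -
    have "\<bar>norm (a n) - 1\<bar> * 1 \<le> \<bar>norm (a n) - 1\<bar> * (norm (a n) + 1)"
      by (intro mult_left_mono) auto
    also have "\<dots> = \<bar>(norm (a n) - 1) * (norm (a n) + 1)\<bar>"
      by (simp add: abs_mult)
    also have "\<dots> \<le> d" using an by (simp add: algebra_simps power2_eq_square)
    finally show ?thesis by simp
  qed
  then have an2: "norm (a n) \<le> 2" using dK K by linarith
  have ip: "\<bar>a n \<bullet> q i\<bar> \<le> 3 * K" if "i < n" for i
  proof -
    have "a n \<bullet> q i = a n \<bullet> a i - a n \<bullet> (a i - q i)" by (simp add: inner_diff_right)
    moreover have "\<bar>a n \<bullet> a i\<bar> \<le> d" using Suc.prems(1)[of n i] that by simp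
    moreover have "\<bar>a n \<bullet> (a i - q i)\<bar> \<le> norm (a n) * norm (a i - q i)" by (rule Cauchy_Schwarz_ineq2)
    moreover have "norm (a n) * norm (a i - q i) \<le> 2 * K"
      using an2 q(2)[OF that] by (intro mult_mono) auto
    ultimately show ?thesis using dK by linarith
  qed
  define s where "s = (\<Sum>i<n. (a n \<bullet> q i) *\<^sub>R q i)"
  define r where "r = a n - s"
  have "norm s \<le> (\<Sum>i<n. 3 * K)" unfolding s_def
  proof (rule sum_norm_le)
    fix i assume i: "i \<in> {..<n}"
    have "norm (q i) = 1" using q(1)[of i i] i by (simp add: norm_eq_sqrt_inner)
    then show "norm ((a n \<bullet> q i) *\<^sub>R q i) \<le> 3 * K" using ip i by simp
  qed
  also have "\<dots> \<le> 8 * (3 * K)"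
    using mult_right_mono[of "real n" 8 K] Suc.prems(4) K by (simp add: mult.commute)
  finally have s: "norm s \<le> 24 * K" by simp
  have rn: "\<bar>norm r - 1\<bar> \<le> 25 * K"
    using norm_triangle_ineq3[of "a n" r] an1 dK s by (simp add: r_def)
  then have r0: "norm r > 0" using K by linarith
  define p where "p = (1 / norm r) *\<^sub>R r"
  have rq: "r \<bullet> q j = 0" if "j < n" for j
  proof -
    have "s \<bullet> q j = (\<Sum>i<n. if i = j then a n \<bullet> q i else 0)"
      unfolding s_def inner_sum_left by (rule sum.cong) (use q(1) that in auto)
    then show ?thesis using that by (simp add: r_def inner_diff_left)
  qed
  have pp: "p \<bullet> p = 1" using r0 by (simp add: p_def dot_square_norm power2_eq_square)
  have pq: "p \<bullet> q j = 0" "q j \<bullet> p = 0" if "j < n" for j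
    using rq[OF that] by (simp_all add: p_def inner_commute)
  have "norm (r - p) = \<bar>norm r - 1\<bar>"
  proof -
    have "r - p = (1 - 1 / norm r) *\<^sub>R r" by (simp add: p_def algebra_simps)
    then have "norm (r - p) = \<bar>1 - 1 / norm r\<bar> * norm r" by simp
    also have "\<dots> = \<bar>(1 - 1 / norm r) * norm r\<bar>" by (simp add: abs_mult)
    also have "(1 - 1 / norm r) * norm r = norm r - 1" using r0 by (simp add: field_simps)
    finally show ?thesis .
  qed
  then have "norm (a n - p) \<le> 49 * K"
    using norm_triangle_ineq[of s "r - p"] s rn by (simp add: r_def)
  then have np: "norm (a n - p) \<le> 64 * K" using K by linarith
  show ?case
  proof (intro exI[of _ "q(n := p)"] conjI allI impI)
    fix i j assume "i < Suc n" "j < Suc n"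
    then show "(q(n := p)) i \<bullet> (q(n := p)) j = (if i = j then 1 else 0)"
      using q(1) pp pq by (auto simp: less_Suc_eq)
  next
    fix i assume "i < Suc n"
    then show "norm (a i - (q(n := p)) i) \<le> 64 ^ Suc n * d"
      using q(2)[of i] np K by (auto simp: less_Suc_eq K_def)
  qed
qed

section \<open>Bounded bases\<close>

context full_lattice
begin

lemma hkz_exists:
  obtains b where "hkz L b DIM('a)"
proof -
  obtain x where x: "minv L (span ((\<lambda>_. 0) ` {..<0::nat})) x"
    using minv_exists[of 0 "\<lambda>_. 0"] by auto
  obtain m where m: "DIM('a) = Suc m" using DIM_positive gr0_implies_Suc by blast
  have "hkz L (\<lambda>_. 0) 0" by (simp add: hkz_def)
  from hermite[OF this x, of m] m show ?thesis using that by auto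
qed

lemma gsn_lower:
  assumes b: "hkz L b k" and short: "\<And>x. x \<in> L \<Longrightarrow> x \<noteq> 0 \<Longrightarrow> norm x \<ge> 1" and i: "i < k"
  shows "(3 / 4) ^ i \<le> gsn b i"
  using i
proof (induction i)
  case 0
  then have "b 0 \<in> L" "b 0 \<noteq> 0" using b by (auto simp: hkz_def minv_def)
  then have "1 \<le> (norm (b 0))\<^sup>2" using short[of "b 0"] by (simp add: power2_eq_square mult_ge1_I)
  moreover have "perp (span {}) (b 0) = b 0"
    by (rule perp_span_unique) (auto simp: span_zero)
  ultimately show ?case by (simp add: gsn_def del: span_empty)
next
  case (Suc i)
  have "minv L (span (b ` {..<i})) (b i)" "minv L (span (insert (b i) (span (b ` {..<i})))) (b (Suc i))"
    using b Suc.prems unfolding hkz_def span_image_Suc[symmetric] by auto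
  then have "3 / 4 * gsn b i \<le> gsn b (Suc i)"
    unfolding gsn_def span_image_Suc by (intro minv_step) auto
  then show ?case using Suc by simp
qed

text \<open>Rounding by earlier vectors changes neither minimality nor spans. The new length is at
  most B plus half the geometric sum of the earlier bounds, that is B (2^k + 1) / 2.\<close>

lemma hkz_size_reduce:
  assumes b0: "hkz L b0 n" and B: "\<And>i. i < n \<Longrightarrow> norm (perp (span (b0 ` {..<i})) (b0 i)) \<le> B" "0 \<le> B"
    and k: "k \<le> n"
  shows "\<exists>b. hkz L b k \<and> span (b ` {..<k}) = span (b0 ` {..<k}) \<and> (\<forall>i<k. norm (b i) \<le> B * 2 ^ i)"
  using k
proof (induction k)
  case 0
  then show ?case by (simp add: hkz_def)
next
  case (Suc k)
  then obtain b where b: "hkz L b k" "span (b ` {..<k}) = span (b0 ` {..<k})"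
    "\<And>i. i < k \<Longrightarrow> norm (b i) \<le> B * 2 ^ i" by auto
  let ?S = "span (b ` {..<k})"
  have S: "subspace ?S" by simp
  have x: "minv L ?S (b0 k)" using b0 Suc.prems unfolding b(2) hkz_def by simp
  obtain z where z: "z \<in> zspan b k" "norm (b0 k - perp ?S (b0 k) - z) \<le> (\<Sum>i<k. norm (b i)) / 2"
    using zspan_approx[OF perp_in[OF S]] by blast
  have zS: "z \<in> ?S" using z(1) by (auto simp: zspan_def intro!: span_sum span_scale intro: span_base)
  have zL: "z \<in> L" using zspan_subset[of k b] hkz_in[OF b(1)] z(1) by blast
  have m: "minv L ?S (b0 k - z)"
    using minv_translate[OF S x, of "- z"] zS zL neg by (simp add: span_neg)
  have sp: "span (insert (b0 k - z) ?S) = span (insert (b0 k) ?S)"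
  proof -
    have "b0 k - z \<in> span (insert (b0 k) ?S)"
      using zS by (intro span_diff) (auto intro: span_base)
    moreover have "(b0 k - z) + z \<in> span (insert (b0 k - z) ?S)"
      using zS by (intro span_add) (auto intro: span_base)
    ultimately show ?thesis unfolding span_eq by (auto intro: span_base)
  qed
  have "(\<Sum>i<k. norm (b i)) \<le> (\<Sum>i<k. B * 2 ^ i)" using b(3) by (intro sum_mono) auto
  also have "\<dots> = B * (2 ^ k - 1)" by (induction k) (simp_all add: algebra_simps)
  finally have "(\<Sum>i<k. norm (b i)) / 2 \<le> B * (2 ^ k - 1) / 2" by simp
  moreover have "norm (b0 k - z) \<le> norm (perp ?S (b0 k)) + norm (b0 k - perp ?S (b0 k) - z)"
    using norm_triangle_ineq[of "perp ?S (b0 k)" "b0 k - perp ?S (b0 k) - z"] by simp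
  moreover have "norm (perp ?S (b0 k)) \<le> B" unfolding b(2) using B Suc.prems by simp
  ultimately have "norm (b0 k - z) \<le> B + B * (2 ^ k - 1) / 2" using z(2) by linarith
  also have "\<dots> \<le> B * 2 ^ k" using B(2) mult_left_mono[of 1 "2 ^ k" B] by (simp add: field_simps)
  finally have nk: "norm (b0 k - z) \<le> B * 2 ^ k" .
  show ?case
  proof (intro exI[of _ "b(k := b0 k - z)"] conjI allI impI)
    show "hkz L (b(k := b0 k - z)) (Suc k)" using hkz_upd[OF b(1) m] .
    show "span ((b(k := b0 k - z)) ` {..<Suc k}) = span (b0 ` {..<Suc k})"
      unfolding span_image_Suc using sp b(2) by (simp add: image_upd_lessThan del: fun_upd_apply) simp
    show "norm ((b(k := b0 k - z)) i) \<le> B * 2 ^ i" if "i < Suc k" for i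
      using that b(3) nk by (auto simp: less_Suc_eq)
  qed
qed

end

lemma lattice_det_zspan:
  fixes b :: "nat \<Rightarrow> real ^ 'n" and g :: "'n \<Rightarrow> nat"
  assumes "bij_betw g UNIV {..<CARD('n)}" "span (zspan b CARD('n)) = UNIV"
  shows "lattice_det (zspan b CARD('n)) = \<bar>det (\<chi> i. b (g i))\<bar>"
  using lattice_det_eq[OF basis_zspan[OF assms(1)] assms(2)] .

text \<open>The upper bound on lengths gives compactness, the lower bound on the covolume keeps the
  limit nondegenerate.\<close>

lemma bounded_basis:
  fixes L :: "(real ^ 8) set"
  assumes L: "full_lattice L" and det: "lattice_det L \<le> 10 / 9"
    and short: "\<And>x. x \<in> L \<Longrightarrow> x \<noteq> 0 \<Longrightarrow> norm x \<ge> 1"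
  obtains b where "L = zspan b 8" "\<And>i. i < 8 \<Longrightarrow> norm (b i) \<le> 2 ^ 13"
    "(3 / 4) ^ 28 \<le> (lattice_det L)\<^sup>2" "0 \<le> lattice_det L"
proof -
  interpret full_lattice L by fact
  obtain b0 where "hkz L b0 DIM(real ^ 8)" by (rule hkz_exists)
  then have b0: "hkz L b0 8" by simp
  have lo: "(3 / 4) ^ i \<le> gsn b0 i" if "i < 8" for i using gsn_lower[OF b0 short that] .
  have cv: "(lattice_det L)\<^sup>2 = (\<Prod>i<8. gsn b0 i)" using covolume_hkz[OF L, of b0] b0 by simp
  obtain g :: "8 \<Rightarrow> nat" where g: "bij_betw g UNIV {..<CARD(8)}"
    using ex_bij_betw_finite_nat[of "UNIV :: 8 set"] by (auto simp: atLeast0LessThan)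
  have "L = zspan b0 CARD(8)" using zspan_eq[of b0] b0 by simp
  then have d0: "0 \<le> lattice_det L" using lattice_det_zspan[OF g, of b0] full by simp
  have "(\<Prod>i<8. (3 / 4) ^ i) \<le> (\<Prod>i<8. gsn b0 i)" using lo by (intro prod_mono) auto
  moreover have "(\<Prod>i<8. (3 / 4 :: real) ^ i) = (3 / 4) ^ 28"
    by (simp add: eval_nat_numeral power_divide)
  ultimately have d1: "(3 / 4) ^ 28 \<le> (lattice_det L)\<^sup>2" using cv by simp
  \<comment> \<open>All other factors of the squared covolume are bounded below, which leaves at
    most (100/81) (4/3)^28 < 4096 = 64^2.\<close>
  have up: "gsn b0 j \<le> 4096" if j: "j < 8" for j
  proof -
    have pos: "gsn b0 i > 0" if "i < 8" for i using gsn_pos[OF b0 that] .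
    have "(\<Prod>i\<in>{..<8}-{j}. (3 / 4 :: real) ^ i) \<le> (\<Prod>i\<in>{..<8}-{j}. gsn b0 i)"
      using lo by (intro prod_mono) auto
    moreover have "(3 / 4 :: real) ^ 28 \<le> (\<Prod>i\<in>{..<8}-{j}. (3 / 4 :: real) ^ i)"
    proof -
      have "(3 / 4 :: real) ^ 28 = (3 / 4) ^ j * (\<Prod>i\<in>{..<8}-{j}. (3 / 4 :: real) ^ i)"
        using prod.remove[of "{..<8}" j "\<lambda>i. (3 / 4 :: real) ^ i"] j
          \<open>(\<Prod>i<8. (3 / 4 :: real) ^ i) = (3 / 4) ^ 28\<close> by simp
      also have "\<dots> \<le> 1 * (\<Prod>i\<in>{..<8}-{j}. (3 / 4 :: real) ^ i)"
        by (intro mult_right_mono power_le_one prod_nonneg) auto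
      finally show ?thesis by simp
    qed
    ultimately have "gsn b0 j * (3 / 4) ^ 28 \<le> gsn b0 j * (\<Prod>i\<in>{..<8}-{j}. gsn b0 i)"
      using pos[OF j] by (intro mult_left_mono) auto
    also have "\<dots> = (lattice_det L)\<^sup>2" unfolding cv using prod.remove[of "{..<8}" j "gsn b0"] j by simp
    also have "\<dots> \<le> (10 / 9)\<^sup>2" using det d0 by (intro power_mono)
    finally show ?thesis by (simp add: power_divide)
  qed
  have "norm (perp (span (b0 ` {..<i})) (b0 i)) \<le> 64" if "i < 8" for i
  proof (rule power2_le_imp_le)
    show "(norm (perp (span (b0 ` {..<i})) (b0 i)))\<^sup>2 \<le> 64\<^sup>2"
      using up[OF that] unfolding gsn_def by simp
  qed simp
  from hkz_size_reduce[OF b0 this] obtain b where b: "hkz L b 8" "\<And>i. i < 8 \<Longrightarrow> norm (b i) \<le> 64 * 2 ^ i"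
    by force
  have "norm (b i) \<le> 2 ^ 13" if "i < 8" for i
  proof -
    have "(2::real) ^ i \<le> 2 ^ 7" using that by (intro power_increasing) auto
    then show ?thesis using b(2)[OF that] by simp
  qed
  moreover have "L = zspan b 8" using zspan_eq[of b] b(1) by simp
  ultimately show ?thesis using that d0 d1 by blast
qed

section \<open>Limits of nearly even lattices\<close>

lemma zspan_zero: "0 \<in> zspan b k"
  by (rule zspanI[of _ "\<lambda>_. 0"]) simp

lemma zspan_add: "x \<in> zspan b k \<Longrightarrow> y \<in> zspan b k \<Longrightarrow> x + y \<in> zspan b k"
proof -
  assume "x \<in> zspan b k" "y \<in> zspan b k"
  then obtain c d where "x = (\<Sum>i<k. of_int (c i) *\<^sub>R b i)" "y = (\<Sum>i<k. of_int (d i) *\<^sub>R b i)"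
    by (auto simp: zspan_def)
  then show ?thesis
    by (intro zspanI[where c = "\<lambda>i. c i + d i"]) (simp add: scaleR_add_left sum.distrib)
qed

lemma zspan_scale: "x \<in> zspan b k \<Longrightarrow> of_int n *\<^sub>R x \<in> zspan b k"
proof -
  assume "x \<in> zspan b k"
  then obtain c where "x = (\<Sum>i<k. of_int (c i) *\<^sub>R b i)" by (auto simp: zspan_def)
  then show ?thesis
    by (intro zspanI[where c = "\<lambda>i. n * c i"]) (simp add: scaleR_sum_right)
qed

lemma zspan_minimal:
  assumes "\<And>i. i < m \<Longrightarrow> v i \<in> zspan b k"
  shows "zspan v m \<subseteq> zspan b k"
proof -
  have "(\<Sum>i<l. of_int (c i) *\<^sub>R v i) \<in> zspan b k" if "l \<le> m" for c :: "nat \<Rightarrow> int" and l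
    using that by (induction l) (auto intro!: zspan_zero zspan_add zspan_scale assms)
  then show ?thesis by (auto simp: zspan_def)
qed

lemma zspan_base: "i < k \<Longrightarrow> b i \<in> zspan b k"
  by (rule zspanI[where c = "\<lambda>j. if j = i then 1 else 0"]) (simp add: if_distrib if_distribR cong: if_cong)

text \<open>The integers form a closed set, so approximate evenness becomes exact in the
  limit.\<close>

lemma norm_sq_limit_even:
  fixes v :: "nat \<Rightarrow> 'a::real_inner"
  assumes v: "v \<longlonglongrightarrow> w" and e: "e \<longlonglongrightarrow> 0"
    and k: "\<And>n. \<exists>k::nat. \<bar>(norm (v n))\<^sup>2 - 2 * real k\<bar> \<le> e n"
  shows "\<exists>k::int. w \<bullet> w = 2 * of_int k"
proof -
  obtain k where k: "\<And>n. \<bar>(norm (v n))\<^sup>2 - 2 * real (k n)\<bar> \<le> e n" using k by metis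
  have "(\<lambda>n. (norm (v n))\<^sup>2 - 2 * real (k n)) \<longlonglongrightarrow> 0"
    by (rule Lim_null_comparison[OF _ e]) (simp add: k)
  from tendsto_diff[OF tendsto_power[OF tendsto_norm[OF v], of 2] this]
  have "(\<lambda>n. 2 * real (k n)) \<longlonglongrightarrow> (norm w)\<^sup>2" by simp
  from tendsto_mult_left[OF this, of "1 / 2"] have "(\<lambda>n. real (k n)) \<longlonglongrightarrow> (norm w)\<^sup>2 / 2" by simp
  moreover have "closed (range of_int :: real set)" by (rule closed_of_int_image)
  moreover have "real (k n) \<in> range of_int" for n by (metis of_int_of_nat_eq rangeI)
  ultimately have "(norm w)\<^sup>2 / 2 \<in> range of_int" by (metis closed_sequentially)
  then show ?thesis by (auto simp: power2_norm_eq_inner field_simps)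
qed

text \<open>The step that restores the rate: eventually the squared norm of \<open>v n\<close> is
  within 1/2 both of 2 m and of some 2 k, so k = m and the error is \<open>e n\<close>. The bound 8
  keeps \<open>v n\<close> inside the radius and covers the largest norm needed, that of 2 (f i + f
  j).\<close>

lemma eventually_norm_sq_near:
  fixes v :: "nat \<Rightarrow> 'a::real_inner"
  assumes v: "v \<longlonglongrightarrow> w" and e: "e \<longlonglongrightarrow> 0" and w: "w \<bullet> w = 2 * real m" "w \<bullet> w \<le> 8"
    and k: "\<And>n. norm (v n) \<le> 2 ^ 16 \<Longrightarrow> \<exists>k::nat. \<bar>(norm (v n))\<^sup>2 - 2 * real k\<bar> \<le> e n"
  shows "eventually (\<lambda>n. \<bar>v n \<bullet> v n - w \<bullet> w\<bar> \<le> e n) sequentially"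
proof -
  have lim: "(\<lambda>n. v n \<bullet> v n) \<longlonglongrightarrow> w \<bullet> w" using v by (intro tendsto_inner)
  have "eventually (\<lambda>n. dist (v n \<bullet> v n) (w \<bullet> w) < 1 / 2) sequentially"
    using tendstoD[OF lim, of "1 / 2"] by simp
  moreover have "eventually (\<lambda>n. dist (e n) 0 < 1 / 2) sequentially" using tendstoD[OF e, of "1 / 2"] by simp
  ultimately show ?thesis
  proof eventually_elim
    case (elim n)
    have "v n \<bullet> v n \<le> 9" using elim(1) w(2) unfolding dist_real_def by linarith
    then have "(norm (v n))\<^sup>2 \<le> (2 ^ 16)\<^sup>2" by (simp add: power2_norm_eq_inner)
    then have "norm (v n) \<le> 2 ^ 16" by (rule power2_le_imp_le) simp
    then obtain k :: nat where kn: "\<bar>(norm (v n))\<^sup>2 - 2 * real k\<bar> \<le> e n" using k by blast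
    then have "\<bar>2 * real k - 2 * real m\<bar> < 1"
      using elim unfolding w(1) power2_norm_eq_inner dist_real_def by linarith
    then have "k = m" by linarith
    then show ?case using kn w(1) by (simp add: power2_norm_eq_inner)
  qed
qed

lemma tendsto_det:
  fixes M :: "nat \<Rightarrow> real ^ 'n ^ 'n"
  assumes "M \<longlonglongrightarrow> N"
  shows "(\<lambda>n. det (M n)) \<longlonglongrightarrow> det N"
  unfolding det_def by (intro tendsto_intros assms)

lemma discrete_if_separated:
  fixes L :: "'a::real_normed_vector set"
  assumes "\<And>x y. x \<in> L \<Longrightarrow> y \<in> L \<Longrightarrow> x - y \<in> L" "\<And>x. x \<in> L \<Longrightarrow> x \<noteq> 0 \<Longrightarrow> norm x \<ge> 1"
  shows "discrete L"
proof -
  have "x isolated_in L" if "x \<in> L" for x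
    unfolding isolated_in_dist_Ex_iff
  proof (intro conjI exI[of _ 1] ballI impI)
    fix y assume "y \<in> L" "dist x y < 1"
    then show "y = x" using assms(1)[of x y] assms(2)[of "x - y"] that by (force simp: dist_norm)
  qed (use that in auto)
  then show ?thesis by (simp add: discrete_def)
qed

lemma zspan_even:
  fixes b :: "nat \<Rightarrow> 'a::real_inner"
  assumes diag: "\<And>i. i < n \<Longrightarrow> \<exists>k::int. b i \<bullet> b i = 2 * of_int k"
    and off: "\<And>i j. i < n \<Longrightarrow> j < n \<Longrightarrow> \<exists>k::int. b i \<bullet> b j = of_int k"
    and x: "x \<in> zspan b n"
  shows "\<exists>k::int. x \<bullet> x = 2 * of_int k"
proof -
  have "(\<exists>k::int. y \<bullet> y = 2 * of_int k) \<and> (\<forall>j<n. \<exists>k::int. y \<bullet> b j = of_int k)"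
    if "l \<le> n" "y \<in> zspan b l" for l y
    using that
  proof (induction l arbitrary: y)
    case 0
    then show ?case by (auto simp: zspan_def intro: exI[of _ 0])
  next
    case (Suc l)
    then obtain m :: int where m: "y - of_int m *\<^sub>R b l \<in> zspan b l" by (auto simp: zspan_Suc)
    define z where "z = y - of_int m *\<^sub>R b l"
    have y: "y = z + of_int m *\<^sub>R b l" by (simp add: z_def)
    obtain k where k: "z \<bullet> z = 2 * of_int (k::int)" and j: "\<And>j. j < n \<Longrightarrow> \<exists>k::int. z \<bullet> b j = of_int k"
      using Suc.IH[of z] Suc.prems m unfolding z_def by auto
    obtain p q :: int where p: "z \<bullet> b l = of_int p" and q: "b l \<bullet> b l = 2 * of_int q"
      using j[of l] diag[of l] Suc.prems by auto
    have "y \<bullet> y = 2 * of_int (k + m * p + m * m * q)"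
      unfolding y by (simp add: inner_add_left inner_add_right k p q inner_commute[of "b l" z] algebra_simps)
    moreover have "\<exists>k::int. y \<bullet> b i = of_int k" if i: "i < n" for i
    proof -
      obtain r s :: int where "z \<bullet> b i = of_int r" "b l \<bullet> b i = of_int s"
        using j[OF i] off[of l i] i Suc.prems by auto
      then have "y \<bullet> b i = of_int (r + m * s)" unfolding y by (simp add: inner_add_left)
      then show ?thesis ..
    qed
    ultimately show ?case by blast
  qed
  from this[of n x] x show ?thesis by simp
qed

lemma limit_lattice:
  fixes B :: "nat \<Rightarrow> nat \<Rightarrow> real ^ 8" and b :: "nat \<Rightarrow> real ^ 8"
  assumes L: "\<And>n. full_lattice (zspan (B n) 8)"
    and near: "\<And>n x. x \<in> zspan (B n) 8 \<Longrightarrow> norm x \<le> 2 ^ 16 \<Longrightarrow>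
        \<exists>k::nat. \<bar>(norm x)\<^sup>2 - 2 * real k\<bar> \<le> e n"
    and e: "e \<longlonglongrightarrow> 0"
    and B: "\<And>n i. i < 8 \<Longrightarrow> norm (B n i) \<le> 2 ^ 13"
    and det: "\<And>n. (3 / 4) ^ 28 \<le> (lattice_det (zspan (B n) 8))\<^sup>2"
      "\<And>n. (lattice_det (zspan (B n) 8))\<^sup>2 \<le> 100 / 81"
    and lim: "\<And>i. i < 8 \<Longrightarrow> (\<lambda>n. B n i) \<longlonglongrightarrow> b i"
  obtains f U where "\<And>i j. i < 8 \<Longrightarrow> j < 8 \<Longrightarrow> f i \<bullet> f j = (if i = j then 1 else (0::real))"
    "\<And>n. zspan (U n) 8 = zspan (B n) 8" "\<And>k. k < 8 \<Longrightarrow> (\<lambda>n. U n k) \<longlonglongrightarrow> e8_basis f k"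
proof -
  obtain g :: "8 \<Rightarrow> nat" where g: "bij_betw g UNIV {..<CARD(8)}"
    using ex_bij_betw_finite_nat[of "UNIV :: 8 set"] by (auto simp: atLeast0LessThan)
  have gl: "g i < 8" for i using bij_betwE[OF g] by simp
  let ?L = "zspan b 8"
  define M where "M n = (\<chi> i. B n (g i))" for n
  define N where "N = (\<chi> i. b (g i))"
  have MN: "M \<longlonglongrightarrow> N"
    unfolding M_def N_def by (rule vec_tendstoI) (simp add: lim gl)
  have dM: "(det (M n))\<^sup>2 = (lattice_det (zspan (B n) 8))\<^sup>2" for n
    using lattice_det_zspan[OF g, of "B n"] full_lattice.full[OF L[of n]] by (simp add: M_def)
  have dlim: "(\<lambda>n. (det (M n))\<^sup>2) \<longlonglongrightarrow> (det N)\<^sup>2" by (intro tendsto_power tendsto_det MN)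
  have dN: "(3 / 4) ^ 28 \<le> (det N)\<^sup>2" "(det N)\<^sup>2 \<le> 100 / 81"
    by (rule LIMSEQ_le_const[OF dlim] LIMSEQ_le_const2[OF dlim]; use det in \<open>simp add: dM\<close>)+
  have N0: "det N \<noteq> 0"
  proof
    assume "det N = 0"
    then have "(3 / 4 :: real) ^ 28 \<le> 0" using dN(1) by simp
    then show False using zero_less_power[of "3 / 4 :: real" 28] by linarith
  qed
  then obtain N' where N': "N' ** N = mat 1" "N ** N' = mat 1"
    using invertible_det_nz[of N] unfolding invertible_def by blast
  have "rows N \<subseteq> ?L"
    using zspan_base[OF gl, of b] by (auto simp: rows_def row_def N_def vec_nth_inverse)
  moreover have "span (rows N) = UNIV" using N'(1) matrix_left_invertible_span_rows by blast
  ultimately have full: "span ?L = UNIV" using span_mono by blast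
  \<comment> \<open>\<open>t = 0\<close> gives the norms and \<open>t = 1\<close> the sums used for
    polarisation; both have length at most 2^14.\<close>
  have half: "\<exists>k::int. (b i + t *\<^sub>R b j) \<bullet> (b i + t *\<^sub>R b j) = 2 * of_int k"
    if "i < 8" "j < 8" "t = 0 \<or> t = 1" for i j t
  proof (rule norm_sq_limit_even[OF _ e])
    show "(\<lambda>n. B n i + t *\<^sub>R B n j) \<longlonglongrightarrow> b i + t *\<^sub>R b j" using lim that by (intro tendsto_intros) auto
    fix n
    have "B n i + t *\<^sub>R B n j \<in> zspan (B n) 8"
      using that zspan_base[of i 8 "B n"] zspan_base[of j 8 "B n"] by (auto intro: zspan_add)
    moreover have "norm (B n i + t *\<^sub>R B n j) \<le> 2 ^ 16"
      using B[of i n] B[of j n] that norm_triangle_ineq[of "B n i" "B n j"] by auto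
    ultimately show "\<exists>k::nat. \<bar>(norm (B n i + t *\<^sub>R B n j))\<^sup>2 - 2 * real k\<bar> \<le> e n" by (rule near)
  qed
  have diag: "\<exists>k::int. b i \<bullet> b i = 2 * of_int k" if "i < 8" for i using half[of i i 0] that by simp
  have off: "\<exists>k::int. b i \<bullet> b j = of_int k" if ij: "i < 8" "j < 8" for i j
  proof -
    obtain p q r :: int where "b i \<bullet> b i = 2 * of_int p" "b j \<bullet> b j = 2 * of_int q"
      "(b i + b j) \<bullet> (b i + b j) = 2 * of_int r" using diag ij half[OF ij, of 1] by force
    then have "b i \<bullet> b j = of_int (r - p - q)"
      by (simp add: inner_add_left inner_add_right inner_commute[of "b j" "b i"])
    then show ?thesis ..
  qed
  have even: "\<exists>k::int. x \<bullet> x = 2 * of_int k" if "x \<in> ?L" for x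
    using zspan_even[OF diag off that] .
  have one: "norm x \<ge> 1" if xL: "x \<in> ?L" "x \<noteq> 0" for x
  proof -
    obtain k :: int where k: "x \<bullet> x = 2 * of_int k" using even[OF xL(1)] by blast
    moreover have "x \<bullet> x > 0" using xL by simp
    ultimately have "k \<ge> 1" by simp
    then have "1\<^sup>2 \<le> (norm x)\<^sup>2" using k by (simp add: power2_norm_eq_inner)
    then show ?thesis by (rule power2_le_imp_le) simp
  qed
  have neg: "- x \<in> ?L" if "x \<in> ?L" for x using zspan_scale[OF that, of "-1"] by simp
  have diff: "x - y \<in> ?L" if "x \<in> ?L" "y \<in> ?L" for x y using zspan_add[OF that(1) neg[OF that(2)]] by simp
  interpret even_lattice ?L
  proof
    show "discrete ?L" using discrete_if_separated[of ?L] diff one by blast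
    show "(lattice_det ?L)\<^sup>2 \<le> 100 / 81"
      using lattice_det_zspan[OF g, of b] full dN(2) by (simp add: N_def)
  qed (use zspan_zero zspan_add neg full even in auto)
  obtain f where f: "frame 8 f" "(1 / 2) *\<^sub>R (\<Sum>i<8. f i) \<in> ?L" by (rule ex_E8_frame)
  have Lf: "?L = zspan (e8_basis f) 8" using lattice_eq_zspan_e8_basis[OF f] .
  have "\<exists>c::nat \<Rightarrow> int. e8_basis f k = (\<Sum>j<8. of_int (c j) *\<^sub>R b j)" if "k < 8" for k
    using zspan_base[OF that, of "e8_basis f"] unfolding Lf[symmetric] by (auto simp: zspan_def)
  then obtain C :: "nat \<Rightarrow> nat \<Rightarrow> int" where C: "\<And>k. k < 8 \<Longrightarrow> e8_basis f k = (\<Sum>j<8. of_int (C k j) *\<^sub>R b j)"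
    by metis
  have "\<exists>c::nat \<Rightarrow> int. b j = (\<Sum>k<8. of_int (c k) *\<^sub>R e8_basis f k)" if "j < 8" for j
    using zspan_base[OF that, of b] unfolding Lf by (auto simp: zspan_def)
  then obtain D :: "nat \<Rightarrow> nat \<Rightarrow> int" where D: "\<And>j. j < 8 \<Longrightarrow> b j = (\<Sum>k<8. of_int (D j k) *\<^sub>R e8_basis f k)"
    by metis
  have swap: "(\<Sum>k<8. of_int (D j k) *\<^sub>R (\<Sum>l<8. of_int (C k l) *\<^sub>R v l))
      = (\<Sum>l<8. of_int (\<Sum>k<8. D j k * C k l) *\<^sub>R v l)" for j and v :: "nat \<Rightarrow> real ^ 8"
    unfolding scaleR_sum_right by (subst sum.swap) (simp add: scaleR_sum_left)
  have indep: "t l = 0" if t: "(\<Sum>l<8. t l *\<^sub>R b l) = 0" and l: "l < 8" for t l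
  proof -
    define \<tau> :: "real ^ 8" where "\<tau> = (\<chi> i. t (g i))"
    have "\<tau> v* N = (\<Sum>i\<in>UNIV. t (g i) *\<^sub>R b (g i))"
      by (simp add: vector_matrix_mult_def \<tau>_def N_def vec_eq_iff)
    also have "\<dots> = (\<Sum>l<8. t l *\<^sub>R b l)"
      using sum.reindex_bij_betw[OF g, of "\<lambda>l. t l *\<^sub>R b l"] by simp
    finally have "\<tau> v* N = 0" using t by simp
    then have "\<tau> v* (N ** N') = 0" by (metis vector_matrix_mul_assoc vector_matrix_mult_0)
    then have "\<tau> = 0" unfolding N' by simp
    moreover obtain i where "g i = l"
    proof -
      have "l \<in> range g" using bij_betw_imp_surj_on[OF g] l by simp
      then show ?thesis using that by blast
    qed
    ultimately show ?thesis unfolding \<tau>_def by (auto simp: vec_eq_iff)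
  qed
  \<comment> \<open>Independence of the limit basis turns the round trip through the E8 basis into
    an identity between integer matrices, which can then be applied to every
    \<open>B n\<close>.\<close>
  have DC: "(\<Sum>k<8. D j k * C k l) = (if l = j then 1 else 0)" if "j < 8" "l < 8" for j l
  proof -
    have "b j = (\<Sum>k<8. of_int (D j k) *\<^sub>R (\<Sum>l<8. of_int (C k l) *\<^sub>R b l))"
      unfolding D[OF that(1)] by (rule sum.cong) (simp_all add: C)
    then have "b j = (\<Sum>l<8. of_int (\<Sum>k<8. D j k * C k l) *\<^sub>R b l)" unfolding swap .
    moreover have "b j = (\<Sum>l<8. (if l = j then 1 else 0) *\<^sub>R b l)"
      using that by (simp add: if_distrib if_distribR cong: if_cong)
    ultimately have "(\<Sum>l<8. (of_int (\<Sum>k<8. D j k * C k l) - (if l = j then 1 else 0)) *\<^sub>R b l) = 0"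
      unfolding scaleR_diff_left sum_subtractf by simp
    from indep[OF this that(2)]
    have "of_int (\<Sum>k<8. D j k * C k l) = (of_int (if l = j then 1 else 0) :: real)" 
      by (cases "l = j") (simp_all del: of_int_sum)
    then show ?thesis unfolding of_int_eq_iff .
  qed
  \<comment> \<open>The change of basis found in the limit; \<open>D\<close> undoes it, so the
    generated lattice stays the same.\<close>
  define U where "U n k = (\<Sum>j<8. of_int (C k j) *\<^sub>R B n j)" for n k
  have "zspan (U n) 8 = zspan (B n) 8" for n
  proof (intro equalityI zspan_minimal)
    show "U n k \<in> zspan (B n) 8" for k unfolding U_def by (rule zspanI) simp
    fix j :: nat assume j: "j < 8"
    have "(\<Sum>k<8. of_int (D j k) *\<^sub>R U n k) = (\<Sum>l<8. of_int (\<Sum>k<8. D j k * C k l) *\<^sub>R B n l)"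
      unfolding U_def swap ..
    also have "\<dots> = (\<Sum>l<8. if l = j then B n l else 0)"
      by (rule sum.cong) (use DC[OF j] in auto)
    also have "\<dots> = B n j" using j by simp
    finally show "B n j \<in> zspan (U n) 8" by (intro zspanI[where c = "D j"]) simp
  qed
  moreover have "(\<lambda>n. U n k) \<longlonglongrightarrow> e8_basis f k" if "k < 8" for k
    unfolding U_def C[OF that] by (intro tendsto_intros lim) auto
  ultimately show ?thesis using that[of f U] frame_inner[OF f(1)] by blast
qed

section \<open>Lattices close to the E8 lattice\<close>

text \<open>The orthonormal vectors near \<open>e8_frame U\<close> become the columns of \<Phi>.
  Passing from frame to basis multiplies errors by at most 4, in total 4 * 64^8 = 2^50.\<close>

lemma nearby_E8_basis:
  fixes U :: "nat \<Rightarrow> real ^ 8"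
  assumes L: "L = zspan U 8"
    and a: "\<And>i j. i < 8 \<Longrightarrow> j < 8 \<Longrightarrow> \<bar>e8_frame U i \<bullet> e8_frame U j - (if i = j then 1 else 0)\<bar> \<le> \<epsilon>"
    and \<epsilon>: "0 \<le> \<epsilon>" "64 ^ 8 * \<epsilon> \<le> 1 / 2"
  shows "\<exists>(\<Phi> :: real ^ 8 ^ 8) (u :: 8 \<Rightarrow> real ^ 8) (z :: 8 \<Rightarrow> real ^ 8).
    orthogonal_matrix \<Phi> \<and> is_lattice_basis u L \<and> is_lattice_basis z E8_lattice \<and>
    Max (range (\<lambda>i. norm (z i))) = 2 \<and> (\<forall>i. norm (u i - \<Phi> *v z i) \<le> 2 ^ 1000 * \<epsilon>)"
proof -
  obtain g :: "8 \<Rightarrow> nat" where g: "bij_betw g UNIV {..<CARD(8)}"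
    using ex_bij_betw_finite_nat[of "UNIV :: 8 set"] by (auto simp: atLeast0LessThan)
  have g8: "bij_betw g UNIV {..<8}" using g by simp
  have gl: "g i < 8" for i using bij_betwE[OF g8] by simp
  let ?h = "inv_into UNIV g"
  have gh: "g (?h k) = k" if "k < 8" for k using bij_betw_inv_into_right[OF g8] that by simp
  obtain i0 where i0: "g i0 = 0" using gh[of 0] by auto
  let ?ax = "\<lambda>k. axis (?h k) 1 :: real ^ 8"
  obtain q where q: "\<And>i j. i < 8 \<Longrightarrow> j < 8 \<Longrightarrow> q i \<bullet> q j = (if i = j then 1 else 0)"
    "\<And>i. i < 8 \<Longrightarrow> norm (e8_frame U i - q i) \<le> 64 ^ 8 * \<epsilon>"
  proof -
    have "\<exists>q. (\<forall>i<8. \<forall>j<8. q i \<bullet> q j = (if i = j then 1 else 0)) \<and>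
        (\<forall>i<8. norm (e8_frame U i - q i) \<le> 64 ^ 8 * \<epsilon>)"
      by (rule orthonormal_stable[OF a \<epsilon>]) simp_all
    then show thesis using that by blast
  qed
  define \<Phi> :: "real ^ 8 ^ 8" where "\<Phi> = (\<chi> r c. q (g c) $ r)"
  have col: "column i \<Phi> = q (g i)" for i by (simp add: column_def \<Phi>_def vec_eq_iff)
  have inj: "g i = g j \<Longrightarrow> i = j" for i j using g8 by (auto simp: bij_betw_def inj_on_def)
  have "orthogonal_matrix \<Phi>"
    unfolding orthogonal_matrix_orthonormal_columns col orthogonal_def norm_eq_1
    using q(1)[OF gl gl] inj by auto
  moreover have "is_lattice_basis (\<lambda>i. U (g i)) L" using basis_zspan[OF g, of U] L by simp
  moreover have "is_lattice_basis (\<lambda>i. e8_basis ?ax (g i)) E8_lattice" using E8_basis[OF g8] .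
  moreover have "Max (range (\<lambda>i. norm (e8_basis ?ax (g i)))) = 2"
  proof (rule Max_eqI)
    have ax: "?ax i \<bullet> ?ax j = (if i = j then 1 else 0)" if "i < 8" "j < 8" for i j
      using gh that by (auto simp: inner_axis_axis) (metis gh)
    fix y assume "y \<in> range (\<lambda>i. norm (e8_basis ?ax (g i)))"
    then obtain i where y: "y = norm (e8_basis ?ax (g i))" by blast
    define k where "k = g i"
    have k: "k < 8" using gl by (simp add: k_def)
    have s: "(\<Sum>i<8. ?ax i) \<bullet> (\<Sum>i<8. ?ax i) = 8"
    proof -
      have "(\<Sum>i<8. ?ax i) \<bullet> (\<Sum>i<8. ?ax i) = (\<Sum>i<8::nat. \<Sum>j<8::nat. if j = i then 1 else 0)"
        unfolding inner_sum_left inner_sum_right by (intro sum.cong refl) (simp add: ax)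
      then show ?thesis by simp
    qed
    have "e8_basis ?ax k \<bullet> e8_basis ?ax k \<le> 4"
      unfolding e8_basis_def using k s ax[of k k] ax[of "k - 1" "k - 1"] ax[of k "k - 1"] ax[of "k - 1" k]
      by (simp add: inner_diff_left inner_diff_right)
    then have "(norm (e8_basis ?ax k))\<^sup>2 \<le> 2\<^sup>2" by (simp add: power2_norm_eq_inner)
    then show "y \<le> 2" unfolding y k_def by (rule power2_le_imp_le) simp
  next
    have "norm (e8_basis ?ax (g i0)) = 2" by (simp add: i0 e8_basis_def)
    then show "2 \<in> range (\<lambda>i. norm (e8_basis ?ax (g i)))" by (metis rangeI)
  qed simp
  moreover have "norm (U (g i) - \<Phi> *v e8_basis ?ax (g i)) \<le> 2 ^ 1000 * \<epsilon>" for i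
  proof -
    have "\<Phi> *v ?ax k = q k" if "k < 8" for k
      unfolding matrix_vector_mult_basis col gh[OF that] ..
    then have "e8_basis (\<lambda>k. \<Phi> *v ?ax k) (g i) = e8_basis q (g i)"
      using gl[of i] by (auto simp: e8_basis_def intro!: sum.cong)
    then have "\<Phi> *v e8_basis ?ax (g i) = e8_basis q (g i)"
      using e8_basis_linear[OF matrix_vector_mul_linear[of \<Phi>], of ?ax "g i"] by simp
    then have "U (g i) - \<Phi> *v e8_basis ?ax (g i) = e8_basis (\<lambda>k. e8_frame U k - q k) (g i)"
      by (simp add: e8_basis_diff e8_basis_e8_frame[OF gl])
    then have "norm (U (g i) - \<Phi> *v e8_basis ?ax (g i)) \<le> 4 * (64 ^ 8 * \<epsilon>)"
      using norm_e8_basis_le[of "\<lambda>k. e8_frame U k - q k", OF q(2) gl[of i]] by simp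
    also have "\<dots> = 2 ^ 50 * \<epsilon>" by simp
    also have "\<dots> \<le> 2 ^ 1000 * \<epsilon>"
      using \<epsilon>(1) by (intro mult_right_mono power_increasing) auto
    finally show ?thesis .
  qed
  ultimately show ?thesis by blast
qed

text \<open>Doubled frame vectors and their sums for distinct indices are lattice vectors whose
  squared norms tend to 4 and 8. Polarising with these norms bounds the errors by e/4 on the
  diagonal and 3e/8 off it, where e stands for \<open>e n\<close>.\<close>

lemma eventually_nearly_orthonormal:
  fixes U :: "nat \<Rightarrow> nat \<Rightarrow> real ^ 8"
  assumes L: "\<And>n. full_lattice (zspan (U n) 8)"
    and near: "\<And>n x. x \<in> zspan (U n) 8 \<Longrightarrow> norm x \<le> 2 ^ 16 \<Longrightarrow>
        \<exists>k::nat. \<bar>(norm x)\<^sup>2 - 2 * real k\<bar> \<le> e n"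
    and e: "e \<longlonglongrightarrow> 0"
    and f: "\<And>i j. i < 8 \<Longrightarrow> j < 8 \<Longrightarrow> f i \<bullet> f j = (if i = j then 1 else (0::real))"
    and lim: "\<And>k. k < 8 \<Longrightarrow> (\<lambda>n. U n k) \<longlonglongrightarrow> e8_basis f k"
    and ij: "i < 8" "j < 8"
  shows "eventually (\<lambda>n. \<bar>e8_frame (U n) i \<bullet> e8_frame (U n) j - (if i = j then 1 else 0)\<bar> \<le> e n) sequentially"
proof -
  define a where "a n k = e8_frame (U n) k" for n k
  have alim: "(\<lambda>n. a n k) \<longlonglongrightarrow> f k" if "k < 8" for k
    using tendsto_e8_frame[of U "e8_basis f", OF lim that] unfolding a_def e8_frame_e8_basis[OF that] .
  have aL: "2 *\<^sub>R a n k \<in> zspan (U n) 8" if "k < 8" for n k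
    unfolding a_def by (rule full_lattice.e8_frame_in[OF L zspan_base that])
  have sq: "eventually (\<lambda>n. \<bar>(2 *\<^sub>R a n k) \<bullet> (2 *\<^sub>R a n k) - 4\<bar> \<le> e n) sequentially" if k: "k < 8" for k
  proof -
    have w: "(2 *\<^sub>R f k) \<bullet> (2 *\<^sub>R f k) = 4" using f[OF k k] by simp
    have "eventually (\<lambda>n. \<bar>(2 *\<^sub>R a n k) \<bullet> (2 *\<^sub>R a n k) - (2 *\<^sub>R f k) \<bullet> (2 *\<^sub>R f k)\<bar> \<le> e n) sequentially"
    proof (rule eventually_norm_sq_near[OF _ e, where m = 2])
      show "(\<lambda>n. 2 *\<^sub>R a n k) \<longlonglongrightarrow> 2 *\<^sub>R f k" by (intro tendsto_intros alim k)
      show "\<exists>m::nat. \<bar>(norm (2 *\<^sub>R a n k))\<^sup>2 - 2 * real m\<bar> \<le> e n"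
        if "norm (2 *\<^sub>R a n k) \<le> 2 ^ 16" for n using near[OF aL[OF k] that] .
    qed (use w in linarith)+
    then show ?thesis unfolding w .
  qed
  show ?thesis unfolding a_def[symmetric]
  proof (cases "i = j")
    case True
    have "eventually (\<lambda>n. \<bar>a n i \<bullet> a n i - 1\<bar> \<le> e n) sequentially"
      using sq[OF ij(1)] by eventually_elim (simp add: abs_if split: if_splits)
    then show "eventually (\<lambda>n. \<bar>a n i \<bullet> a n j - (if i = j then 1 else 0)\<bar> \<le> e n) sequentially"
      using True by simp
  next
    case False
    have w: "(2 *\<^sub>R f i + 2 *\<^sub>R f j) \<bullet> (2 *\<^sub>R f i + 2 *\<^sub>R f j) = 8"
      using f[OF ij(1) ij(1)] f[OF ij(2) ij(2)] f[OF ij] f[OF ij(2) ij(1)] False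
      by (simp add: inner_add_left inner_add_right)
    have "eventually (\<lambda>n. \<bar>(2 *\<^sub>R a n i + 2 *\<^sub>R a n j) \<bullet> (2 *\<^sub>R a n i + 2 *\<^sub>R a n j)
        - (2 *\<^sub>R f i + 2 *\<^sub>R f j) \<bullet> (2 *\<^sub>R f i + 2 *\<^sub>R f j)\<bar> \<le> e n) sequentially"
    proof (rule eventually_norm_sq_near[OF _ e, where m = 4])
      show "(\<lambda>n. 2 *\<^sub>R a n i + 2 *\<^sub>R a n j) \<longlonglongrightarrow> 2 *\<^sub>R f i + 2 *\<^sub>R f j" by (intro tendsto_intros alim ij)
      show "\<exists>m::nat. \<bar>(norm (2 *\<^sub>R a n i + 2 *\<^sub>R a n j))\<^sup>2 - 2 * real m\<bar> \<le> e n"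
        if "norm (2 *\<^sub>R a n i + 2 *\<^sub>R a n j) \<le> 2 ^ 16" for n
        using near[OF zspan_add[OF aL[OF ij(1)] aL[OF ij(2)]] that] .
    qed (use w in linarith)+
    then have "eventually (\<lambda>n. \<bar>(2 *\<^sub>R a n i + 2 *\<^sub>R a n j) \<bullet> (2 *\<^sub>R a n i + 2 *\<^sub>R a n j) - 8\<bar> \<le> e n) sequentially"
      unfolding w .
    then have "eventually (\<lambda>n. \<bar>a n i \<bullet> a n j\<bar> \<le> e n) sequentially"
      using sq[OF ij(1)] sq[OF ij(2)]
    proof eventually_elim
      case (elim n)
      have "(2 *\<^sub>R a n i + 2 *\<^sub>R a n j) \<bullet> (2 *\<^sub>R a n i + 2 *\<^sub>R a n j)
          = (2 *\<^sub>R a n i) \<bullet> (2 *\<^sub>R a n i) + (2 *\<^sub>R a n j) \<bullet> (2 *\<^sub>R a n j) + 8 * (a n i \<bullet> a n j)"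
        by (simp add: inner_add_left inner_add_right inner_commute[of "a n j" "a n i"])
      then show ?case using elim by linarith
    qed
    then show "eventually (\<lambda>n. \<bar>a n i \<bullet> a n j - (if i = j then 1 else 0)\<bar> \<le> e n) sequentially"
      using False by simp
  qed
qed

theorem proposition3p2:
  shows "\<exists>\<epsilon>\<^sub>0 > (0::real). \<forall>\<epsilon>. 0 < \<epsilon> \<and> \<epsilon> < \<epsilon>\<^sub>0 \<longrightarrow>
    (\<forall>L :: (real ^ 8) set.
       is_lattice L \<longrightarrow>
       lattice_det L \<le> 10 / 9 \<longrightarrow>
       (\<forall>x \<in> L - {0}. norm x \<le> 2 ^ 16 \<longrightarrow>
          (\<exists>k::nat. k > 0 \<and> \<bar>(norm x)\<^sup>2 - 2 * real k\<bar> \<le> \<epsilon>)) \<longrightarrow>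
       (\<exists>(\<Phi> :: real ^ 8 ^ 8) (u :: 8 \<Rightarrow> real ^ 8) (z :: 8 \<Rightarrow> real ^ 8).
          orthogonal_matrix \<Phi> \<and>
          is_lattice_basis u L \<and>
          is_lattice_basis z E8_lattice \<and>
          Max (range (\<lambda>i. norm (z i))) = 2 \<and>
          (\<forall>i. norm (u i - \<Phi> *v z i) \<le> 2 ^ 1000 * \<epsilon>)))"
proof (rule ccontr)
  define good where "good \<epsilon> L \<longleftrightarrow> (\<exists>(\<Phi> :: real ^ 8 ^ 8) (u :: 8 \<Rightarrow> real ^ 8) (z :: 8 \<Rightarrow> real ^ 8).
    orthogonal_matrix \<Phi> \<and> is_lattice_basis u L \<and> is_lattice_basis z E8_lattice \<and>
    Max (range (\<lambda>i. norm (z i))) = 2 \<and> (\<forall>i. norm (u i - \<Phi> *v z i) \<le> 2 ^ 1000 * \<epsilon>))"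
    for \<epsilon> and L :: "(real ^ 8) set"
  define near where "near \<epsilon> L \<longleftrightarrow> (\<forall>x \<in> L - {0}. norm x \<le> 2 ^ 16 \<longrightarrow>
    (\<exists>k::nat. k > 0 \<and> \<bar>(norm x)\<^sup>2 - 2 * real k\<bar> \<le> \<epsilon>))" for \<epsilon> and L :: "(real ^ 8) set"
  assume "\<not> ?thesis"
  then have "\<forall>\<epsilon>\<^sub>0 > 0. \<exists>\<epsilon> L. 0 < \<epsilon> \<and> \<epsilon> < \<epsilon>\<^sub>0 \<and> is_lattice L \<and> lattice_det L \<le> 10 / 9 \<and>
      near \<epsilon> L \<and> \<not> good \<epsilon> L"
    unfolding good_def[symmetric] near_def[symmetric] by blast
  then have "\<exists>\<epsilon> L. 0 < \<epsilon> \<and> \<epsilon> < inverse (real (Suc n)) \<and> is_lattice L \<and> lattice_det L \<le> 10 / 9 \<and>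
      near \<epsilon> L \<and> \<not> good \<epsilon> L" for n by simp
  then obtain \<epsilon> L where \<epsilon>: "\<And>n. 0 < \<epsilon> n" "\<And>n. \<epsilon> n < inverse (real (Suc n))"
    and L: "\<And>n. is_lattice (L n)" "\<And>n. lattice_det (L n) \<le> 10 / 9" "\<And>n. near (\<epsilon> n) (L n)"
    and bad: "\<And>n. \<not> good (\<epsilon> n) (L n)" by metis
  have full: "full_lattice (L n)" for n
    using L(1)[of n] unfolding is_lattice_def additive_subgroup_set_def full_lattice_def by blast
  \<comment> \<open>Admitting k = 0 includes the zero vector, so the limit argument applies to all
    combinations uniformly.\<close>
  have near0: "\<exists>k::nat. \<bar>(norm x)\<^sup>2 - 2 * real k\<bar> \<le> \<epsilon> n" if "x \<in> L n" "norm x \<le> 2 ^ 16" for x n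
  proof (cases "x = 0")
    case True
    then show ?thesis using \<epsilon>(1)[of n] by (intro exI[of _ 0]) simp
  next
    case False
    then show ?thesis using L(3)[of n] that unfolding near_def by blast
  qed
  have short: "norm x \<ge> 1" if x: "x \<in> L n" "x \<noteq> 0" for x n
  proof (cases "norm x \<le> 2 ^ 16")
    case True
    then obtain k :: nat where k: "k > 0" "\<bar>(norm x)\<^sup>2 - 2 * real k\<bar> \<le> \<epsilon> n"
      using L(3)[of n] x unfolding near_def by blast
    \<comment> \<open>With k at least 1 and an error below 1, the squared norm is at least 2 -
      1.\<close>
    have "inverse (real (Suc n)) \<le> 1" by (simp add: inverse_le_1_iff)
    then have "1\<^sup>2 \<le> (norm x)\<^sup>2" using k \<epsilon>(2)[of n] by simp
    then show ?thesis by (rule power2_le_imp_le) simp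
  qed simp
  have "\<exists>b. L n = zspan b 8 \<and> (\<forall>i<8. norm (b i) \<le> 2 ^ 13) \<and>
      (3 / 4) ^ 28 \<le> (lattice_det (L n))\<^sup>2 \<and> 0 \<le> lattice_det (L n)" for n
    by (rule bounded_basis[OF full[of n] L(2)[of n] short[of _ n]]) blast+
  then obtain B where B: "\<And>n. L n = zspan (B n) 8" "\<And>n i. i < 8 \<Longrightarrow> norm (B n i) \<le> 2 ^ 13"
    "\<And>n. (3 / 4) ^ 28 \<le> (lattice_det (L n))\<^sup>2" "\<And>n. 0 \<le> lattice_det (L n)" by metis
  have d2: "(lattice_det (L n))\<^sup>2 \<le> 100 / 81" for n
    using power_mono[OF L(2) B(4), of n 2] by (simp add: power_divide)
  obtain g :: "8 \<Rightarrow> nat" where g: "bij_betw g UNIV {..<CARD(8)}"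
    using ex_bij_betw_finite_nat[of "UNIV :: 8 set"] by (auto simp: atLeast0LessThan)
  have gl: "g i < 8" for i using bij_betwE[OF g] by simp
  \<comment> \<open>One matrix holds all eight vectors, so a single convergent subsequence
    suffices.\<close>
  define M :: "nat \<Rightarrow> real ^ 8 ^ 8" where "M n = (\<chi> i. B n (g i))" for n
  have "norm (M n) \<le> (\<Sum>i\<in>(UNIV :: 8 set). 2 ^ 13)" for n
  proof -
    have "norm (M n) \<le> (\<Sum>i\<in>UNIV. norm (M n $ i))"
      by (subst norm_vec_def) (rule L2_set_le_sum, simp)
    also have "\<dots> \<le> (\<Sum>i\<in>(UNIV :: 8 set). 2 ^ 13)"
      unfolding M_def vec_lambda_beta by (intro sum_mono B(2) gl)
    finally show ?thesis .
  qed
  then have "bounded (range M)" unfolding bounded_iff by blast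
  then obtain N r where r: "strict_mono r" "(M \<circ> r) \<longlonglongrightarrow> N"
    using bounded_imp_convergent_subsequence by blast
  define b where "b k = N $ inv_into UNIV g k" for k
  have lim: "(\<lambda>n. B (r n) k) \<longlonglongrightarrow> b k" if "k < 8" for k
  proof -
    have "g (inv_into UNIV g k) = k" using bij_betw_inv_into_right[OF g] that by simp
    then show ?thesis
      using tendsto_vec_nth[OF r(2), of "inv_into UNIV g k"] by (simp add: M_def b_def)
  qed
  have "\<epsilon> \<longlonglongrightarrow> 0"
    by (rule Lim_null_comparison[OF _ LIMSEQ_inverse_real_of_nat])
      (use \<epsilon> in \<open>auto intro!: always_eventually simp: less_imp_le\<close>)
  then have e: "(\<lambda>n. \<epsilon> (r n)) \<longlonglongrightarrow> 0" using LIMSEQ_subseq_LIMSEQ[OF _ r(1)] by (auto simp: o_def)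
  obtain f U where f: "\<And>i j. i < 8 \<Longrightarrow> j < 8 \<Longrightarrow> f i \<bullet> f j = (if i = j then 1 else (0::real))"
    and U: "\<And>n. zspan (U n) 8 = zspan (B (r n)) 8" "\<And>k. k < 8 \<Longrightarrow> (\<lambda>n. U n k) \<longlonglongrightarrow> e8_basis f k"
  proof (rule limit_lattice[of "\<lambda>n. B (r n)", OF _ _ e _ _ _ lim])
    show "full_lattice (zspan (B (r n)) 8)" for n using full B(1) by metis
    show "\<exists>k::nat. \<bar>(norm x)\<^sup>2 - 2 * real k\<bar> \<le> \<epsilon> (r n)"
      if "x \<in> zspan (B (r n)) 8" "norm x \<le> 2 ^ 16" for n x using near0 that B(1) by blast
    show "(3 / 4) ^ 28 \<le> (lattice_det (zspan (B (r n)) 8))\<^sup>2"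
      "(lattice_det (zspan (B (r n)) 8))\<^sup>2 \<le> 100 / 81" for n using B(3) d2 B(1) by metis+
  qed (use B(2) in blast)+
  have UL: "zspan (U n) 8 = L (r n)" for n using U(1) B(1) by simp
  have "eventually (\<lambda>n. \<forall>i\<in>{..<8}. \<forall>j\<in>{..<8}.
      \<bar>e8_frame (U n) i \<bullet> e8_frame (U n) j - (if i = j then 1 else 0)\<bar> \<le> \<epsilon> (r n)) sequentially"
    by (intro eventually_ball_finite ballI finite_lessThan eventually_nearly_orthonormal[OF _ _ e f U(2)])
      (use full near0 UL in auto)
  \<comment> \<open>2^49 is 2 * 64^8, the smallness required by the eight Gram-Schmidt
    steps.\<close>
  moreover have "eventually (\<lambda>n. \<epsilon> (r n) < 1 / 2 ^ 49) sequentially"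
    using order_tendstoD(2)[OF e, of "1 / 2 ^ 49"] by simp
  ultimately have "eventually (\<lambda>n. good (\<epsilon> (r n)) (L (r n))) sequentially"
  proof eventually_elim
    case (elim n)
    show ?case unfolding good_def
      by (rule nearby_E8_basis[OF UL[symmetric]])
        (use elim \<epsilon>(1)[of "r n"] in \<open>auto simp: less_imp_le\<close>)
  qed
  then show False using bad by (auto dest: eventually_happens)
qed

end
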